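(* Let $0<\alpha<1$ and let $X$ and $\{X_{i,j}: i,j\ge1\}$ be i.i.d. real random variables. If $$E\,|X|^{2/\alpha}(\log^+|X|)^{-1/\alpha}<\infty,\quad E(X)=0,\quad E(X^2)=\sigma^2,$$ then $$\limsup_{m,n\to\infty}\frac{T_{(m,n),(m+m^{\alpha},\,n+n/\log n)}}{\sqrt{2m^{\alpha}n\,\frac{(1-\alpha)\log(mn)}{\log n}}}=\sigma\quad\text{a.s.}$$ Conversely, if $$P\Big(\limsup_{m,n\to\infty}\frac{|T_{(m,n),(m+m^{\alpha},\,n+n/\log n)}|}{\sqrt{m^{\alpha}n\,\frac{\log(mn)}{\log n}}}<\infty\Big)>0,$$ then $E\,|X|^{2/\alpha}(\log^+|X|)^{-1/\alpha}<\infty$ and $E(X)=0$.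
   Context: The window (delayed sum) is $$T_{(m,n),(m+m^{\alpha},\,n+n/\log n)}=\sum_{\substack{m\le i\le m+m^{\alpha}\\ n\le j\le n+n/\log n}}X_{i,j},$$ where $i,j$ range over positive integers (quantities such as $m^\alpha$ and $n/\log n$ are treated as integers for convenience). The limit $m,n\to\infty$ means that both $m\to\infty$ and $n\to\infty$, i.e. $\limsup_{m,n\to\infty}$ is $\lim_{k\to\infty}\sup_{m,n\ge k}$. Here $\log^+x=\max\{\log x,1\}$ for $x>0$ (with value $1$ at $0$); $\sigma=\sqrt{\sigma^2}\ge 0$. *)

theory Defs
  imports "HOL-Probability.Probability"
begin

definition log_plus :: "real \<Rightarrow> real" where
  "log_plus x = max (ln x) 1"

text \<open>The window is cut out by real inequalities, so no rounding of the side lengths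
  is needed; the numbers of summands in the two directions are
  floor(m powr \<alpha>) + 1 and floor(n / ln n) + 1.\<close>

definition delayed_sum ::
    "real \<Rightarrow> (nat \<times> nat \<Rightarrow> 'a \<Rightarrow> real) \<Rightarrow> nat \<Rightarrow> nat \<Rightarrow> 'a \<Rightarrow> real" where
  "delayed_sum \<alpha> X m n \<omega> =
     (\<Sum>i\<in>{i. 1 \<le> i \<and> m \<le> i \<and> real i \<le> real m + real m powr \<alpha>}.
      \<Sum>j\<in>{j. 1 \<le> j \<and> n \<le> j \<and> real j \<le> real n + real n / ln (real n)}. X (i, j) \<omega>)"

definition limsup2 :: "(nat \<Rightarrow> nat \<Rightarrow> ereal) \<Rightarrow> ereal" where
  "limsup2 f = Limsup (sequentially \<times>\<^sub>F sequentially) (\<lambda>(m, n). f m n)"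

lemma limsup2_eq_INF: "limsup2 f = (INF k. SUP (m, n)\<in>{k..} \<times> {k..}. f m n)"
proof (rule antisym)
  show "limsup2 f \<le> (INF k. SUP (m, n)\<in>{k..} \<times> {k..}. f m n)"
  proof (rule INF_greatest)
    fix k :: nat
    let ?P = "\<lambda>p::nat \<times> nat. p \<in> {k..} \<times> {k..}"
    have "eventually ?P (sequentially \<times>\<^sub>F sequentially)"
      unfolding eventually_prod_sequentially by auto
    then have "limsup2 f \<le> (SUP p\<in>Collect ?P. case p of (m, n) \<Rightarrow> f m n)"
      unfolding limsup2_def Limsup_def by (intro INF_lower) auto
    then show "limsup2 f \<le> (SUP (m, n)\<in>{k..} \<times> {k..}. f m n)"
      by (simp only: Collect_mem_eq)
  qed
  show "(INF k. SUP (m, n)\<in>{k..} \<times> {k..}. f m n) \<le> limsup2 f"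
    unfolding limsup2_def Limsup_def
  proof (rule INF_greatest)
    fix P :: "nat \<times> nat \<Rightarrow> bool"
    assume "P \<in> {P. eventually P (sequentially \<times>\<^sub>F sequentially)}"
    then obtain k where "\<forall>m\<ge>k. \<forall>n\<ge>k. P (n, m)"
      unfolding eventually_prod_sequentially by auto
    then have "(SUP (m, n)\<in>{k..} \<times> {k..}. f m n) \<le> (SUP p\<in>Collect P. case p of (m, n) \<Rightarrow> f m n)"
      by (intro SUP_subset_mono) auto
    then show "(INF k. SUP (m, n)\<in>{k..} \<times> {k..}. f m n) \<le> (SUP p\<in>Collect P. case p of (m, n) \<Rightarrow> f m n)"
      by (rule INF_lower2[OF UNIV_I])
  qed
qed

lemma limsup2_LIMSEQ: "(\<lambda>k. SUP (m, n)\<in>{k..} \<times> {k..}. f m n) \<longlonglongrightarrow> limsup2 f"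
  unfolding limsup2_eq_INF
  by (rule LIMSEQ_INF) (auto simp: decseq_def intro!: SUP_subset_mono)

end

theory Submission
  imports Defs "HOL-Real_Asymp.Real_Asymp"
begin

text \<open>
  Write \<open>a(m,n) = m powr \<alpha> * n / ln n\<close> for the approximate number of summands in a window and
  \<open>L(m,n) = ln (m * n)\<close>. Both parts compare the window sums with \<open>norming m n = sqrt (a * L)\<close>.

  \<^bold>\<open>Upper bound.\<close> Truncate each summand from above at \<open>b = \<eta> * sqrt (a / L)\<close>. For a truncated
  variable the mean is at most \<open>0\<close> and the moment generating function is almost Gaussian
  (\<open>cut_above_mgf\<close>), so a sum of \<open>c * a\<close> truncated variables exceeds \<open>x * norming\<close> with probability at
  most a power of \<open>m * n\<close>, and the exponent is of order \<open>x^2 / c\<close> when \<open>\<eta>\<close> is small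
  (\<open>cut_event_tail\<close>). The lattice points \<open>(m, n)\<close> are grouped into cells with side lengths \<open>\<delta>\<close> times those of the window.
  All windows of a cell share a common core, for which a single exponential bound is used; what a window
  has beyond the core has at most \<open>24 * \<delta> * a\<close> terms, hence a tail bound that is so small
  that a union bound over all windows of the cell is affordable, and no maximal inequality is needed.
  A window contains \<open>N\<close> terms above the truncation level with a probability that is also a large
  negative power of \<open>m * n\<close>, and single terms are eventually \<open>o(norming)\<close> by the moment condition
  (\<open>large_terms_eventually_small\<close>). With norming constant \<open>sqrt (2 * (1 - \<alpha>))\<close> the bounds for the
  cores are just summable over the cells: there are about \<open>m powr (1 - \<alpha>)\<close> cells in the first
  direction up to \<open>m\<close>, and in the second direction the cells are so few that any negative power of \<open>n\<close> is summable.

  \<^bold>\<open>Lower bound.\<close> Keep \<open>n\<close> fixed and let \<open>m\<close> run through a sequence with disjoint consecutive windows,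
  so that the window sums are independent. The central limit theorem, applied in a number of blocks proportional to \<open>h\<close>,
  gives \<open>P(S_K \<ge> \<tau> * sqrt (2 * h * K)) \<ge> exp (- h) / 2\<close> for \<open>\<tau> < \<sigma>\<close>
  (\<open>psum_moderate_deviation_lower\<close>). With \<open>h = (1 - \<alpha>) * L\<close> these probabilities have a divergent sum.

  \<^bold>\<open>Converse.\<close> On such a sequence the probabilities of \<open>|S| > C * norming\<close> must be summable. A sum of
  this kind is large at least about as often as one of its terms is (\<open>single_jump_bound\<close>), so that
  \<open>P(|X| > C' * norming m n)\<close> is summable over \<open>m\<close>, which is the moment condition. The mean
  vanishes because otherwise the law of large numbers would make the window sums of order \<open>a\<close>,
  which is larger than \<open>norming\<close>.
\<close>

section \<open>Sums over independent identically distributed families\<close>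

text \<open>
  The second Borel--Cantelli lemma, in the form in which both the lower bound and the converse use it.
\<close>

lemma (in prob_space) prob_avoid_indep_sequence:
  fixes Y :: "nat \<Rightarrow> 'a \<Rightarrow> real"
  assumes ind: "indep_vars (\<lambda>_. borel) Y UNIV"
    and U: "\<And>l. U l \<in> sets borel"
    and nsum: "\<not> summable (\<lambda>l. prob {\<omega>\<in>space M. Y l \<omega> \<in> U l})"
  shows "prob {\<omega>\<in>space M. \<forall>l\<ge>k. Y l \<omega> \<notin> U l} = 0"
proof (rule antisym[OF field_le_epsilon measure_nonneg])
  fix e :: real assume e: "e > 0"
  define p where "p l = prob {\<omega>\<in>space M. Y l \<omega> \<in> U l}" for l
  have Ym[measurable]: "Y l \<in> borel_measurable M" for l
    using ind by (auto simp: indep_vars_def)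
  note U[measurable]
  have p0: "p l \<ge> 0" "p l \<le> 1" for l by (auto simp: p_def)
  have "\<exists>N. (\<Sum>l<N. p l) > k - ln e"
  proof (rule ccontr)
    assume "\<not> ?thesis"
    then have "summable p"
      by (intro summableI_nonneg_bounded[of p "k - ln e"]) (auto simp: p0 not_less)
    then show False using nsum by (simp add: p_def[abs_def])
  qed
  then obtain N where N: "(\<Sum>l<N. p l) > k - ln e" by auto
  have "(\<Sum>l<N. p l) \<le> (\<Sum>l\<in>{..<k} \<union> {k..<k+N}. p l)"
    by (intro sum_mono2) (auto simp: p0)
  also have "\<dots> \<le> (\<Sum>l<k. p l) + (\<Sum>l\<in>{k..<k+N}. p l)"
    by (subst sum.union_disjoint) auto
  also have "(\<Sum>l<k. p l) \<le> (\<Sum>l<k. 1)" by (intro sum_mono) (auto simp: p0)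
  finally have big: "(\<Sum>l\<in>{k..<k+N}. p l) > - ln e" using N by simp
  have "prob {\<omega>\<in>space M. \<forall>l\<ge>k. Y l \<omega> \<notin> U l} \<le> prob {\<omega>\<in>space M. \<forall>l\<in>{k..<k+N}. Y l \<omega> \<notin> U l}"
    by (intro finite_measure_mono) auto
  also have "\<dots> \<le> (\<Prod>l\<in>{k..<k+N}. 1 - p l)"
  proof (cases "{k..<k+N} = {}")
    case False
    have "{\<omega>\<in>space M. \<forall>l\<in>{k..<k+N}. Y l \<omega> \<notin> U l} = (\<Inter>l\<in>{k..<k+N}. Y l -` (- U l) \<inter> space M)"
      using False by auto
    also have "prob \<dots> = (\<Prod>l\<in>{k..<k+N}. prob (Y l -` (- U l) \<inter> space M))"
      using False by (intro indep_varsD[OF ind]) auto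
    also have "\<dots> = (\<Prod>l\<in>{k..<k+N}. 1 - p l)"
    proof (intro prod.cong refl)
      fix l
      have "Y l -` (- U l) \<inter> space M = space M - {\<omega>\<in>space M. Y l \<omega> \<in> U l}" by auto
      then show "prob (Y l -` (- U l) \<inter> space M) = 1 - p l"
        by (simp add: prob_compl p_def)
    qed
    finally show ?thesis by simp
  qed auto
  also have "\<dots> \<le> (\<Prod>l\<in>{k..<k+N}. exp (- p l))"
  proof (intro prod_mono conjI)
    fix l
    show "0 \<le> 1 - p l" using p0 by simp
    show "1 - p l \<le> exp (- p l)" using exp_ge_add_one_self[of "- p l"] by simp
  qed
  also have "\<dots> = exp (- (\<Sum>l\<in>{k..<k+N}. p l))"
    by (subst sum_negf[symmetric], subst exp_sum) auto
  also have "\<dots> \<le> exp (ln e)" using big by simp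
  also have "\<dots> = e" using e by simp
  finally show "prob {\<omega>\<in>space M. \<forall>l\<ge>k. Y l \<omega> \<notin> U l} \<le> 0 + e" by simp
qed

text \<open>
  Independent variables \<open>X i\<close> for \<open>i\<close> in an arbitrary index set \<open>I\<close>, all distributed like \<open>Z\<close>. Nothing is
  assumed about \<open>X i\<close> outside \<open>I\<close>.
\<close>

locale iid_family = prob_space M for M :: "'a measure" +
  fixes X :: "'i \<Rightarrow> 'a \<Rightarrow> real" and I :: "'i set" and Z :: "'a \<Rightarrow> real"
  assumes Z_measurable [measurable]: "Z \<in> borel_measurable M"
    and indep: "indep_vars (\<lambda>_. borel) X I"
    and ident: "i \<in> I \<Longrightarrow> distr M borel (X i) = distr M borel Z"
begin

text \<open>
  The partial sum over a set of indices; it is meant for finite sets.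
\<close>

definition psum :: "'i set \<Rightarrow> 'a \<Rightarrow> real" where
  "psum A \<omega> = (\<Sum>k\<in>A. X k \<omega>)"

lemma X_measurable: "i \<in> I \<Longrightarrow> X i \<in> borel_measurable M"
  using indep by (auto simp: indep_vars_def)

lemma psum_measurable [measurable (raw)]: "A \<subseteq> I \<Longrightarrow> psum A \<in> borel_measurable M"
  unfolding psum_def[abs_def] by (intro borel_measurable_sum X_measurable) auto

lemma prob_X:
  assumes "i \<in> I" "U \<in> sets borel"
  shows "prob {\<omega>\<in>space M. X i \<omega> \<in> U} = prob {\<omega>\<in>space M. Z \<omega> \<in> U}"
proof -
  have *: "{\<omega>\<in>space M. Y \<omega> \<in> U} = Y -` U \<inter> space M" for Y by auto
  have "prob (X i -` U \<inter> space M) = measure (distr M borel (X i)) U"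
    using assms X_measurable by (intro measure_distr[symmetric]) auto
  also have "\<dots> = prob (Z -` U \<inter> space M)"
    using assms by (simp add: ident measure_distr)
  finally show ?thesis by (simp add: *)
qed

lemma
  fixes g :: "real \<Rightarrow> real"
  assumes "i \<in> I" and g: "g \<in> borel_measurable borel"
  shows integrable_X: "integrable M (\<lambda>\<omega>. g (X i \<omega>)) \<longleftrightarrow> integrable M (\<lambda>\<omega>. g (Z \<omega>))"
    and expectation_X: "expectation (\<lambda>\<omega>. g (X i \<omega>)) = expectation (\<lambda>\<omega>. g (Z \<omega>))"
proof -
  note [measurable] = X_measurable[OF assms(1)]
  show "integrable M (\<lambda>\<omega>. g (X i \<omega>)) \<longleftrightarrow> integrable M (\<lambda>\<omega>. g (Z \<omega>))"
    using integrable_distr_eq[of "X i" M borel g] integrable_distr_eq[of Z M borel g] g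
    by (simp add: ident[OF assms(1)])
  show "expectation (\<lambda>\<omega>. g (X i \<omega>)) = expectation (\<lambda>\<omega>. g (Z \<omega>))"
    using integral_distr[of "X i" M borel g] integral_distr[of Z M borel g] g
    by (simp add: ident[OF assms(1)])
qed

lemma indep_block_sums:
  assumes "\<And>l. l \<in> L \<Longrightarrow> K l \<subseteq> I" and "disjoint_family_on K L"
  shows "indep_vars (\<lambda>_. borel) (\<lambda>l. psum (K l)) L"
proof -
  have "indep_vars (\<lambda>_. borel) (\<lambda>l. (\<lambda>x. \<Sum>k\<in>K l. x k) \<circ> (\<lambda>\<omega>. restrict (\<lambda>i. X i \<omega>) (K l))) L"
    by (rule indep_vars_compose[OF indep_vars_restrict[OF indep assms]]) auto
  also have "(\<lambda>l. (\<lambda>x. \<Sum>k\<in>K l. x k) \<circ> (\<lambda>\<omega>. restrict (\<lambda>i. X i \<omega>) (K l))) = (\<lambda>l. psum (K l))"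
    by (auto simp: psum_def fun_eq_iff intro!: sum.cong)
  finally show ?thesis .
qed

lemma indep_var_psum:
  assumes "A \<subseteq> I" "B \<subseteq> I" "A \<inter> B = {}"
  shows "indep_var borel (psum A) borel (psum B)"
proof -
  have "indep_vars (\<lambda>_. borel) (\<lambda>l. psum (case_bool A B l)) UNIV"
    using assms by (intro indep_block_sums) (auto simp: disjoint_family_on_def split: bool.split)
  moreover have "(\<lambda>_. borel) = case_bool borel borel"
    "(\<lambda>l. psum (case_bool A B l)) = case_bool (psum A) (psum B)"
    by (auto simp: fun_eq_iff split: bool.split)
  ultimately show ?thesis unfolding indep_var_def by metis
qed

text \<open>
  The law of a partial sum depends on the number of terms only, by comparison of characteristic functions.
\<close>

lemma distr_psum_eq:
  assumes "A \<subseteq> I" "B \<subseteq> I" "card A = card B"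
  shows "distr M borel (psum A) = distr M borel (psum B)"
proof (rule Levy_uniqueness)
  have ch: "char (distr M borel (psum A)) t = char (distr M borel Z) t ^ card A" if "A \<subseteq> I" for t A
  proof -
    have "char (distr M borel (psum A)) t = (\<Prod>i\<in>A. char (distr M borel (X i)) t)"
      unfolding psum_def[abs_def] using that indep_vars_subset[OF indep] by (intro char_distr_sum) auto
    also have "\<dots> = (\<Prod>i\<in>A. char (distr M borel Z) t)"
      using that by (intro prod.cong) (auto simp: ident)
    finally show ?thesis by simp
  qed
  show "char (distr M borel (psum A)) = char (distr M borel (psum B))"
    using assms by (intro ext) (simp add: ch)
qed (use assms in auto)

lemma prob_psum_eq:
  assumes "A \<subseteq> I" "B \<subseteq> I" "card A = card B" "U \<in> sets borel"
  shows "prob {\<omega>\<in>space M. psum A \<omega> \<in> U} = prob {\<omega>\<in>space M. psum B \<omega> \<in> U}"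
proof -
  have *: "{\<omega>\<in>space M. Y \<omega> \<in> U} = Y -` U \<inter> space M" for Y by auto
  show ?thesis
    using assms distr_psum_eq[OF assms(1-3)] measure_distr[of "psum A" M borel U]
      measure_distr[of "psum B" M borel U] by (simp add: *)
qed

lemma psum_union:
  assumes "finite A" "finite B" "A \<inter> B = {}"
  shows "psum (A \<union> B) \<omega> = psum A \<omega> + psum B \<omega>"
  using assms by (simp add: psum_def sum.union_disjoint)

lemma prob_psum_superadditive:
  assumes AB: "A \<subseteq> I" "B \<subseteq> I" "A \<inter> B = {}" and fin: "finite A" "finite B"
  shows "prob {\<omega>\<in>space M. x \<le> psum A \<omega>} * prob {\<omega>\<in>space M. y \<le> psum B \<omega>}
    \<le> prob {\<omega>\<in>space M. x + y \<le> psum (A \<union> B) \<omega>}"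
proof -
  have [measurable]: "psum A \<in> borel_measurable M" "psum B \<in> borel_measurable M"
    "psum (A \<union> B) \<in> borel_measurable M"
    using AB by auto
  have *: "{\<omega>\<in>space M. x \<le> Y \<omega>} = Y -` {x..} \<inter> space M" for Y :: "'a \<Rightarrow> real" and x by auto
  have "prob ((\<lambda>\<omega>. (psum A \<omega>, psum B \<omega>)) -` ({x..} \<times> {y..}) \<inter> space M)
    = prob (psum A -` {x..} \<inter> space M) * prob (psum B -` {y..} \<inter> space M)"
    by (rule indep_varD[OF indep_var_psum[OF AB]]) auto
  also have "(\<lambda>\<omega>. (psum A \<omega>, psum B \<omega>)) -` ({x..} \<times> {y..}) \<inter> space M
      = {\<omega>\<in>space M. x \<le> psum A \<omega> \<and> y \<le> psum B \<omega>}" by auto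
  finally have "prob {\<omega>\<in>space M. x \<le> psum A \<omega>} * prob {\<omega>\<in>space M. y \<le> psum B \<omega>}
      = prob {\<omega>\<in>space M. x \<le> psum A \<omega> \<and> y \<le> psum B \<omega>}" by (simp add: *)
  also have "\<dots> \<le> prob {\<omega>\<in>space M. x + y \<le> psum (A \<union> B) \<omega>}"
    using psum_union[OF fin AB(3)] by (intro finite_measure_mono) auto
  finally show ?thesis .
qed

lemma prob_psum_blocks:
  assumes D: "\<And>t. t < r \<Longrightarrow> D t \<subseteq> I \<and> finite (D t)" and disj: "disjoint_family_on D {..<r}"
    and q: "\<And>t. t < r \<Longrightarrow> q \<le> prob {\<omega>\<in>space M. y \<le> psum (D t) \<omega>}" and "0 \<le> q"
  shows "q ^ r \<le> prob {\<omega>\<in>space M. real r * y \<le> psum (\<Union>t<r. D t) \<omega>}"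
  using D disj q
proof (induction r)
  case 0
  have "{\<omega> \<in> space M. real 0 * y \<le> psum (\<Union> (D ` {..<0})) \<omega>} = space M"
    by (auto simp: psum_def)
  then show ?case by (simp only: prob_space) simp
next
  case (Suc r)
  have "q ^ Suc r \<le> prob {\<omega>\<in>space M. real r * y \<le> psum (\<Union>t<r. D t) \<omega>} *
    prob {\<omega>\<in>space M. y \<le> psum (D r) \<omega>}"
    unfolding power_Suc2
  proof (rule mult_mono)
    show "q ^ r \<le> prob {\<omega>\<in>space M. real r * y \<le> psum (\<Union>t<r. D t) \<omega>}"
      using Suc.prems by (intro Suc.IH) (auto simp: disjoint_family_on_def)
    show "q \<le> prob {\<omega>\<in>space M. y \<le> psum (D r) \<omega>}" using Suc.prems by auto
  qed (use \<open>0 \<le> q\<close> in auto)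
  also have "\<dots> \<le> prob {\<omega>\<in>space M. real r * y + y \<le> psum ((\<Union>t<r. D t) \<union> D r) \<omega>}"
  proof (rule prob_psum_superadditive)
    have "D t \<inter> D r = {}" if "t < r" for t
      using that by (intro disjoint_family_onD[OF Suc.prems(2)]) auto
    then show "(\<Union>t<r. D t) \<inter> D r = {}" by blast
    show "(\<Union>t<r. D t) \<subseteq> I" "D r \<subseteq> I" "finite (\<Union>t<r. D t)" "finite (D r)"
      using Suc.prems(1) by (auto simp: less_Suc_eq UN_subset_iff)
  qed
  also have "(\<Union>t<r. D t) \<union> D r = (\<Union>t<Suc r. D t)" by (auto simp: less_Suc_eq)
  finally show ?case by (simp add: algebra_simps)
qed

lemma second_moment_psum:
  assumes "finite A" "A \<subseteq> I" and Z2: "integrable M (\<lambda>\<omega>. (Z \<omega>)\<^sup>2)" and Z0: "expectation Z = 0"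
  shows "integrable M (\<lambda>\<omega>. (psum A \<omega>)\<^sup>2) \<and> integrable M (psum A) \<and> expectation (psum A) = 0 \<and>
    expectation (\<lambda>\<omega>. (psum A \<omega>)\<^sup>2) = real (card A) * expectation (\<lambda>\<omega>. (Z \<omega>)\<^sup>2)"
  using assms(1,2)
proof (induction A rule: finite_induct)
  case empty
  then show ?case by (simp add: psum_def[abs_def])
next
  case (insert a A)
  have iZ: "integrable M Z" using Z2 by (rule square_integrable_imp_integrable[rotated]) auto
  have iX: "integrable M (X a)" "expectation (X a) = 0"
    using integrable_X[of a "\<lambda>x. x"] expectation_X[of a "\<lambda>x. x"] insert.prems iZ Z0 by auto
  have iX2: "integrable M (\<lambda>\<omega>. (X a \<omega>)\<^sup>2)" "expectation (\<lambda>\<omega>. (X a \<omega>)\<^sup>2) = expectation (\<lambda>\<omega>. (Z \<omega>)\<^sup>2)"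
    using integrable_X[of a "\<lambda>x. x\<^sup>2"] expectation_X[of a "\<lambda>x. x\<^sup>2"] insert.prems Z2 by auto
  have IH: "integrable M (\<lambda>\<omega>. (psum A \<omega>)\<^sup>2)" "integrable M (psum A)" "expectation (psum A) = 0"
    "expectation (\<lambda>\<omega>. (psum A \<omega>)\<^sup>2) = real (card A) * expectation (\<lambda>\<omega>. (Z \<omega>)\<^sup>2)"
    using insert by auto
  have ps: "psum (insert a A) = (\<lambda>\<omega>. X a \<omega> + psum A \<omega>)" "psum {a} = X a"
    using insert.hyps by (auto simp: psum_def fun_eq_iff)
  have iv: "indep_var borel (X a) borel (psum A)"
    using indep_var_psum[of "{a}" A] insert by (simp add: ps)
  note prod = indep_var_integrable[OF iv iX(1) IH(2)] indep_var_lebesgue_integral[OF iv iX(1) IH(2)]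
  have sq: "(\<lambda>\<omega>. (psum (insert a A) \<omega>)\<^sup>2) = (\<lambda>\<omega>. (X a \<omega>)\<^sup>2 + 2 * (X a \<omega> * psum A \<omega>) + (psum A \<omega>)\<^sup>2)"
    by (simp add: ps power2_eq_square algebra_simps)
  show ?case
    unfolding sq using insert.hyps iX iX2 IH prod
    by (simp add: ps algebra_simps)
qed

lemma psum_tail_Chebyshev:
  assumes "finite A" "A \<subseteq> I" and Z2: "integrable M (\<lambda>\<omega>. (Z \<omega>)\<^sup>2)" and Z0: "expectation Z = 0" and "y > 0"
  shows "prob {\<omega>\<in>space M. y \<le> \<bar>psum A \<omega>\<bar>} \<le> real (card A) * expectation (\<lambda>\<omega>. (Z \<omega>)\<^sup>2) / y\<^sup>2"
proof -
  note m = second_moment_psum[OF assms(1-4)]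
  have "prob {\<omega>\<in>space M. \<bar>psum A \<omega> - expectation (psum A)\<bar> \<ge> y} \<le> variance (psum A) / y\<^sup>2"
    using m assms by (intro Chebyshev_inequality) auto
  then show ?thesis using m by simp
qed

lemma chernoff_bound:
  fixes g :: "real \<Rightarrow> real"
  assumes A: "finite A" "A \<subseteq> I" and [measurable]: "g \<in> borel_measurable borel"
    and int: "integrable M (\<lambda>\<omega>. exp (l * g (Z \<omega>)))"
    and le: "expectation (\<lambda>\<omega>. exp (l * g (Z \<omega>))) \<le> exp c" and "0 \<le> l"
  shows "prob {\<omega>\<in>space M. x \<le> (\<Sum>k\<in>A. g (X k \<omega>))} \<le> exp (real (card A) * c - l * x)"
proof -
  let ?E = "\<lambda>k \<omega>. exp (l * g (X k \<omega>))"
  have [measurable]: "k \<in> A \<Longrightarrow> X k \<in> borel_measurable M" for k using X_measurable A by auto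
  have ind: "indep_vars (\<lambda>_. borel) ?E A"
    by (rule indep_vars_compose2[OF indep_vars_subset[OF indep A(2)], where Y="\<lambda>_ x. exp (l * g x)"]) auto
  have intE: "integrable M (?E k)" "expectation (?E k) = expectation (\<lambda>\<omega>. exp (l * g (Z \<omega>)))" if "k \<in> A" for k
    using integrable_X[of k "\<lambda>x. exp (l * g x)"] expectation_X[of k "\<lambda>x. exp (l * g x)"] that A int by auto
  note P = indep_vars_integrable[OF A(1) ind intE(1)] indep_vars_lebesgue_integral[OF A(1) ind intE(1)]
  have ex: "(\<Prod>k\<in>A. ?E k \<omega>) = exp (l * (\<Sum>k\<in>A. g (X k \<omega>)))" for \<omega>
    using A by (simp add: exp_sum sum_distrib_left)
  have "prob {\<omega>\<in>space M. x \<le> (\<Sum>k\<in>A. g (X k \<omega>))} \<le> prob {\<omega>\<in>space M. exp (l * x) \<le> (\<Prod>k\<in>A. ?E k \<omega>)}"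
    unfolding ex using \<open>0 \<le> l\<close> by (intro finite_measure_mono) (auto intro: mult_left_mono)
  also have "\<dots> \<le> expectation (\<lambda>\<omega>. \<Prod>k\<in>A. ?E k \<omega>) / exp (l * x)"
    by (rule integral_Markov_inequality_measure[OF P(1), of "{}" , simplified]) (auto intro!: AE_I2 prod_nonneg)
  also have "expectation (\<lambda>\<omega>. \<Prod>k\<in>A. ?E k \<omega>) = expectation (\<lambda>\<omega>. exp (l * g (Z \<omega>))) ^ card A"
    using P(2) intE(2) by simp
  also have "\<dots> \<le> exp c ^ card A" by (intro power_mono le integral_nonneg_AE) auto
  finally show ?thesis by (simp add: exp_diff exp_of_nat_mult divide_right_mono)
qed

end

text \<open>
  The factor \<open>exp B\<close> bounds the second derivative of \<open>exp\<close> up to \<open>B\<close>; no lower bound on \<open>y\<close> is needed.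
\<close>

lemma exp_le_quadratic:
  fixes y B :: real
  assumes "y \<le> B" "0 \<le> B"
  shows "exp y \<le> 1 + y + y\<^sup>2 / 2 * exp B"
proof (cases "0 \<le> y")
  case True
  obtain t where t: "\<bar>t\<bar> \<le> \<bar>y\<bar>" "exp y = (\<Sum>m<2. y ^ m / fact m) + exp t / fact 2 * y ^ 2"
    using Maclaurin_exp_le[of y 2] by blast
  have "exp t * y\<^sup>2 \<le> exp B * y\<^sup>2" using t(1) True assms by (intro mult_right_mono) auto
  then show ?thesis using t(2) by (simp add: eval_nat_numeral field_simps)
next
  case False
  obtain t where t: "\<bar>t\<bar> \<le> \<bar>y\<bar>" "exp y = (\<Sum>m<3. y ^ m / fact m) + exp t / fact 3 * y ^ 3"
    using Maclaurin_exp_le[of y 3] by blast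
  have "y ^ 3 \<le> 0" using False by (simp add: power3_eq_cube mult_nonneg_nonpos2 mult_nonneg_nonpos mult_nonpos_nonpos)
  then have "exp t / fact 3 * y ^ 3 \<le> 0" by (intro mult_nonneg_nonpos) auto
  moreover have "y\<^sup>2 * 1 \<le> y\<^sup>2 * exp B" using assms by (intro mult_left_mono) auto
  ultimately show ?thesis using t(2) by (simp add: eval_nat_numeral algebra_simps)
qed

text \<open>
  One-sided truncation: values above \<open>b\<close> are replaced by \<open>0\<close>. Large negative values are kept, so that the
  mean can only decrease and no recentring is necessary in an upper bound.
\<close>

definition cut_above :: "real \<Rightarrow> real \<Rightarrow> real" where
  "cut_above b x = (if x \<le> b then x else 0)"

lemma cut_above_measurable [measurable]: "cut_above b \<in> borel_measurable borel"
  unfolding cut_above_def[abs_def] by measurable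

context prob_space
begin

lemma cut_above_mgf:
  assumes [measurable]: "Z \<in> borel_measurable M"
    and Z2: "integrable M (\<lambda>\<omega>. (Z \<omega>)\<^sup>2)" and Z0: "expectation Z = 0"
    and s: "expectation (\<lambda>\<omega>. (Z \<omega>)\<^sup>2) \<le> s\<^sup>2" and "0 \<le> b" "0 \<le> l"
  shows "integrable M (\<lambda>\<omega>. exp (l * cut_above b (Z \<omega>)))"
    and "expectation (\<lambda>\<omega>. exp (l * cut_above b (Z \<omega>))) \<le> exp (l\<^sup>2 * s\<^sup>2 / 2 * exp (l * b))"
proof -
  have iZ: "integrable M Z" using Z2 by (rule square_integrable_imp_integrable[rotated]) auto
  have iC: "integrable M (\<lambda>\<omega>. cut_above b (Z \<omega>))"
    by (rule Bochner_Integration.integrable_bound[OF iZ]) (auto simp: cut_above_def)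
  have cb: "cut_above b x \<le> b" for x using \<open>0 \<le> b\<close> by (auto simp: cut_above_def)
  show int: "integrable M (\<lambda>\<omega>. exp (l * cut_above b (Z \<omega>)))"
    by (rule integrable_const_bound[where B="exp (l * b)"])
       (auto intro!: mult_left_mono cb \<open>0 \<le> l\<close>)
  \<comment> \<open>This uses \<open>b \<ge> 0\<close>: only positive values are removed.\<close>
  have "expectation (\<lambda>\<omega>. cut_above b (Z \<omega>)) \<le> expectation Z"
    using iC iZ \<open>0 \<le> b\<close> by (intro integral_mono) (auto simp: cut_above_def)
  then have neg: "expectation (\<lambda>\<omega>. cut_above b (Z \<omega>)) \<le> 0" using Z0 by simp
  have "expectation (\<lambda>\<omega>. exp (l * cut_above b (Z \<omega>)))
     \<le> expectation (\<lambda>\<omega>. 1 + l * cut_above b (Z \<omega>) + l\<^sup>2 * (Z \<omega>)\<^sup>2 / 2 * exp (l * b))"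
  proof (rule integral_mono[OF int])
    show "integrable M (\<lambda>\<omega>. 1 + l * cut_above b (Z \<omega>) + l\<^sup>2 * (Z \<omega>)\<^sup>2 / 2 * exp (l * b))"
      using iC Z2 by auto
    fix \<omega>
    have "exp (l * cut_above b (Z \<omega>)) \<le> 1 + l * cut_above b (Z \<omega>) + (l * cut_above b (Z \<omega>))\<^sup>2 / 2 * exp (l * b)"
      by (intro exp_le_quadratic mult_left_mono cb mult_nonneg_nonneg assms)
    also have "(l * cut_above b (Z \<omega>))\<^sup>2 \<le> l\<^sup>2 * (Z \<omega>)\<^sup>2"
      by (auto simp: cut_above_def power_mult_distrib)
    finally show "exp (l * cut_above b (Z \<omega>)) \<le> 1 + l * cut_above b (Z \<omega>) + l\<^sup>2 * (Z \<omega>)\<^sup>2 / 2 * exp (l * b)"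
      by simp
  qed
  also have "\<dots> = 1 + l * expectation (\<lambda>\<omega>. cut_above b (Z \<omega>)) + l\<^sup>2 / 2 * exp (l * b) * expectation (\<lambda>\<omega>. (Z \<omega>)\<^sup>2)"
    using iC Z2 by (simp add: prob_space algebra_simps)
  also have "\<dots> \<le> 1 + l * 0 + l\<^sup>2 / 2 * exp (l * b) * s\<^sup>2"
    by (intro add_mono mult_left_mono neg s order_refl mult_nonneg_nonneg \<open>0 \<le> l\<close>) auto
  also have "\<dots> \<le> exp (l\<^sup>2 * s\<^sup>2 / 2 * exp (l * b))"
    using exp_ge_add_one_self[of "l\<^sup>2 * s\<^sup>2 / 2 * exp (l * b)"] by (simp add: algebra_simps)
  finally show "expectation (\<lambda>\<omega>. exp (l * cut_above b (Z \<omega>))) \<le> exp (l\<^sup>2 * s\<^sup>2 / 2 * exp (l * b))" .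
qed

lemma exceedance_mgf:
  fixes b :: real and Z :: "'a \<Rightarrow> real"
  assumes [measurable]: "Z \<in> borel_measurable M"
  defines "g \<equiv> (\<lambda>x::real. indicat_real {b<..} x)"
  shows "integrable M (\<lambda>\<omega>. exp (l * g (Z \<omega>)))"
    and "expectation (\<lambda>\<omega>. exp (l * g (Z \<omega>))) \<le> exp (exp l * prob {\<omega>\<in>space M. b < Z \<omega>})"
proof -
  have eq: "exp (l * g (Z \<omega>)) = 1 + (exp l - 1) * indicat_real {\<omega>\<in>space M. b < Z \<omega>} \<omega>" if "\<omega> \<in> space M" for \<omega>
    using that by (auto simp: g_def indicator_def)
  have i: "integrable M (indicat_real {\<omega>\<in>space M. b < Z \<omega>})" by (auto simp: less_top[symmetric])
  have i': "integrable M (\<lambda>\<omega>. 1 + (exp l - 1) * indicat_real {\<omega>\<in>space M. b < Z \<omega>} \<omega>)"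
    using i by auto
  show "integrable M (\<lambda>\<omega>. exp (l * g (Z \<omega>)))"
    using i' by (subst Bochner_Integration.integrable_cong[OF refl eq]) auto
  have "expectation (\<lambda>\<omega>. exp (l * g (Z \<omega>))) = expectation (\<lambda>\<omega>. 1 + (exp l - 1) * indicat_real {\<omega>\<in>space M. b < Z \<omega>} \<omega>)"
    by (intro Bochner_Integration.integral_cong refl eq)
  also have "\<dots> = 1 + (exp l - 1) * prob {\<omega>\<in>space M. b < Z \<omega>}"
    using i by (simp add: prob_space)
  also have "\<dots> \<le> 1 + exp l * prob {\<omega>\<in>space M. b < Z \<omega>}" by (simp add: algebra_simps)
  also have "\<dots> \<le> exp (exp l * prob {\<omega>\<in>space M. b < Z \<omega>})"
    using exp_ge_add_one_self[of "exp l * prob {\<omega>\<in>space M. b < Z \<omega>}"] by simp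
  finally show "expectation (\<lambda>\<omega>. exp (l * g (Z \<omega>))) \<le> exp (exp l * prob {\<omega>\<in>space M. b < Z \<omega>})" .
qed

end

section \<open>Lower deviations from the central limit theorem\<close>

text \<open>
  A crude bound on the normal tail, obtained from the interval of length \<open>1\<close> to the right of \<open>a\<close>; the
  constant \<open>3\<close> replaces \<open>sqrt (2 * pi)\<close>.
\<close>

lemma std_normal_tail_lower:
  fixes a :: real
  assumes "0 \<le> a"
  shows "exp (- (a + 1)\<^sup>2 / 2) / 3 < 1 - cdf std_normal_distribution a"
proof -
  interpret N: prob_space std_normal_distribution
    by (rule prob_space_normal_density) auto
  have "2 * pi < 9" using pi_less_4 by simp
  then have "sqrt (2 * pi) < sqrt 9" by (intro real_sqrt_less_mono)
  also have "sqrt 9 = (3::real)" using real_sqrt_unique[of 3 9] by simp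
  finally have s: "sqrt (2 * pi) < 3" .
  have dens: "exp (- (a + 1)\<^sup>2 / 2) / sqrt (2 * pi) \<le> std_normal_density x" if "x \<in> {a<..a+1}" for x
  proof -
    have "x\<^sup>2 \<le> (a+1)\<^sup>2" using that assms by (intro power_mono) auto
    then show ?thesis by (simp add: std_normal_density_def divide_right_mono)
  qed
  have "exp (- (a + 1)\<^sup>2 / 2) / 3 < exp (- (a + 1)\<^sup>2 / 2) / sqrt (2 * pi)"
    using s by (intro divide_strict_left_mono) auto
  also have "\<dots> \<le> measure std_normal_distribution {a<..a+1}"
  proof -
    let ?c = "exp (- (a + 1)\<^sup>2 / 2) / sqrt (2 * pi)"
    have "ennreal ?c = (\<integral>\<^sup>+x. ennreal ?c * indicator {a<..a+1} x \<partial>lborel)"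
      by (subst nn_integral_cmult_indicator) (auto simp del: times_divide_eq_left)
    also have "\<dots> \<le> (\<integral>\<^sup>+x. ennreal (std_normal_density x) * indicator {a<..a+1} x \<partial>lborel)"
      using dens by (intro nn_integral_mono) (auto simp: indicator_def intro!: ennreal_leI)
    also have "\<dots> = emeasure std_normal_distribution {a<..a+1}"
      by (subst emeasure_density) auto
    finally show ?thesis by (simp add: N.emeasure_eq_measure)
  qed
  also have "\<dots> \<le> measure std_normal_distribution (space std_normal_distribution - {..a})"
    by (intro N.finite_measure_mono) auto
  also have "\<dots> = 1 - cdf std_normal_distribution a"
    by (subst N.prob_compl) (auto simp: cdf_def)
  finally show ?thesis .
qed

context iid_family
begin

lemma psum_gaussian_lower:
  assumes inf: "infinite I" and Z2: "integrable M (\<lambda>\<omega>. (Z \<omega>)\<^sup>2)" and Z0: "expectation Z = 0"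
    and var: "expectation (\<lambda>\<omega>. (Z \<omega>)\<^sup>2) = \<sigma>\<^sup>2" and "0 < \<sigma>" and "0 \<le> a"
  shows "\<exists>B0. \<forall>A. A \<subseteq> I \<longrightarrow> finite A \<longrightarrow> B0 \<le> card A \<longrightarrow>
    exp (- (a + 1)\<^sup>2 / 2) / 3 \<le> prob {\<omega>\<in>space M. a * \<sigma> * sqrt (card A) \<le> psum A \<omega>}"
proof -
  obtain e :: "nat \<Rightarrow> 'i" where e: "inj e" "range e \<subseteq> I"
    using inf infinite_countable_subset by blast
  define Y where "Y n = X (e n)" for n
  have YS: "(\<Sum>i<n. Y i \<omega>) = psum (e ` {..<n}) \<omega>" for n \<omega>
    unfolding psum_def Y_def using e(1) by (subst sum.reindex) (auto intro: inj_on_subset)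
  have indY: "indep_vars (\<lambda>_. borel) Y UNIV"
  proof -
    have "indep_vars (\<lambda>_. borel) (\<lambda>n. psum {e n}) UNIV"
      using e by (intro indep_block_sums) (auto simp: disjoint_family_on_def inj_def)
    then show ?thesis by (simp add: Y_def[abs_def] psum_def[abs_def])
  qed
  have eI: "e n \<in> I" for n using e by auto
  have Y0: "expectation (Y n) = 0" for n using expectation_X[OF eI, of "\<lambda>x. x"] Z0 by (simp add: Y_def)
  have Y2: "integrable M (\<lambda>x. (Y n x)\<^sup>2)" for n
    using integrable_X[OF eI, of "\<lambda>x. x\<^sup>2"] Z2 by (simp add: Y_def)
  have Yv: "expectation (\<lambda>x. (Y n x)\<^sup>2) = \<sigma>\<^sup>2" for n
    using expectation_X[OF eI, of "\<lambda>x. x\<^sup>2"] var by (simp add: Y_def)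
  let ?N = "\<lambda>n. distr M borel (\<lambda>x. (\<Sum>i<n. Y i x) / sqrt (n * \<sigma>\<^sup>2))"
  have clt: "weak_conv_m ?N std_normal_distribution"
    by (rule central_limit_theorem_zero_mean[OF indY, where \<mu>="distr M borel Z"])
       (use Y0 Y2 Yv \<open>0 < \<sigma>\<close> ident[OF eI] in \<open>auto simp: Y_def[abs_def]\<close>)
  interpret N: prob_space std_normal_distribution
    by (rule prob_space_normal_density) auto
  interpret N: real_distribution std_normal_distribution
    by standard auto
  have "measure std_normal_distribution {a} = 0"
  proof -
    have "{a} \<in> null_sets std_normal_distribution"
      by (rule absolutely_continuousI_density[unfolded absolutely_continuous_def, THEN subsetD]) auto
    then show ?thesis by (auto simp: measure_def)
  qed
  then have "isCont (cdf std_normal_distribution) a" by (simp add: N.isCont_cdf)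
  then have "(\<lambda>n. cdf (?N n) a) \<longlonglongrightarrow> cdf std_normal_distribution a"
    using clt by (auto simp: weak_conv_m_def weak_conv_def)
  moreover have "cdf std_normal_distribution a < 1 - exp (- (a + 1)\<^sup>2 / 2) / 3"
    using std_normal_tail_lower[OF \<open>0 \<le> a\<close>] by simp
  ultimately have "eventually (\<lambda>n. cdf (?N n) a < 1 - exp (- (a + 1)\<^sup>2 / 2) / 3) sequentially"
    by (rule order_tendstoD)
  then obtain B0 where B0: "\<And>n. n \<ge> B0 \<Longrightarrow> cdf (?N n) a < 1 - exp (- (a + 1)\<^sup>2 / 2) / 3"
    by (auto simp: eventually_sequentially)
  show ?thesis
  proof (intro exI[of _ "Suc B0"] allI impI)
    fix A assume A: "A \<subseteq> I" "finite A" "Suc B0 \<le> card A"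
    define n where "n = card A"
    have n: "n \<ge> B0" "n > 0" using A by (auto simp: n_def)
    have eA: "e ` {..<n} \<subseteq> I" "card A = card (e ` {..<n})"
      using e by (auto simp: n_def card_image inj_on_subset)
    have [measurable]: "psum (e ` {..<n}) \<in> borel_measurable M" using eA by auto
    have "cdf (?N n) a = prob ((\<lambda>x. psum (e ` {..<n}) x / sqrt (n * \<sigma>\<^sup>2)) -` {..a} \<inter> space M)"
      unfolding cdf_def YS by (subst measure_distr) auto
    then have "1 - cdf (?N n) a = prob (space M - ((\<lambda>x. psum (e ` {..<n}) x / sqrt (n * \<sigma>\<^sup>2)) -` {..a} \<inter> space M))"
      by (subst prob_compl) auto
    also have "\<dots> \<le> prob {\<omega>\<in>space M. psum (e ` {..<n}) \<omega> \<in> {a * \<sigma> * sqrt n ..}}"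
    proof (intro finite_measure_mono)
      show "space M - ((\<lambda>x. psum (e ` {..<n}) x / sqrt (n * \<sigma>\<^sup>2)) -` {..a} \<inter> space M)
        \<subseteq> {\<omega>\<in>space M. psum (e ` {..<n}) \<omega> \<in> {a * \<sigma> * sqrt n ..}}"
        using n \<open>0 < \<sigma>\<close> by (auto simp: real_sqrt_mult field_simps not_le)
    qed measurable
    also have "\<dots> = prob {\<omega>\<in>space M. psum A \<omega> \<in> {a * \<sigma> * sqrt n ..}}"
      using eA A by (intro prob_psum_eq) auto
    finally show "exp (- (a + 1)\<^sup>2 / 2) / 3 \<le> prob {\<omega>\<in>space M. a * \<sigma> * sqrt (card A) \<le> psum A \<omega>}"
      using B0[OF n(1)] by (simp add: n_def)
  qed
qed

text \<open>
  The exponent is sharp up to the gap between \<open>\<tau>\<close> and \<open>\<sigma>\<close>. The set \<open>A\<close> is split into \<open>r\<close> blocks of equal size, with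
  \<open>r\<close> proportional to \<open>h\<close>, and each block is asked to exceed \<open>a\<close> standard deviations. By the central limit
  theorem this has probability at least some fixed \<open>q\<close>, and \<open>q ^ r\<close> approaches the Gaussian order when the
  constant \<open>a\<close> is large. Fewer than \<open>r\<close> left-over terms are controlled by the Chebyshev inequality.
\<close>

lemma psum_moderate_deviation_lower:
  assumes inf: "infinite I" and Z2: "integrable M (\<lambda>\<omega>. (Z \<omega>)\<^sup>2)" and Z0: "expectation Z = 0"
    and var: "expectation (\<lambda>\<omega>. (Z \<omega>)\<^sup>2) = \<sigma>\<^sup>2" and "0 < \<tau>" "\<tau> < \<sigma>"
  shows "\<exists>h0>0. \<exists>\<kappa>>0. \<forall>h\<ge>h0::real. \<forall>A. A \<subseteq> I \<longrightarrow> finite A \<longrightarrow> \<kappa> * h \<le> real (card A) \<longrightarrow>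
    exp (- h) / 2 \<le> prob {\<omega>\<in>space M. \<tau> * sqrt (2 * h * card A) \<le> psum A \<omega>}"
proof -
  define \<tau>' where "\<tau>' = (\<tau> + \<sigma>) / 2"
  have \<tau>': "\<tau> < \<tau>'" "\<tau>' < \<sigma>" "0 < \<tau>'" "0 < \<sigma>" using assms by (auto simp: \<tau>'_def)
  have "eventually (\<lambda>a::real. a \<ge> 1 \<and> a\<^sup>2 / ((a+1)\<^sup>2 / 2 + ln 3) > 2 * (\<tau>'\<^sup>2 / \<sigma>\<^sup>2)) at_top"
  proof (intro eventually_conj)
    have lim: "((\<lambda>a::real. a\<^sup>2 / ((a+1)\<^sup>2 / 2 + ln 3)) \<longlongrightarrow> 2) at_top" by real_asymp
    have "\<tau>'\<^sup>2 < \<sigma>\<^sup>2" using \<tau>' by (intro power_strict_mono) auto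
    then have "2 * (\<tau>'\<^sup>2 / \<sigma>\<^sup>2) < 2" using \<tau>' by (simp add: field_simps)
    with lim show "eventually (\<lambda>a::real. a\<^sup>2 / ((a+1)\<^sup>2 / 2 + ln 3) > 2 * (\<tau>'\<^sup>2 / \<sigma>\<^sup>2)) at_top"
      by (rule order_tendstoD)
  qed (rule eventually_ge_at_top)
  then obtain a :: real where a: "a \<ge> 1" "a\<^sup>2 / ((a+1)\<^sup>2 / 2 + ln 3) > 2 * (\<tau>'\<^sup>2 / \<sigma>\<^sup>2)"
    by (auto simp: eventually_at_top_linorder)
  \<comment> \<open>The cost of one block: it exceeds \<open>a\<close> standard deviations with probability at least \<open>exp (- c)\<close>.\<close>
  define c where "c = (a+1)\<^sup>2 / 2 + ln 3"
  have c0: "c > 0" unfolding c_def by (intro add_nonneg_pos) auto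
  define q where "q = exp (- (a + 1)\<^sup>2 / 2) / 3"
  have q: "q = exp (- c)"
  proof -
    have "exp (- c) = exp (- (a + 1)\<^sup>2 / 2 - ln 3)" by (simp add: c_def)
    then show ?thesis unfolding exp_diff q_def by simp
  qed
  define \<theta> where "\<theta> = 2 * \<tau>'\<^sup>2 * c / (\<sigma>\<^sup>2 * a\<^sup>2)"
  have \<theta>: "\<theta> < 1" using a(2) \<tau>' c0 a(1) unfolding c_def[symmetric] \<theta>_def by (simp add: field_simps)
  obtain B0 where B0: "\<And>A. A \<subseteq> I \<Longrightarrow> finite A \<Longrightarrow> B0 \<le> card A \<Longrightarrow>
      q \<le> prob {\<omega>\<in>space M. a * \<sigma> * sqrt (card A) \<le> psum A \<omega>}"
    using psum_gaussian_lower[OF inf Z2 Z0 var \<tau>'(4), of a] a(1) unfolding q_def by auto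
  define d where "d = \<tau>' - \<tau>"
  have d: "d > 0" using \<tau>' by (simp add: d_def)
  define h0 where "h0 = max c (2 * c / (1 - \<theta>))"
  have h0: "h0 \<ge> c" "h0 > 0" using c0 by (auto simp: h0_def)
  define \<kappa> where "\<kappa> = Max {(real B0 + 1) / c, 2 / ((1 - \<theta>) * c), \<sigma>\<^sup>2 / (d\<^sup>2 * c * h0), 1}"
  have \<kappa>: "\<kappa> \<ge> (real B0 + 1) / c" "\<kappa> \<ge> 2 / ((1 - \<theta>) * c)" "\<kappa> \<ge> \<sigma>\<^sup>2 / (d\<^sup>2 * c * h0)" "\<kappa> \<ge> 1"
    unfolding \<kappa>_def by (intro Max_ge; simp)+
  show ?thesis
  proof (rule exI[of _ h0], intro conjI exI[of _ \<kappa>] allI impI)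
    fix h A assume h: "h0 \<le> h" and A: "A \<subseteq> I" "finite A" "\<kappa> * h \<le> real (card A)"
    define K where "K = card A"
    have hp: "h > 0" "h \<ge> c" "h \<ge> 2 * c / (1 - \<theta>)" using h h0 by (auto simp: h0_def)
    have K: "\<kappa> * h \<le> real K" using A by (simp add: K_def)
    have Kp: "K > 0" using K hp \<kappa>(4) by (metis mult_pos_pos less_le_trans of_nat_0_less_iff zero_less_one)
    \<comment> \<open>The largest number of blocks that the total cost \<open>h\<close> allows.\<close>
    define r where "r = nat \<lfloor>h / c\<rfloor>"
    have r: "real r \<le> h / c" "h / c - 1 \<le> real r"
    proof -
      have "0 \<le> h / c" using hp c0 by simp
      then have "real r = real_of_int \<lfloor>h / c\<rfloor>" by (simp add: r_def)
      then show "real r \<le> h / c" "h / c - 1 \<le> real r" by linarith+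
    qed
    have r1: "r \<ge> 1" using hp c0 unfolding r_def by (simp add: le_nat_iff le_floor_iff)
    define B where "B = K div r"
    have BK: "B * r \<le> K" by (simp add: B_def)
    have BK2: "K < B * r + r" unfolding B_def
      using r1 by (metis add.commute div_mult_mod_eq less_le_trans mod_less_divisor nat_add_left_cancel_less zero_less_one)
    obtain f where f: "bij_betw f {0..<K} A" using ex_bij_betw_nat_finite[OF A(2)] by (auto simp: K_def)
    have fin: "inj_on f {0..<K}" "f ` {0..<K} = A" using f by (auto simp: bij_betw_def)
    define D where "D t = f ` {t * B..<Suc t * B}" for t
    have sub: "{t * B..<Suc t * B} \<subseteq> {0..<K}" if "t < r" for t
    proof -
      have "Suc t * B \<le> r * B" using that by (intro mult_right_mono) auto
      also have "\<dots> \<le> K" using BK by (simp add: mult.commute)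
      finally show ?thesis by auto
    qed
    have DA: "D t \<subseteq> A" if "t < r" for t
      unfolding D_def fin(2)[symmetric] by (rule image_mono[OF sub[OF that]])
    have Dc: "card (D t) = B" if "t < r" for t
      unfolding D_def card_image[OF inj_on_subset[OF fin(1) sub[OF that]]] by simp
    have Df: "finite (D t)" for t by (auto simp: D_def)
    have Dd: "D t \<inter> D u = {}" if "t < u" "u < r" for t u
    proof -
      have "Suc t * B \<le> u * B" using that by (intro mult_right_mono) auto
      then have "{t * B..<Suc t * B} \<inter> {u * B..<Suc u * B} = {}" by auto
      moreover have "D t \<inter> D u = f ` ({t * B..<Suc t * B} \<inter> {u * B..<Suc u * B})"
        unfolding D_def by (rule inj_on_image_Int[OF fin(1) sub sub, symmetric]) (use that in auto)
      ultimately show ?thesis by simp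
    qed
    have Ddf: "disjoint_family_on D {..<r}"
      unfolding disjoint_family_on_def using Dd by (metis Int_commute lessThan_iff linorder_neqE_nat)
    define U where "U = (\<Union>t<r. D t)"
    define W where "W = A - U"
    have UA: "U \<subseteq> A" using DA by (auto simp: U_def)
    have cU: "card U = r * B"
      unfolding U_def using Dc Df Ddf
      by (subst card_UN_disjoint) (auto simp: disjoint_family_on_def)
    have cW: "real (card W) \<le> real r"
      unfolding W_def using BK2 UA A cU by (subst card_Diff_subset) (auto simp: K_def[symmetric] finite_subset mult.commute)
    have "real r \<le> real K / (\<kappa> * c)"
    proof -
      have "real r \<le> h / c" by (rule r)
      also have "\<dots> = \<kappa> * h / (\<kappa> * c)" using \<kappa>(4) by simp
      also have "\<dots> \<le> real K / (\<kappa> * c)" using K \<kappa>(4) c0 by (intro divide_right_mono) auto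
      finally show ?thesis .
    qed
    then have rK: "\<kappa> * c * real r \<le> real K" using \<kappa>(4) c0 by (simp add: field_simps)
    have "real B0 + 1 \<le> \<kappa> * c" using \<kappa>(1) c0 by (simp add: field_simps)
    then have "(real B0 + 1) * real r \<le> real K" using rK by (meson mult_right_mono of_nat_0_le_iff order_trans)
    then have "(B0 + 1) * r \<le> K" by (metis of_nat_1 of_nat_add of_nat_le_iff of_nat_mult)
    then have BB0: "B0 \<le> B" unfolding B_def using r1
      by (metis add_leD1 div_le_mono div_mult_self_is_m less_le_trans zero_less_one)
    have qr: "q ^ r \<le> prob {\<omega>\<in>space M. real r * (a * \<sigma> * sqrt B) \<le> psum U \<omega>}"
      unfolding U_def
    proof (rule prob_psum_blocks[OF _ Ddf])
      fix t assume t: "t < r"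
      show "D t \<subseteq> I \<and> finite (D t)" using DA[OF t] Df A by auto
      show "q \<le> prob {\<omega>\<in>space M. a * \<sigma> * sqrt B \<le> psum (D t) \<omega>}"
        using B0[of "D t"] DA[OF t] Df A Dc[OF t] BB0 by auto
    qed (simp add: q)
    have "exp (- h) \<le> exp (- c * real r)" using r(1) c0 by (simp add: field_simps)
    also have "\<dots> = q ^ r" by (simp add: q exp_of_nat_mult[symmetric] mult.commute)
    finally have e1: "exp (- h) \<le> q ^ r" .
    \<comment> \<open>The blocks together reach slightly more than required; the slack \<open>\<tau>' - \<tau>\<close> absorbs the left-over terms.\<close>
    have thr: "\<tau>' * sqrt (2 * h * K) \<le> real r * (a * \<sigma> * sqrt B)"
    proof -
      have x1: "c / h \<le> (1 - \<theta>) / 2" using hp \<theta> by (simp add: field_simps)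
      have x2: "real r / K \<le> (1 - \<theta>) / 2"
      proof -
        have "2 / (1 - \<theta>) \<le> \<kappa> * c" using \<kappa>(2) c0 \<theta> by (simp add: field_simps)
        then have "2 / (1 - \<theta>) * real r \<le> K" using rK by (meson mult_right_mono of_nat_0_le_iff order_trans)
        then show ?thesis using \<theta> Kp by (simp add: field_simps)
      qed
      have "\<theta> \<le> 1 - c / h - real r / K" using x1 x2 by simp
      also have "\<dots> \<le> (1 - c / h) * (1 - real r / K)"
      proof -
        have "1 - x - y \<le> (1 - x) * (1 - y)" if "0 \<le> x * y" for x y :: real
          using that by (simp add: algebra_simps)
        then show ?thesis using hp c0 by simp
      qed
      finally have "\<theta> * (h * K / c) \<le> (1 - c / h) * (1 - real r / K) * (h * K / c)"
        using hp c0 by (intro mult_right_mono) auto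
      also have "\<dots> = (h / c - 1) * (real K - real r)"
        using hp c0 Kp by (simp add: field_simps)
      also have "\<dots> \<le> real r * (real r * B)"
      proof (rule mult_mono)
        have "real K \<le> real (B * r + r)" using BK2 by (simp only: of_nat_le_iff)
        then show "real K - real r \<le> real r * B" by (simp add: mult.commute)
        have "real r \<le> \<kappa> * c * real r" using \<open>real B0 + 1 \<le> \<kappa> * c\<close>
          by (intro mult_le_cancel_right1[THEN iffD2]) auto
        then show "0 \<le> real K - real r" using rK by simp
      qed (use r in auto)
      finally have main: "\<theta> * (h * K / c) \<le> real r * (real r * B)" .
      have "\<tau>'\<^sup>2 * (2 * h * K) = a\<^sup>2 * \<sigma>\<^sup>2 * (\<theta> * (h * K / c))"
        using c0 a(1) \<tau>' by (simp add: \<theta>_def field_simps)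
      also have "\<dots> \<le> a\<^sup>2 * \<sigma>\<^sup>2 * (real r * (real r * B))"
        using main by (intro mult_left_mono) auto
      finally have "sqrt (\<tau>'\<^sup>2 * (2 * h * K)) \<le> sqrt ((real r * (a * \<sigma>))\<^sup>2 * B)"
        by (intro real_sqrt_le_mono) (simp add: power2_eq_square algebra_simps)
      then show ?thesis using \<tau>' a(1) by (simp add: real_sqrt_mult mult.assoc)
    qed
    have left: "1 / 2 \<le> prob {\<omega>\<in>space M. - (d * sqrt (2 * h * K)) \<le> psum W \<omega>}"
    proof -
      let ?y = "d * sqrt (2 * h * K)"
      have y: "?y > 0" using d hp Kp by simp
      have WI: "finite W" "W \<subseteq> I" using A by (auto simp: W_def)
      then have [measurable]: "psum W \<in> borel_measurable M" by auto
      have "prob {\<omega>\<in>space M. ?y \<le> \<bar>psum W \<omega>\<bar>} \<le> real (card W) * \<sigma>\<^sup>2 / ?y\<^sup>2"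
        using psum_tail_Chebyshev[OF WI Z2 Z0 y] by (simp add: var)
      also have "\<dots> \<le> (h / c) * \<sigma>\<^sup>2 / (d\<^sup>2 * (2 * h * K))"
        using cW r(1) hp by (intro divide_mono mult_right_mono) (use d Kp hp in \<open>auto simp: power_mult_distrib\<close>)
      also have "\<dots> = \<sigma>\<^sup>2 / (d\<^sup>2 * c * K) / 2" using hp c0 d Kp by (simp add: field_simps)
      also have "\<dots> \<le> 1 / 2"
      proof -
        have "\<sigma>\<^sup>2 / (d\<^sup>2 * c) \<le> \<kappa> * h0" using \<kappa>(3) d c0 h0 by (simp add: field_simps)
        also have "\<dots> \<le> \<kappa> * h" using h \<kappa>(4) by (intro mult_left_mono) auto
        also have "\<dots> \<le> K" by (rule K)
        finally show ?thesis using d c0 Kp by (simp add: field_simps)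
      qed
      finally have le: "prob {\<omega>\<in>space M. ?y \<le> \<bar>psum W \<omega>\<bar>} \<le> 1 / 2" .
      have "1 - prob {\<omega>\<in>space M. ?y \<le> \<bar>psum W \<omega>\<bar>} = prob (space M - {\<omega>\<in>space M. ?y \<le> \<bar>psum W \<omega>\<bar>})"
        by (subst prob_compl) auto
      also have "\<dots> \<le> prob {\<omega>\<in>space M. - ?y \<le> psum W \<omega>}"
        by (intro finite_measure_mono) auto
      finally show ?thesis using le by simp
    qed
    have WU: "finite U" "finite W" "U \<subseteq> I" "W \<subseteq> I" "U \<inter> W = {}" "U \<union> W = A"
      using A UA by (auto simp: W_def intro: finite_subset)
    have [measurable]: "psum A \<in> borel_measurable M" using A by auto
    have [measurable]: "psum U \<in> borel_measurable M" using WU by auto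
    have "exp (- h) * (1/2) \<le> prob {\<omega>\<in>space M. real r * (a * \<sigma> * sqrt B) \<le> psum U \<omega>}
      * prob {\<omega>\<in>space M. - (d * sqrt (2 * h * K)) \<le> psum W \<omega>}"
      using e1 qr left by (intro mult_mono) auto
    also have "\<dots> \<le> prob {\<omega>\<in>space M. real r * (a * \<sigma> * sqrt B) + - (d * sqrt (2 * h * K)) \<le> psum (U \<union> W) \<omega>}"
      using WU by (intro prob_psum_superadditive) auto
    also have "\<dots> \<le> prob {\<omega>\<in>space M. \<tau> * sqrt (2 * h * K) \<le> psum A \<omega>}"
    proof (intro finite_measure_mono)
      have "\<tau> * sqrt (2 * h * K) \<le> real r * (a * \<sigma> * sqrt B) + - (d * sqrt (2 * h * K))"
        using thr by (simp add: d_def algebra_simps)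
      then show "{\<omega>\<in>space M. real r * (a * \<sigma> * sqrt B) + - (d * sqrt (2 * h * K)) \<le> psum (U \<union> W) \<omega>}
        \<subseteq> {\<omega>\<in>space M. \<tau> * sqrt (2 * h * K) \<le> psum A \<omega>}" using WU(6) by auto
    qed measurable
    finally show "exp (- h) / 2 \<le> prob {\<omega>\<in>space M. \<tau> * sqrt (2 * h * card A) \<le> psum A \<omega>}"
      by (simp add: K_def)
  qed (use h0 \<kappa> in auto)
qed

end

context iid_family
begin

section \<open>A large term makes the sum large\<close>

text \<open>
  If the sum over \<open>A\<close> is usually at most \<open>c\<close> and a single term is usually at most \<open>d\<close> in absolute value, then the sum with one
  term deleted is usually at most \<open>c + d\<close>. That sum is
  independent of the deleted term, which therefore makes the whole sum large whenever it is itself larger than \<open>3 * (c + d)\<close>. No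
  symmetry of the distribution is assumed.
\<close>

lemma single_jump_bound:
  assumes A: "finite A" "A \<subseteq> I" and "0 \<le> c" "0 \<le> d"
    and p: "prob {\<omega>\<in>space M. c < \<bar>psum A \<omega>\<bar>} \<le> 1 / 16"
    and pd: "prob {\<omega>\<in>space M. d < \<bar>Z \<omega>\<bar>} \<le> 1 / 16"
  shows "real (card A) * prob {\<omega>\<in>space M. 3 * (c + d) < \<bar>Z \<omega>\<bar>} \<le> 2 * prob {\<omega>\<in>space M. c < \<bar>psum A \<omega>\<bar>}"
proof -
  define t where "t = c + d"
  define q where "q = prob {\<omega>\<in>space M. 3 * t < \<bar>Z \<omega>\<bar>}"
  define P where "P = prob {\<omega>\<in>space M. c < \<bar>psum A \<omega>\<bar>}"
  have t: "0 \<le> t" "d \<le> t" "c \<le> t" using assms by (auto simp: t_def)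
  have q0: "0 \<le> q" "q \<le> 1 / 16"
  proof -
    have "q \<le> prob {\<omega>\<in>space M. d < \<bar>Z \<omega>\<bar>}" unfolding q_def
      using t by (intro finite_measure_mono) auto
    then show "q \<le> 1 / 16" using pd by simp
  qed (simp add: q_def)
  have Xs: "{\<omega>\<in>space M. \<bar>X j \<omega>\<bar> \<le> u} \<in> events" "{\<omega>\<in>space M. u < \<bar>X j \<omega>\<bar>} \<in> events"
    if "j \<in> A" for j u
  proof -
    have [measurable]: "X j \<in> borel_measurable M" using A that X_measurable by auto
    show "{\<omega>\<in>space M. \<bar>X j \<omega>\<bar> \<le> u} \<in> events" "{\<omega>\<in>space M. u < \<bar>X j \<omega>\<bar>} \<in> events"
      by measurable
  qed
  have [measurable]: "psum A \<in> borel_measurable M" using A by auto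
  have [measurable]: "psum (A - {i}) \<in> borel_measurable M" for i using A by (intro psum_measurable) auto
  have key: "real k * q / 2 \<le> P" if kA: "A' \<subseteq> A" "card A' = k" and kq: "real k * q \<le> 1 / 4" for A' k
  proof -
    have finA': "finite A'" using kA A finite_subset by blast
    \<comment> \<open>Exactly the term \<open>i\<close> of \<open>A'\<close> is large: these events are disjoint, and each of them makes the sum large.\<close>
    define G where "G i = {\<omega>\<in>space M. 3 * t < \<bar>X i \<omega>\<bar> \<and> \<bar>psum (A - {i}) \<omega>\<bar> \<le> t \<and> (\<forall>j\<in>A' - {i}. \<bar>X j \<omega>\<bar> \<le> 3 * t)}" for i
    have Gm: "G i \<in> events" if "i \<in> A'" for i
      unfolding G_def using that finA' kA
      by (intro sets.sets_Collect_conj sets.sets_Collect_finite_All Xs) (auto, measurable)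
    have tail: "prob {\<omega>\<in>space M. u < \<bar>X i \<omega>\<bar>} = prob {\<omega>\<in>space M. u < \<bar>Z \<omega>\<bar>}" if "i \<in> A" for i u
      using prob_X[of i "{x. u < \<bar>x\<bar>}"] that A by auto
    have G: "q / 2 \<le> prob (G i)" if i: "i \<in> A'" for i
    proof -
      have iA: "i \<in> A" using i kA by auto
      have [measurable]: "X i \<in> borel_measurable M" using iA A X_measurable by auto
      let ?V = "{x. \<bar>\<Sum>k\<in>A - {i}. x k\<bar> \<le> t \<and> (\<forall>j\<in>A' - {i}. \<bar>x j\<bar> \<le> 3 * t)} :: ('i \<Rightarrow> real) set"
      let ?U = "{x. 3 * t < \<bar>x i\<bar>} :: ('i \<Rightarrow> real) set"
      let ?PM = "\<lambda>K. PiM K (\<lambda>_. borel) :: ('i \<Rightarrow> real) measure"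
      have iv: "indep_var (?PM {i}) (\<lambda>\<omega>. restrict (\<lambda>i. X i \<omega>) {i}) (?PM (A - {i})) (\<lambda>\<omega>. restrict (\<lambda>i. X i \<omega>) (A - {i}))"
        using iA A by (intro indep_var_restrict[OF indep]) auto
      have Um: "?U \<inter> space (?PM {i}) \<in> sets (?PM {i})"
      proof -
        have "{x\<in>space (?PM {i}). 3 * t < \<bar>x i\<bar>} \<in> sets (?PM {i})" by measurable
        then show ?thesis by (simp add: Int_def conj_commute)
      qed
      have Vm: "?V \<inter> space (?PM (A - {i})) \<in> sets (?PM (A - {i}))"
      proof -
        have [measurable]: "(\<lambda>x. x j) \<in> borel_measurable (?PM (A - {i}))" if "j \<in> A' - {i}" for j
          using that kA by (intro measurable_component_singleton) auto
        have "{x\<in>space (?PM (A - {i})). \<bar>x j\<bar> \<le> 3 * t} \<in> sets (?PM (A - {i}))" if "j \<in> A' - {i}" for j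
          using that by measurable
        moreover have "{x\<in>space (?PM (A - {i})). \<bar>\<Sum>k\<in>A - {i}. x k\<bar> \<le> t} \<in> sets (?PM (A - {i}))"
          by measurable
        ultimately have "{x\<in>space (?PM (A - {i})). \<bar>\<Sum>k\<in>A - {i}. x k\<bar> \<le> t \<and> (\<forall>j\<in>A' - {i}. \<bar>x j\<bar> \<le> 3 * t)} \<in> sets (?PM (A - {i}))"
          using finA' by (intro sets.sets_Collect_conj sets.sets_Collect_finite_All) auto
        then show ?thesis by (simp add: Int_def conj_commute)
      qed
      have r1: "restrict (\<lambda>i. X i \<omega>) {i} \<in> space (?PM {i})" for \<omega> by (simp add: space_PiM)
      have r2: "restrict (\<lambda>i. X i \<omega>) (A - {i}) \<in> space (?PM (A - {i}))" for \<omega> by (simp add: space_PiM)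
      have r3: "(\<Sum>k\<in>A - {i}. restrict (\<lambda>i. X i \<omega>) (A - {i}) k) = psum (A - {i}) \<omega>" for \<omega>
        unfolding psum_def by (rule sum.cong) auto
      have r4: "(\<forall>j\<in>A' - {i}. \<bar>restrict (\<lambda>i. X i \<omega>) (A - {i}) j\<bar> \<le> 3 * t) \<longleftrightarrow> (\<forall>j\<in>A' - {i}. \<bar>X j \<omega>\<bar> \<le> 3 * t)"
        for \<omega> using kA by (intro ball_cong) auto
      have "prob ((\<lambda>\<omega>. (restrict (\<lambda>i. X i \<omega>) {i}, restrict (\<lambda>i. X i \<omega>) (A - {i}))) -`
           ((?U \<inter> space (?PM {i})) \<times> (?V \<inter> space (?PM (A - {i})))) \<inter> space M)
        = prob ((\<lambda>\<omega>. restrict (\<lambda>i. X i \<omega>) {i}) -` (?U \<inter> space (?PM {i})) \<inter> space M)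
          * prob ((\<lambda>\<omega>. restrict (\<lambda>i. X i \<omega>) (A - {i})) -` (?V \<inter> space (?PM (A - {i}))) \<inter> space M)"
        by (rule indep_varD[OF iv Um Vm])
      also have "(\<lambda>\<omega>. (restrict (\<lambda>i. X i \<omega>) {i}, restrict (\<lambda>i. X i \<omega>) (A - {i}))) -`
           ((?U \<inter> space (?PM {i})) \<times> (?V \<inter> space (?PM (A - {i})))) \<inter> space M = G i"
      proof (rule set_eqI)
        fix \<omega>
        show "\<omega> \<in> (\<lambda>\<omega>. (restrict (\<lambda>i. X i \<omega>) {i}, restrict (\<lambda>i. X i \<omega>) (A - {i}))) -`
           ((?U \<inter> space (?PM {i})) \<times> (?V \<inter> space (?PM (A - {i})))) \<inter> space M \<longleftrightarrow> \<omega> \<in> G i"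
          using r1[of \<omega>] r2[of \<omega>] r3[of \<omega>] r4[of \<omega>] by (simp add: G_def conj_commute conj_left_commute)
      qed
      also have "(\<lambda>\<omega>. restrict (\<lambda>i. X i \<omega>) {i}) -` (?U \<inter> space (?PM {i})) \<inter> space M
        = {\<omega>\<in>space M. 3 * t < \<bar>X i \<omega>\<bar>}"
      proof (rule set_eqI)
        fix \<omega>
        show "\<omega> \<in> (\<lambda>\<omega>. restrict (\<lambda>i. X i \<omega>) {i}) -` (?U \<inter> space (?PM {i})) \<inter> space M \<longleftrightarrow>
            \<omega> \<in> {\<omega>\<in>space M. 3 * t < \<bar>X i \<omega>\<bar>}"
          using r1[of \<omega>] by (simp add: conj_commute)
      qed
      also have "(\<lambda>\<omega>. restrict (\<lambda>i. X i \<omega>) (A - {i})) -` (?V \<inter> space (?PM (A - {i}))) \<inter> space M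
        = {\<omega>\<in>space M. \<bar>psum (A - {i}) \<omega>\<bar> \<le> t \<and> (\<forall>j\<in>A' - {i}. \<bar>X j \<omega>\<bar> \<le> 3 * t)}"
      proof (rule set_eqI)
        fix \<omega>
        show "\<omega> \<in> (\<lambda>\<omega>. restrict (\<lambda>i. X i \<omega>) (A - {i})) -` (?V \<inter> space (?PM (A - {i}))) \<inter> space M \<longleftrightarrow>
            \<omega> \<in> {\<omega>\<in>space M. \<bar>psum (A - {i}) \<omega>\<bar> \<le> t \<and> (\<forall>j\<in>A' - {i}. \<bar>X j \<omega>\<bar> \<le> 3 * t)}"
          using r2[of \<omega>] r3[of \<omega>] r4[of \<omega>] by (simp add: conj_commute conj_left_commute)
      qed
      finally have PG: "prob (G i) = q * prob {\<omega>\<in>space M. \<bar>psum (A - {i}) \<omega>\<bar> \<le> t \<and> (\<forall>j\<in>A' - {i}. \<bar>X j \<omega>\<bar> \<le> 3 * t)}"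
        using tail[OF iA] by (simp add: q_def)
      let ?E = "{\<omega>\<in>space M. c < \<bar>psum A \<omega>\<bar>} \<union> {\<omega>\<in>space M. d < \<bar>X i \<omega>\<bar>} \<union> (\<Union>j\<in>A'. {\<omega>\<in>space M. 3 * t < \<bar>X j \<omega>\<bar>})"
      have UNm: "(\<Union>j\<in>A'. {\<omega>\<in>space M. 3 * t < \<bar>X j \<omega>\<bar>}) \<in> events"
        using kA finA' by (intro sets.finite_UN Xs) auto
      have E: "prob ?E \<le> 1 / 2"
      proof -
        have "prob ?E \<le> prob {\<omega>\<in>space M. c < \<bar>psum A \<omega>\<bar>} + prob {\<omega>\<in>space M. d < \<bar>X i \<omega>\<bar>} + prob (\<Union>j\<in>A'. {\<omega>\<in>space M. 3 * t < \<bar>X j \<omega>\<bar>})"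
          using UNm by (intro order_trans[OF measure_Un_le] add_mono) auto
        also have "prob (\<Union>j\<in>A'. {\<omega>\<in>space M. 3 * t < \<bar>X j \<omega>\<bar>}) \<le> (\<Sum>j\<in>A'. prob {\<omega>\<in>space M. 3 * t < \<bar>X j \<omega>\<bar>})"
          using kA finA' by (intro measure_UNION_le Xs) auto
        also have "\<dots> = real k * q"
          using tail kA by (subst sum.cong[OF refl, where h="\<lambda>_. q"]) (auto simp: q_def)
        finally show ?thesis using p pd kq tail[OF iA, of d] by simp
      qed
      have "1 / 2 \<le> 1 - prob ?E" using E by simp
      also have "\<dots> = prob (space M - ?E)" using UNm by (subst prob_compl) auto
      also have "\<dots> \<le> prob {\<omega>\<in>space M. \<bar>psum (A - {i}) \<omega>\<bar> \<le> t \<and> (\<forall>j\<in>A' - {i}. \<bar>X j \<omega>\<bar> \<le> 3 * t)}"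
      proof (intro finite_measure_mono)
        have "psum A \<omega> = X i \<omega> + psum (A - {i}) \<omega>" for \<omega>
          unfolding psum_def by (rule sum.remove[OF A(1) iA])
        then show "space M - ?E \<subseteq> {\<omega>\<in>space M. \<bar>psum (A - {i}) \<omega>\<bar> \<le> t \<and> (\<forall>j\<in>A' - {i}. \<bar>X j \<omega>\<bar> \<le> 3 * t)}"
          by (force simp: t_def not_less)
        show "{\<omega>\<in>space M. \<bar>psum (A - {i}) \<omega>\<bar> \<le> t \<and> (\<forall>j\<in>A' - {i}. \<bar>X j \<omega>\<bar> \<le> 3 * t)} \<in> events"
          using finA' kA
          by (intro sets.sets_Collect_conj sets.sets_Collect_finite_All Xs) (auto, measurable)
      qed
      finally show ?thesis unfolding PG using mult_left_mono[OF _ q0(1), of "1/2"] by simp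
    qed
    have "disjoint_family_on G A'"
      by (force simp: disjoint_family_on_def G_def)
    then have "(\<Sum>i\<in>A'. prob (G i)) = prob (\<Union>i\<in>A'. G i)"
      using finA' Gm by (intro finite_measure_finite_Union[symmetric]) auto
    also have "\<dots> \<le> P" unfolding P_def
    proof (intro finite_measure_mono subsetI)
      fix \<omega> assume "\<omega> \<in> (\<Union>i\<in>A'. G i)"
      then obtain i where i: "i \<in> A'" "\<omega> \<in> G i" by auto
      then have "psum A \<omega> = X i \<omega> + psum (A - {i}) \<omega>"
        unfolding psum_def using kA by (intro sum.remove[OF A(1)]) auto
      then show "\<omega> \<in> {\<omega>\<in>space M. c < \<bar>psum A \<omega>\<bar>}" using i t by (auto simp: G_def)
    qed measurable
    finally have "(\<Sum>i\<in>A'. prob (G i)) \<le> P" .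
    moreover have "(\<Sum>i\<in>A'. q / 2) \<le> (\<Sum>i\<in>A'. prob (G i))" by (intro sum_mono G)
    ultimately show ?thesis using kA by simp
  qed
  show ?thesis
  proof (cases "real (card A) * q \<le> 1 / 4")
    case True
    then show ?thesis using key[of A "card A"] by (simp add: P_def q_def t_def)
  next
    case False
    then have q: "q > 0" using q0 by (cases "q = 0") auto
    \<comment> \<open>Otherwise \<open>k\<close> terms with \<open>k * q\<close> just below \<open>1 / 4\<close> contradict the assumption that the sum is rarely large.\<close>
    define k where "k = nat \<lfloor>1 / (4 * q)\<rfloor>"
    have "real k \<le> 1 / (4 * q)" "1 / (4 * q) - 1 \<le> real k"
    proof -
      have "0 \<le> 1 / (4 * q)" using q by simp
      then have "real k = real_of_int \<lfloor>1 / (4 * q)\<rfloor>" by (simp add: k_def)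
      then show "real k \<le> 1 / (4 * q)" "1 / (4 * q) - 1 \<le> real k" by linarith+
    qed
    then have k: "real k * q \<le> 1 / 4" "1 / 4 - q \<le> real k * q" using q by (auto simp: field_simps)
    have "real k * q \<le> real (card A) * q" using k False by simp
    then have "k \<le> card A" using q by simp
    then obtain A' where "A' \<subseteq> A" "card A' = k" using obtain_subset_with_card_n by metis
    then have "real k * q / 2 \<le> P" using key k by blast
    then show ?thesis using k q0 p by (simp add: P_def)
  qed
qed

end

section \<open>Grids, windows and cells\<close>

text \<open>
  The increasing sequence that starts in \<open>u0\<close> and goes from \<open>u\<close> to \<open>u + s u\<close>. It cuts \<open>{u0..}\<close> into the cells
  \<open>{u..<u + s u}\<close>, and sums over the grid are compared with sums over all integers cell by cell.
\<close>

definition grid :: "(nat \<Rightarrow> nat) \<Rightarrow> nat \<Rightarrow> nat \<Rightarrow> nat" where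
  "grid s u0 k = ((\<lambda>u. u + s u) ^^ k) u0"

lemma grid_0 [simp]: "grid s u0 0 = u0"
  and grid_Suc: "grid s u0 (Suc k) = grid s u0 k + s (grid s u0 k)"
  by (simp_all add: grid_def)

lemma grid_ge: "u0 \<le> grid s u0 k"
  by (induction k) (auto simp: grid_Suc)

lemma grid_mono: "i \<le> j \<Longrightarrow> grid s u0 i \<le> grid s u0 j"
  by (rule lift_Suc_mono_le[of "grid s u0"]) (simp_all add: grid_Suc)

context
  fixes s :: "nat \<Rightarrow> nat" and u0 :: nat
  assumes s_pos: "\<And>u. u0 \<le> u \<Longrightarrow> 1 \<le> s u"
begin

lemma grid_ge_index: "k \<le> grid s u0 k"
proof (induction k)
  case (Suc k)
  then show ?case using s_pos[OF grid_ge, of s k] by (simp add: grid_Suc)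
qed simp

lemma grid_cell:
  assumes "u0 \<le> m"
  obtains i where "grid s u0 i \<le> m" "m < grid s u0 i + s (grid s u0 i)"
proof -
  define i where "i = (LEAST i. m < grid s u0 (Suc i))"
  have "m < grid s u0 (Suc m)" using grid_ge_index[of "Suc m"] by simp
  then have i: "m < grid s u0 (Suc i)" unfolding i_def by (rule LeastI)
  have "grid s u0 i \<le> m"
  proof (cases i)
    case (Suc j)
    then have "\<not> m < grid s u0 (Suc j)" using not_less_Least[of j "\<lambda>i. m < grid s u0 (Suc i)"] i_def by auto
    then show ?thesis using Suc by simp
  qed (use assms in simp)
  then show thesis using i that by (simp add: grid_Suc)
qed

end

lemma sum_grid_cells:
  fixes H :: "nat \<Rightarrow> real"
  shows "(\<Sum>i<N. \<Sum>m\<in>{grid s u0 i..<grid s u0 i + s (grid s u0 i)}. H m) = (\<Sum>m\<in>{u0..<grid s u0 N}. H m)"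
proof (induction N)
  case (Suc N)
  have "{u0..<grid s u0 (Suc N)} = {u0..<grid s u0 N} \<union> {grid s u0 N..<grid s u0 N + s (grid s u0 N)}"
    using grid_ge[of u0 s N] by (auto simp: grid_Suc)
  then show ?case using Suc by (simp add: sum.union_disjoint ivl_disj_int)
qed simp

lemma summable_grid:
  fixes G H :: "nat \<Rightarrow> real"
  assumes "summable H" and H: "\<And>m. 0 \<le> H m" and G: "\<And>u. 0 \<le> G u"
    and le: "\<And>u. u0 \<le> u \<Longrightarrow> G u \<le> (\<Sum>m\<in>{u..<u + s u}. H m)"
  shows "summable (\<lambda>i. G (grid s u0 i))"
proof (rule summableI_nonneg_bounded)
  fix N
  have "(\<Sum>i<N. G (grid s u0 i)) \<le> (\<Sum>i<N. \<Sum>m\<in>{grid s u0 i..<grid s u0 i + s (grid s u0 i)}. H m)"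
    by (intro sum_mono le grid_ge)
  also have "\<dots> \<le> suminf H"
    unfolding sum_grid_cells by (intro sum_le_suminf assms) auto
  finally show "(\<Sum>i<N. G (grid s u0 i)) \<le> suminf H" .
qed (rule G)

lemma summable_of_grid:
  fixes G H :: "nat \<Rightarrow> real"
  assumes s_pos: "\<And>u. u0 \<le> u \<Longrightarrow> 1 \<le> s u"
    and G: "summable (\<lambda>i. G (grid s u0 i))" and H: "\<And>m. 0 \<le> H m" and G0: "\<And>u. 0 \<le> G u"
    and le: "\<And>u. u0 \<le> u \<Longrightarrow> (\<Sum>m\<in>{u..<u + s u}. H m) \<le> G u"
  shows "summable H"
proof (rule summableI_nonneg_bounded)
  fix N
  have "(\<Sum>m<N. H m) \<le> (\<Sum>m\<in>{..<u0} \<union> {u0..<grid s u0 N}. H m)"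
    using grid_ge_index[of u0 s N] s_pos by (intro sum_mono2) (auto simp: H)
  also have "\<dots> = (\<Sum>m<u0. H m) + (\<Sum>m\<in>{u0..<grid s u0 N}. H m)"
    by (intro sum.union_disjoint) auto
  also have "(\<Sum>m\<in>{u0..<grid s u0 N}. H m) \<le> (\<Sum>i<N. G (grid s u0 i))"
    unfolding sum_grid_cells[symmetric] by (intro sum_mono le grid_ge)
  also have "\<dots> \<le> (\<Sum>i. G (grid s u0 i))" by (intro sum_le_suminf G) (auto simp: G0)
  finally show "(\<Sum>m<N. H m) \<le> (\<Sum>m<u0. H m) + (\<Sum>i. G (grid s u0 i))" by simp
qed (rule H)

text \<open>
  The windows of one coordinate: the integers from \<open>m\<close> to \<open>m + \<phi> m\<close>, for a length \<open>\<phi> m\<close> that need not be an integer.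
\<close>

definition window :: "(nat \<Rightarrow> real) \<Rightarrow> nat \<Rightarrow> nat set" where
  "window \<phi> m = {i. 1 \<le> i \<and> m \<le> i \<and> real i \<le> real m + \<phi> m}"

text \<open>
  For nondecreasing \<open>\<phi>\<close>, this is contained in all windows that start at a positive \<open>m\<close> with \<open>u \<le> m \<le> u'\<close>.
\<close>

definition window_core :: "(nat \<Rightarrow> real) \<Rightarrow> nat \<Rightarrow> nat \<Rightarrow> nat set" where
  "window_core \<phi> u u' = {i. u' \<le> i \<and> real i \<le> real u + \<phi> u}"

lemma window_eq:
  assumes "1 \<le> m" "0 \<le> \<phi> m"
  shows "window \<phi> m = {m..m + nat \<lfloor>\<phi> m\<rfloor>}"
proof -
  have "real i \<le> real m + \<phi> m \<longleftrightarrow> i \<le> m + nat \<lfloor>\<phi> m\<rfloor>" if "m \<le> i" for i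
  proof -
    have "real i \<le> real m + \<phi> m \<longleftrightarrow> real_of_int (int i - int m) \<le> \<phi> m" by auto
    also have "\<dots> \<longleftrightarrow> int i - int m \<le> \<lfloor>\<phi> m\<rfloor>" by (rule le_floor_iff[symmetric])
    also have "\<dots> \<longleftrightarrow> i \<le> m + nat \<lfloor>\<phi> m\<rfloor>" using assms(2) by linarith
    finally show ?thesis .
  qed
  then show ?thesis using assms by (auto simp: window_def)
qed

lemma card_window:
  fixes \<phi> :: "nat \<Rightarrow> real"
  assumes "1 \<le> m" "0 \<le> \<phi> m"
  shows "finite (window \<phi> m)" "\<phi> m \<le> card (window \<phi> m)" "card (window \<phi> m) \<le> \<phi> m + 1"
proof -
  have "real (nat \<lfloor>\<phi> m\<rfloor>) = real_of_int \<lfloor>\<phi> m\<rfloor>" using assms by simp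
  then show "finite (window \<phi> m)" "\<phi> m \<le> card (window \<phi> m)" "card (window \<phi> m) \<le> \<phi> m + 1"
    unfolding window_eq[of m \<phi>, OF assms] by (simp; linarith)+
qed

text \<open>
  The asymptotic properties that the two side lengths \<open>m powr \<alpha>\<close> and \<open>n / ln n\<close> have in common: eventually
  nondecreasing with slope at most \<open>1\<close>, unbounded, and at most as long as the starting point.
\<close>

definition window_length :: "(nat \<Rightarrow> real) \<Rightarrow> bool" where
  "window_length \<phi> \<longleftrightarrow> (\<exists>U. \<forall>u v. U \<le> u \<longrightarrow> u \<le> v \<longrightarrow> \<phi> u \<le> \<phi> v \<and> \<phi> v - \<phi> u \<le> real v - real u)
     \<and> filterlim \<phi> at_top sequentially \<and> (\<forall>\<^sub>F u in sequentially. \<phi> u \<le> real u)"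

text \<open>
  The length of a cell that starts in \<open>u\<close>: a fraction \<open>\<delta>\<close> of the window length, rounded up.
\<close>

definition step :: "real \<Rightarrow> (nat \<Rightarrow> real) \<Rightarrow> nat \<Rightarrow> nat" where
  "step \<delta> \<phi> u = nat \<lceil>\<delta> * \<phi> u\<rceil>"

text \<open>
  All that is used of a cell starting in \<open>u\<close>: the windows starting in it contain the core, exceed it by a fraction of order \<open>\<delta>\<close>
  only, and stay in \<open>{u..4 * u}\<close>.
\<close>

definition regular_cell :: "(nat \<Rightarrow> real) \<Rightarrow> real \<Rightarrow> nat \<Rightarrow> bool" where
  "regular_cell \<phi> \<delta> u \<longleftrightarrow> 1 \<le> step \<delta> \<phi> u \<and> step \<delta> \<phi> u \<le> u \<and> \<delta> * \<phi> u \<le> real (step \<delta> \<phi> u) \<and> 1 \<le> \<phi> u \<and>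
    (\<forall>m. u \<le> m \<longrightarrow> m < u + step \<delta> \<phi> u \<longrightarrow>
      \<phi> u \<le> \<phi> m \<and> finite (window \<phi> m) \<and> window_core \<phi> u (u + step \<delta> \<phi> u) \<subseteq> window \<phi> m \<and>
      real (card (window \<phi> m - window_core \<phi> u (u + step \<delta> \<phi> u))) \<le> 4 * \<delta> * \<phi> u \<and>
      real (card (window_core \<phi> u (u + step \<delta> \<phi> u))) \<le> (1 + \<delta>) * \<phi> u \<and>
      real (card (window \<phi> m)) \<le> 3 * \<phi> u \<and> window \<phi> m \<subseteq> {u..4 * u})"

lemma window_cell:
  fixes \<delta> :: real and \<phi> :: "nat \<Rightarrow> real"
  assumes "window_length \<phi>" "0 < \<delta>" "\<delta> \<le> 1"
  shows "\<forall>\<^sub>F u in sequentially. regular_cell \<phi> \<delta> u"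
proof -
  obtain U where U: "\<And>u v. U \<le> u \<Longrightarrow> u \<le> v \<Longrightarrow> \<phi> u \<le> \<phi> v \<and> \<phi> v - \<phi> u \<le> real v - real u"
    using assms(1) unfolding window_length_def by blast
  \<comment> \<open>From here on rounding errors are at most a quarter of \<open>\<delta> * \<phi> u\<close>.\<close>
  have "\<forall>\<^sub>F u in sequentially. 4 / \<delta> \<le> \<phi> u"
    using assms(1) unfolding window_length_def filterlim_at_top by blast
  moreover have "\<forall>\<^sub>F u in sequentially. \<phi> u \<le> real u"
    using assms(1) unfolding window_length_def by blast
  ultimately have "\<forall>\<^sub>F u in sequentially. 4 / \<delta> \<le> \<phi> u \<and> \<phi> u \<le> real u \<and> max U 1 \<le> u"
    using eventually_ge_at_top[of "max U 1"] by eventually_elim auto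
  then obtain V where V: "\<And>u. V \<le> u \<Longrightarrow> 4 / \<delta> \<le> \<phi> u \<and> \<phi> u \<le> real u \<and> max U 1 \<le> u"
    unfolding eventually_sequentially by blast
  show ?thesis unfolding eventually_sequentially regular_cell_def
  proof (intro exI[of _ V] allI impI)
    fix u assume u: "V \<le> u"
    have p: "4 \<le> \<delta> * \<phi> u" "\<phi> u \<le> u" "U \<le> u" "1 \<le> u"
      using V[OF u] \<open>0 < \<delta>\<close> by (auto simp: field_simps)
    have p0: "0 < \<phi> u" using p(1) \<open>0 < \<delta>\<close> by (metis less_le_trans zero_less_mult_pos zero_less_numeral)
    have dl: "\<delta> * \<phi> u \<le> \<phi> u" using p0 assms by simp
    have p4: "4 \<le> \<phi> u" using p(1) dl by simp
    define w where "w = step \<delta> \<phi> u"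
    have w: "\<delta> * \<phi> u \<le> real w" "real w < \<delta> * \<phi> u + 1" "1 \<le> w" "w \<le> u"
      using p dl by (auto simp: w_def step_def) linarith+
    show "1 \<le> step \<delta> \<phi> u \<and> step \<delta> \<phi> u \<le> u \<and> \<delta> * \<phi> u \<le> real (step \<delta> \<phi> u) \<and> 1 \<le> \<phi> u \<and>
    (\<forall>m. u \<le> m \<longrightarrow> m < u + step \<delta> \<phi> u \<longrightarrow>
      \<phi> u \<le> \<phi> m \<and> finite (window \<phi> m) \<and> window_core \<phi> u (u + step \<delta> \<phi> u) \<subseteq> window \<phi> m \<and>
      real (card (window \<phi> m - window_core \<phi> u (u + step \<delta> \<phi> u))) \<le> 4 * \<delta> * \<phi> u \<and>
      real (card (window_core \<phi> u (u + step \<delta> \<phi> u))) \<le> (1 + \<delta>) * \<phi> u \<and>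
      real (card (window \<phi> m)) \<le> 3 * \<phi> u \<and> window \<phi> m \<subseteq> {u..4 * u})"
      unfolding w_def[symmetric]
    proof (intro conjI allI impI)
      fix m assume m: "u \<le> m" "m < u + w"
      let ?C = "window_core \<phi> u (u + w)"
      have mm: "\<phi> u \<le> \<phi> m" "\<phi> m - \<phi> u \<le> real m - real u" using U[of u m] p m by auto
      show "\<phi> u \<le> \<phi> m" by fact
      have m1: "1 \<le> m" "0 \<le> \<phi> m" using m p mm p0 by auto
      have mV: "\<phi> m \<le> real m" using V[of m] u m by auto
      note cw = card_window[of m \<phi>, OF m1]
      show "finite (window \<phi> m)" by (rule cw)
      show sub: "?C \<subseteq> window \<phi> m"
        using m m1 mm by (auto simp: window_core_def window_def)
      have "real m - real u \<le> real w" using m by linarith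
      then show "real (card (window \<phi> m)) \<le> 3 * \<phi> u" using cw(3) mm w dl p4 by linarith
      show "window \<phi> m \<subseteq> {u..4 * u}"
      proof
        fix i assume i: "i \<in> window \<phi> m"
        then have "real i \<le> real m + real m" "m \<le> i" using mV by (auto simp: window_def)
        then show "i \<in> {u..4 * u}" using m w by auto
      qed
      have "?C \<subseteq> window \<phi> u" using p by (auto simp: window_core_def window_def)
      then have "card ?C \<le> card (window \<phi> u)"
        using card_window[of u \<phi>] p p0 by (intro card_mono) auto
      then have "real (card ?C) \<le> \<phi> u + 1" using card_window(3)[of u \<phi>] p p0 by linarith
      then show "real (card ?C) \<le> (1 + \<delta>) * \<phi> u" using p(1) by (simp add: algebra_simps)
      have "{i. real u + \<phi> u < real i \<and> real i \<le> real m + \<phi> m} \<subseteq> {u + nat \<lfloor>\<phi> u\<rfloor> <.. m + nat \<lfloor>\<phi> m\<rfloor>}"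
        (is "?D \<subseteq> ?D'")
        using p0 m1 by (auto; linarith)
      \<comment> \<open>A point of the window outside the core lies before the next cell or beyond the end of the first window of this cell.\<close>
      have "window \<phi> m - ?C \<subseteq> {m..<u + w} \<union> ?D"
        by (auto simp: window_def window_core_def)
      also have "\<dots> \<subseteq> {m..<u + w} \<union> ?D'" using \<open>?D \<subseteq> ?D'\<close> by blast
      finally have "card (window \<phi> m - ?C) \<le> card ({m..<u + w} \<union> ?D')"
        by (intro card_mono) auto
      also have "\<dots> \<le> card {m..<u + w} + card ?D'" by (rule card_Un_le)
      also have "\<dots> = (u + w - m) + (m + nat \<lfloor>\<phi> m\<rfloor> - (u + nat \<lfloor>\<phi> u\<rfloor>))" by simp
      finally have "real (card (window \<phi> m - ?C)) \<le> real ((u + w - m) + (m + nat \<lfloor>\<phi> m\<rfloor> - (u + nat \<lfloor>\<phi> u\<rfloor>)))"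
        by (simp only: of_nat_le_iff)
      also have "\<dots> \<le> real w + \<phi> m - \<phi> u + 1"
      proof -
        have f: "\<lfloor>\<phi> u\<rfloor> \<le> \<lfloor>\<phi> m\<rfloor>" using mm by (intro floor_mono)
        have "real (m + nat \<lfloor>\<phi> m\<rfloor> - (u + nat \<lfloor>\<phi> u\<rfloor>)) = real m + real_of_int \<lfloor>\<phi> m\<rfloor> - real u - real_of_int \<lfloor>\<phi> u\<rfloor>"
          using f m p0 m1 by (subst of_nat_diff) auto
        moreover have "real (u + w - m) = real u + real w - real m" using m by (subst of_nat_diff) auto
        moreover have "real_of_int \<lfloor>\<phi> m\<rfloor> \<le> \<phi> m" "\<phi> u - 1 \<le> real_of_int \<lfloor>\<phi> u\<rfloor>" by linarith+
        ultimately show ?thesis unfolding of_nat_add by linarith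
      qed
      also have "\<dots> \<le> 2 * real w + 1" using mm \<open>real m - real u \<le> real w\<close> by simp
      also have "\<dots> \<le> 4 * \<delta> * \<phi> u" using w p(1) by simp
      finally show "real (card (window \<phi> m - ?C)) \<le> 4 * \<delta> * \<phi> u" .
    qed (use w p4 in auto)
  qed
qed

text \<open>
  The window length in the first coordinate.
\<close>

definition row_length :: "real \<Rightarrow> nat \<Rightarrow> real" where
  "row_length \<alpha> m = real m powr \<alpha>"

text \<open>
  The window length in the second coordinate.
\<close>

definition col_length :: "nat \<Rightarrow> real" where
  "col_length n = real n / ln (real n)"

lemma window_length_row:
  assumes "0 < \<alpha>" "\<alpha> < 1"
  shows "window_length (row_length \<alpha>)"
  unfolding window_length_def
proof (intro conjI exI[of _ 1] allI impI)
  fix u v :: nat assume uv: "1 \<le> u" "u \<le> v"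
  show "row_length \<alpha> u \<le> row_length \<alpha> v"
    using uv assms by (auto simp: row_length_def intro!: powr_mono2)
  show "row_length \<alpha> v - row_length \<alpha> u \<le> real v - real u"
  proof -
    have "(\<lambda>x. x - x powr \<alpha>) (real u) \<le> (\<lambda>x. x - x powr \<alpha>) (real v)"
    proof (rule DERIV_nonneg_imp_nondecreasing[where f="\<lambda>x. x - x powr \<alpha>"])
      fix x assume x: "real u \<le> x"
      then have x1: "x \<ge> 1" using uv by simp
      have "x powr (\<alpha> - 1) \<le> x powr 0" using x1 assms by (intro powr_mono) auto
      then have "\<alpha> * x powr (\<alpha> - 1) \<le> 1" using assms x1 by (intro mult_le_one) auto
      moreover have "((\<lambda>x. x - x powr \<alpha>) has_real_derivative 1 - \<alpha> * x powr (\<alpha> - 1)) (at x)"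
        using x1 by (auto intro!: derivative_eq_intros)
      ultimately show "\<exists>y. ((\<lambda>x. x - x powr \<alpha>) has_real_derivative y) (at x) \<and> 0 \<le> y" by force
    qed (use uv in auto)
    then show ?thesis by (simp add: row_length_def)
  qed
next
  show "filterlim (row_length \<alpha>) at_top sequentially"
    unfolding row_length_def[abs_def] using assms by real_asymp
  show "\<forall>\<^sub>F u in sequentially. row_length \<alpha> u \<le> real u"
    using eventually_ge_at_top[of 1]
  proof eventually_elim
    case (elim u)
    have "real u powr \<alpha> \<le> real u powr 1" using elim assms by (intro powr_mono) auto
    then show ?case using elim by (simp add: row_length_def)
  qed
qed

lemma ln_3_ge_1: "1 \<le> ln (3::real)"
  using exp_le by (subst ln_ge_iff) auto

lemma col_length_mono:
  assumes "3 \<le> u" "u \<le> v"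
  shows "col_length u \<le> col_length v"
proof -
  have "(\<lambda>x. x / ln x) (real u) \<le> (\<lambda>x. x / ln x) (real v)"
  proof (rule DERIV_nonneg_imp_nondecreasing[where f="\<lambda>x. x / ln x"])
    fix x assume x: "real u \<le> x"
    have "ln 3 \<le> ln x" using x assms by (subst ln_le_cancel_iff) auto
    then have l: "1 \<le> ln x" using ln_3_ge_1 by simp
    have "((\<lambda>x. x / ln x) has_real_derivative (ln x - 1) / (ln x)\<^sup>2) (at x)"
      using x assms l by (auto intro!: derivative_eq_intros simp: power2_eq_square field_simps)
    then show "\<exists>y. ((\<lambda>x. x / ln x) has_real_derivative y) (at x) \<and> 0 \<le> y"
      using l by (intro exI conjI) auto
  qed (use assms in auto)
  then show ?thesis by (simp add: col_length_def)
qed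

lemma window_length_col: "window_length col_length"
  unfolding window_length_def
proof (intro conjI exI[of _ 3] allI impI)
  fix u v :: nat assume uv: "3 \<le> u" "u \<le> v"
  show "col_length u \<le> col_length v" using uv by (rule col_length_mono)
  have "(\<lambda>x. x - x / ln x) (real u) \<le> (\<lambda>x. x - x / ln x) (real v)"
  proof (rule DERIV_nonneg_imp_nondecreasing[where f="\<lambda>x. x - x / ln x"])
    fix x assume x: "real u \<le> x"
    have "ln 3 \<le> ln x" using x uv by (subst ln_le_cancel_iff) auto
    then have l: "1 \<le> ln x" using ln_3_ge_1 by simp
    have d: "((\<lambda>x. x - x / ln x) has_real_derivative 1 - (ln x - 1) / (ln x)\<^sup>2) (at x)"
      using x uv l by (auto intro!: derivative_eq_intros simp: power2_eq_square field_simps)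
    have "ln x * 1 \<le> ln x * ln x" using l by (intro mult_left_mono) auto
    then have "ln x - 1 \<le> (ln x)\<^sup>2" unfolding power2_eq_square by linarith
    then have "(ln x - 1) / (ln x)\<^sup>2 \<le> 1" using l by simp
    then show "\<exists>y. ((\<lambda>x. x - x / ln x) has_real_derivative y) (at x) \<and> 0 \<le> y"
      using d by (intro exI conjI) auto
  qed (use uv in auto)
  then show "col_length v - col_length u \<le> real v - real u" by (simp add: col_length_def)
next
  show "filterlim col_length at_top sequentially"
    unfolding col_length_def[abs_def] by real_asymp
  show "\<forall>\<^sub>F u in sequentially. col_length u \<le> real u"
    unfolding col_length_def[abs_def] by real_asymp
qed

text \<open>
  A grid whose steps are at least of order \<open>u powr (1 - \<beta> + \<kappa>)\<close> is sparse enough for \<open>u powr - \<beta>\<close> to be summable along it,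
  since \<open>u powr - \<beta>\<close> is at most a constant times the sum of \<open>m powr - (1 + \<kappa>)\<close> over the cell of \<open>u\<close>.
\<close>

lemma summable_powr_grid:
  fixes \<beta> \<kappa> c \<delta> :: real
  assumes "0 < \<kappa>" "0 < c" "0 < \<delta>" "1 \<le> u0"
    and \<phi>: "\<And>u. u0 \<le> u \<Longrightarrow> c * real u powr (1 - \<beta> + \<kappa>) \<le> \<phi> u"
    and s: "\<And>u. u0 \<le> u \<Longrightarrow> \<delta> * \<phi> u \<le> real (s u)" "\<And>u. u0 \<le> u \<Longrightarrow> s u \<le> u"
  shows "summable (\<lambda>i. real (grid s u0 i) powr - \<beta>)"
proof (rule summable_grid[where G="\<lambda>u. real u powr - \<beta>"])
  let ?H = "\<lambda>m. (2 powr (1 + \<kappa>) / (c * \<delta>)) * real m powr (- (1 + \<kappa>))"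
  show "summable ?H"
    using assms by (intro summable_mult) (simp add: summable_real_powr_iff)
  fix u assume u: "u0 \<le> u"
  have up: "real u > 0" using u assms by simp
  have "real u powr - \<beta> = (c * \<delta> * real u powr (1 - \<beta> + \<kappa>)) * ((2 powr (1 + \<kappa>) / (c * \<delta>)) * (2 * real u) powr (- (1 + \<kappa>)))"
  proof -
    have "(2 * real u) powr (- (1 + \<kappa>)) = 2 powr (- (1 + \<kappa>)) * real u powr (- (1 + \<kappa>))"
      using up by (intro powr_mult)
    moreover have "real u powr (1 - \<beta> + \<kappa>) * real u powr (- (1 + \<kappa>)) = real u powr - \<beta>"
      unfolding powr_add[symmetric] by simp
    moreover have "2 powr (1 + \<kappa>) * 2 powr (- (1 + \<kappa>)) = (1::real)"
      unfolding powr_add[symmetric] by simp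
    ultimately show ?thesis using assms(2,3) by (simp add: field_simps)
  qed
  also have "\<dots> \<le> real (s u) * ((2 powr (1 + \<kappa>) / (c * \<delta>)) * (2 * real u) powr (- (1 + \<kappa>)))"
  proof (intro mult_right_mono)
    have "c * \<delta> * real u powr (1 - \<beta> + \<kappa>) = \<delta> * (c * real u powr (1 - \<beta> + \<kappa>))" by simp
    also have "\<dots> \<le> \<delta> * \<phi> u" using \<phi>[OF u] assms by (intro mult_left_mono) auto
    also have "\<dots> \<le> s u" by (rule s(1)[OF u])
    finally show "c * \<delta> * real u powr (1 - \<beta> + \<kappa>) \<le> s u" .
  qed (use assms in auto)
  also have "\<dots> = (\<Sum>m\<in>{u..<u + s u}. (2 powr (1 + \<kappa>) / (c * \<delta>)) * (2 * real u) powr (- (1 + \<kappa>)))"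
    by simp
  also have "\<dots> \<le> (\<Sum>m\<in>{u..<u + s u}. ?H m)"
    using s(2)[OF u] up assms by (intro sum_mono mult_left_mono powr_mono2') auto
  finally show "real u powr - \<beta> \<le> (\<Sum>m\<in>{u..<u + s u}. ?H m)" .
qed (use assms in auto)

section \<open>The moment condition\<close>

text \<open>
  The moment condition says that \<open>jump_weight \<bar>X\<bar> powr (1 / \<alpha>)\<close> is integrable, see \<open>moment_weight_eq\<close>. Apart from constants, the
  function inverts \<open>t \<mapsto> sqrt (t * ln t)\<close>.
\<close>

definition jump_weight :: "real \<Rightarrow> real" where
  "jump_weight x = x\<^sup>2 / log_plus x"

lemma log_plus_ge_1: "1 \<le> log_plus x" by (simp add: log_plus_def)

lemma jump_weight_nonneg: "0 \<le> jump_weight x"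
  using log_plus_ge_1[of x] by (simp add: jump_weight_def)

lemma jump_weight_mono:
  assumes "0 \<le> x" "x \<le> y"
  shows "jump_weight x \<le> jump_weight y"
proof (cases "x = 0")
  case True
  then show ?thesis using jump_weight_nonneg[of y] by (simp add: jump_weight_def)
next
  case False
  \<comment> \<open>The claim amounts to \<open>log_plus (t * x) \<le> t^2 * log_plus x\<close> for \<open>t \<ge> 1\<close>.\<close>
  define t where "t = y / x"
  have t: "1 \<le> t" "y = t * x" using assms False by (auto simp: t_def field_simps)
  have x: "0 < x" using assms False by simp
  have "log_plus y \<le> ln t + log_plus x"
  proof -
    have "0 \<le> ln t" "ln y = ln t + ln x" using t x by (auto simp: ln_mult)
    then show ?thesis by (auto simp: log_plus_def)
  qed
  also have "ln t \<le> t - 1" using t by (intro ln_le_minus_one) auto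
  also have "t - 1 \<le> (t\<^sup>2 - 1) * 1" using t mult_left_mono[of 1 t t] by (simp add: power2_eq_square)
  also have "\<dots> \<le> (t\<^sup>2 - 1) * log_plus x"
    using t log_plus_ge_1 by (intro mult_left_mono) auto
  finally have "log_plus y \<le> t\<^sup>2 * log_plus x" by (simp add: algebra_simps)
  then have "x\<^sup>2 * log_plus y \<le> x\<^sup>2 * (t\<^sup>2 * log_plus x)" by (intro mult_left_mono) auto
  then have "x\<^sup>2 * log_plus y \<le> y\<^sup>2 * log_plus x" by (simp add: t(2) power_mult_distrib algebra_simps)
  then show ?thesis using log_plus_ge_1[of x] log_plus_ge_1[of y]
    by (simp add: jump_weight_def field_simps)
qed

lemma moment_weight_eq:
  "\<bar>x\<bar> powr (2 / \<alpha>) * log_plus \<bar>x\<bar> powr (- (1 / \<alpha>)) = jump_weight \<bar>x\<bar> powr (1 / \<alpha>)" for x \<alpha> :: real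
proof -
  have "\<bar>x\<bar> powr (2 / \<alpha>) = (\<bar>x\<bar>\<^sup>2) powr (1 / \<alpha>)"
  proof (cases "x = 0")
    case False
    then have "\<bar>x\<bar>\<^sup>2 = \<bar>x\<bar> powr 2" by (simp only: powr_numeral[symmetric] abs_ge_zero)
    then show ?thesis by (simp only: powr_powr) simp
  qed simp
  moreover have "log_plus \<bar>x\<bar> powr (- (1 / \<alpha>)) = inverse (log_plus \<bar>x\<bar>) powr (1 / \<alpha>)"
    using log_plus_ge_1[of "\<bar>x\<bar>"] by (simp add: powr_minus inverse_powr)
  ultimately show ?thesis using log_plus_ge_1[of "\<bar>x\<bar>"]
    by (simp add: jump_weight_def powr_mult[symmetric] divide_inverse)
qed

section \<open>Exponential bounds for window sums\<close>

text \<open>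
  A double-indexed first Borel--Cantelli lemma. Summability over both indices gives more than is usual for a limit in which
  both indices grow: beyond some \<open>j\<close>, the events fail for every \<open>i\<close>.
\<close>

lemma (in prob_space) borel_cantelli_rows:
  fixes A :: "nat \<Rightarrow> nat \<Rightarrow> 'a set"
  assumes A: "\<And>i j. A i j \<in> events"
    and sm: "\<And>j. summable (\<lambda>i. prob (A i j))" and le: "\<And>j. (\<Sum>i. prob (A i j)) \<le> h j" and h: "summable h"
  shows "AE \<omega> in M. \<exists>J. \<forall>j\<ge>J. \<forall>i. \<omega> \<notin> A i j"
proof -
  let ?B = "\<lambda>j. \<Union>i. A i j"
  have B: "?B j \<in> events" for j using A by auto
  have "prob (?B j) \<le> h j" for j
    by (rule order_trans[OF finite_measure_subadditive_countably le]) (use A sm in auto)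
  then have "summable (\<lambda>j. prob (?B j))"
    by (intro summable_comparison_test'[OF h, of 0]) auto
  then have "AE \<omega> in M. \<forall>\<^sub>F j in sequentially. \<omega> \<in> space M - ?B j"
    by (intro borel_cantelli_AE1) (auto simp: B less_top[symmetric])
  then show ?thesis by eventually_elim (auto simp: eventually_sequentially)
qed

lemma (in prob_space) sum_tails_le_expectation:
  fixes f :: "'a \<Rightarrow> real"
  assumes f: "integrable M f" "\<And>\<omega>. 0 \<le> f \<omega>" and "0 < c"
  shows "summable (\<lambda>i. prob {\<omega>\<in>space M. c * real (Suc i) \<le> f \<omega>})"
    and "(\<Sum>i. prob {\<omega>\<in>space M. c * real (Suc i) \<le> f \<omega>}) \<le> expectation f / c"
proof -
  have [measurable]: "f \<in> borel_measurable M" using f by auto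
  let ?p = "\<lambda>i. prob {\<omega>\<in>space M. c * real (Suc i) \<le> f \<omega>}"
  have bound: "(\<Sum>i<N. ?p i) \<le> expectation f / c" for N
  proof -
    have ii: "integrable M (indicat_real {\<omega>\<in>space M. c * real (Suc i) \<le> f \<omega>})" for i
      by (auto simp: less_top[symmetric])
    have "(\<Sum>i<N. ?p i) = expectation (\<lambda>\<omega>. \<Sum>i<N. indicat_real {\<omega>\<in>space M. c * real (Suc i) \<le> f \<omega>} \<omega>)"
      using ii by (subst Bochner_Integration.integral_sum) auto
    also have "\<dots> \<le> expectation (\<lambda>\<omega>. f \<omega> / c)"
    proof (rule integral_mono)
      fix \<omega> assume w: "\<omega> \<in> space M"
      have "(\<Sum>i<N. indicat_real {\<omega>\<in>space M. c * real (Suc i) \<le> f \<omega>} \<omega>)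
          = (\<Sum>i<N. if real (Suc i) \<le> f \<omega> / c then 1 else 0)"
        using w \<open>0 < c\<close> by (intro sum.cong) (auto simp: indicator_def field_simps)
      also have "\<dots> = real (card {i\<in>{..<N}. real (Suc i) \<le> f \<omega> / c})"
        by (simp add: sum.If_cases Int_def)
      also have "\<dots> \<le> real (card {..<nat \<lfloor>f \<omega> / c\<rfloor>})"
      proof -
        have "{i\<in>{..<N}. real (Suc i) \<le> f \<omega> / c} \<subseteq> {..<nat \<lfloor>f \<omega> / c\<rfloor>}"
          by auto linarith
        then show ?thesis by (intro of_nat_mono card_mono) auto
      qed
      also have "\<dots> \<le> f \<omega> / c" using f(2)[of \<omega>] \<open>0 < c\<close> by simp
      finally show "(\<Sum>i<N. indicat_real {\<omega>\<in>space M. c * real (Suc i) \<le> f \<omega>} \<omega>) \<le> f \<omega> / c" .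
    qed (use f ii in auto)
    finally show ?thesis by simp
  qed
  show s: "summable ?p" by (rule summableI_nonneg_bounded[OF _ bound]) auto
  show "(\<Sum>i. ?p i) \<le> expectation f / c"
    using s bound by (intro suminf_le_const)
qed

lemma (in prob_space) moment_tail_bound:
  fixes Z :: "'a \<Rightarrow> real"
  assumes [measurable]: "Z \<in> borel_measurable M"
    and int: "integrable M (\<lambda>\<omega>. \<bar>Z \<omega>\<bar> powr p)" and "0 < b" "0 < p"
  shows "prob {\<omega>\<in>space M. b < Z \<omega>} \<le> expectation (\<lambda>\<omega>. \<bar>Z \<omega>\<bar> powr p) / b powr p"
proof -
  have "prob {\<omega>\<in>space M. b < Z \<omega>} \<le> prob {\<omega>\<in>space M. b powr p \<le> \<bar>Z \<omega>\<bar> powr p}"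
    using assms(3,4) by (intro finite_measure_mono) (auto intro!: powr_mono2)
  also have "\<dots> \<le> expectation (\<lambda>\<omega>. \<bar>Z \<omega>\<bar> powr p) / b powr p"
    by (rule integral_Markov_inequality_measure[OF int, of "{}", simplified]) (use assms in auto)
  finally show ?thesis .
qed

context iid_family
begin

text \<open>
  Chernoff bound for truncated sums, normalised so that \<open>L\<close> only appears as a factor of the exponent. The parameter of the
  exponential is \<open>\<theta> * sqrt (L / a)\<close>, whose product with the truncation level is the constant \<open>\<theta> * \<eta>\<close>.
\<close>

lemma cut_sum_tail:
  assumes A: "finite A" "A \<subseteq> I" and Z2: "integrable M (\<lambda>\<omega>. (Z \<omega>)\<^sup>2)" and Z0: "expectation Z = 0"
    and s: "expectation (\<lambda>\<omega>. (Z \<omega>)\<^sup>2) \<le> s\<^sup>2" and pos: "0 < a" "0 < L" "0 \<le> c" "0 \<le> \<theta>" "0 \<le> \<eta>"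
    and card: "real (card A) \<le> c * a"
  shows "prob {\<omega>\<in>space M. x * sqrt (a * L) \<le> (\<Sum>k\<in>A. cut_above (\<eta> * sqrt (a / L)) (X k \<omega>))}
    \<le> exp (- (L * (\<theta> * x - c * \<theta>\<^sup>2 * s\<^sup>2 * exp (\<theta> * \<eta>) / 2)))"
proof -
  define l where "l = \<theta> * sqrt (L / a)"
  define b where "b = \<eta> * sqrt (a / L)"
  have "sqrt (L / a) * sqrt (a / L) = 1" using pos by (simp add: real_sqrt_mult[symmetric])
  then have lb: "l * b = \<theta> * \<eta>" by (simp add: l_def b_def algebra_simps)
  have lx: "l * (x * sqrt (a * L)) = L * (\<theta> * x)"
  proof -
    have "sqrt (L / a) * sqrt (a * L) = sqrt (L * L)" using pos by (simp add: real_sqrt_mult[symmetric])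
    also have "\<dots> = L" using pos by simp
    finally show ?thesis by (simp add: l_def algebra_simps)
  qed
  have l2: "l\<^sup>2 = \<theta>\<^sup>2 * (L / a)" using pos by (simp add: l_def power_mult_distrib)
  have "prob {\<omega>\<in>space M. x * sqrt (a * L) \<le> (\<Sum>k\<in>A. cut_above b (X k \<omega>))}
    \<le> exp (real (card A) * (l\<^sup>2 * s\<^sup>2 / 2 * exp (l * b)) - l * (x * sqrt (a * L)))"
    by (intro chernoff_bound A cut_above_measurable cut_above_mgf[OF Z_measurable Z2 Z0 s])
       (use pos in \<open>auto simp: l_def b_def\<close>)
  also have "real (card A) * (l\<^sup>2 * s\<^sup>2 / 2 * exp (l * b)) \<le> (c * a) * (l\<^sup>2 * s\<^sup>2 / 2 * exp (l * b))"
    by (intro mult_right_mono card) auto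
  also have "(c * a) * (l\<^sup>2 * s\<^sup>2 / 2 * exp (l * b)) = L * (c * \<theta>\<^sup>2 * s\<^sup>2 * exp (\<theta> * \<eta>) / 2)"
    unfolding l2 lb using pos by simp
  finally show ?thesis unfolding lx b_def by (simp add: algebra_simps)
qed

text \<open>
  Chernoff bound for the number of terms above \<open>b\<close>, whose expectation is at most \<open>w powr - \<kappa>\<close>.
\<close>

lemma exceedance_count_tail:
  assumes A: "finite A" "A \<subseteq> I" and w: "1 \<le> w" "0 \<le> \<kappa>"
    and le: "real (card A) * prob {\<omega>\<in>space M. b < Z \<omega>} \<le> w powr - \<kappa>"
  shows "prob {\<omega>\<in>space M. real N \<le> (\<Sum>k\<in>A. indicat_real {b<..} (X k \<omega>))} \<le> 3 * w powr (- (\<kappa> * real N))"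
proof -
  \<comment> \<open>This makes \<open>exp l\<close> times the expected number of exceedances at most \<open>1\<close>.\<close>
  define l where "l = \<kappa> * ln w"
  have el: "exp l = w powr \<kappa>" "exp (- l * real N) = w powr (- (\<kappa> * real N))"
    using w by (auto simp: l_def powr_def algebra_simps)
  have "prob {\<omega>\<in>space M. real N \<le> (\<Sum>k\<in>A. indicat_real {b<..} (X k \<omega>))}
      \<le> exp (real (card A) * (exp l * prob {\<omega>\<in>space M. b < Z \<omega>}) - l * real N)"
    by (intro chernoff_bound A exceedance_mgf Z_measurable) (use w in \<open>auto simp: l_def\<close>)
  also have "\<dots> \<le> exp (1 - l * real N)"
  proof -
    have "real (card A) * (exp l * prob {\<omega>\<in>space M. b < Z \<omega>}) \<le> w powr \<kappa> * w powr - \<kappa>"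
      unfolding el(1) using mult_left_mono[OF le, of "w powr \<kappa>"] by (simp add: algebra_simps)
    also have "\<dots> = 1" using w by (simp add: powr_add[symmetric])
    finally show ?thesis by simp
  qed
  also have "\<dots> = exp 1 * w powr (- (\<kappa> * real N))" unfolding el(2)[symmetric] by (simp add: exp_add[symmetric])
  also have "\<dots> \<le> 3 * w powr (- (\<kappa> * real N))" using exp_le by (intro mult_right_mono) auto
  finally show ?thesis .
qed

end

lemma area_lower_bound:
  assumes "0 < \<alpha>" "1 \<le> u" "3 \<le> v"
  shows "(real u * real v) powr (min \<alpha> (1/2)) / 2 \<le> row_length \<alpha> u * col_length v"
proof -
  let ?a = "min \<alpha> (1/2)"
  have "ln 3 \<le> ln (real v)" using assms by (subst ln_le_cancel_iff) auto
  then have l: "1 \<le> ln (real v)" using ln_3_ge_1 by simp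
  have "ln (real v) \<le> real v powr (1/2) / (1/2)" using assms by (intro ln_powr_bound) auto
  then have "real v / (2 * real v powr (1/2)) \<le> col_length v"
    unfolding col_length_def using l assms by (intro divide_left_mono) auto
  also have "real v / (2 * real v powr (1/2)) = real v powr (1/2) / 2"
    using assms by (simp add: powr_half_sqrt real_div_sqrt field_simps)
  finally have c: "real v powr (1/2) / 2 \<le> col_length v" .
  have "(real u * real v) powr ?a / 2 = real u powr ?a * (real v powr ?a / 2)"
    by (simp add: powr_mult)
  also have "\<dots> \<le> real u powr \<alpha> * (real v powr (1/2) / 2)"
    using assms by (intro mult_mono divide_right_mono powr_mono) auto
  also have "\<dots> \<le> row_length \<alpha> u * col_length v"
    unfolding row_length_def using c by (intro mult_left_mono) auto
  finally show ?thesis .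
qed

text \<open>
  The expected number of terms above the truncation level in a window is a negative power of \<open>u * v\<close>: by the Markov inequality with
  a moment of order \<open>p > 2\<close> it is of order \<open>a powr (1 - p / 2)\<close> up to logarithms.
\<close>

lemma exceedance_mean_small:
  fixes \<alpha> p \<eta> K :: real
  assumes "0 < \<alpha>" "2 < p" "0 < \<eta>" "0 \<le> K"
  shows "\<exists>\<kappa>>0. \<exists>k\<ge>3. \<forall>u\<ge>k. \<forall>v\<ge>k.
    9 * (row_length \<alpha> u * col_length v) *
      (K / (\<eta> * sqrt (row_length \<alpha> u * col_length v / ln (real u * real v))) powr p)
    \<le> (real u * real v) powr - \<kappa>"
proof -
  define a0 where "a0 = min \<alpha> (1/2)"
  define \<kappa> where "\<kappa> = a0 * (p/2 - 1) / 2"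
  have a0: "a0 > 0" using assms by (auto simp: a0_def)
  have \<kappa>: "\<kappa> > 0" using assms a0 by (simp add: \<kappa>_def)
  define C where "C = 9 * K / \<eta> powr p * 2 powr (p/2 - 1)"
  have C: "C \<ge> 0" using assms by (simp add: C_def)
  have "((\<lambda>w::real. C * ln w powr (p/2) * w powr - \<kappa>) \<longlongrightarrow> 0) at_top"
    using assms \<kappa> by real_asymp
  then have "\<forall>\<^sub>F w in at_top. C * ln w powr (p/2) * w powr - \<kappa> < 1"
    by (rule order_tendstoD) simp
  then obtain w0 where w0: "\<And>w. w \<ge> w0 \<Longrightarrow> C * ln w powr (p/2) * w powr - \<kappa> < 1"
    unfolding eventually_at_top_linorder by auto
  define k where "k = max 3 (nat \<lceil>w0\<rceil>)"
  show ?thesis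
  proof (intro exI[of _ \<kappa>] conjI exI[of _ k] allI impI)
    fix u v assume uv: "k \<le> u" "k \<le> v"
    then have uv3: "3 \<le> u" "3 \<le> v" by (auto simp: k_def)
    define w where "w = real u * real v"
    define a where "a = row_length \<alpha> u * col_length v"
    define L where "L = ln w"
    have "w0 \<le> real u" using uv by (auto simp: k_def)
    also have "real u * 1 \<le> w" unfolding w_def using uv3 by (intro mult_left_mono) auto
    finally have ww: "w0 \<le> w" by simp
    have w3: "3 \<le> w" using uv3 mult_mono[of 3 "real u" 1 "real v"] by (simp add: w_def)
    then have "ln 3 \<le> L" unfolding L_def by (subst ln_le_cancel_iff) auto
    then have L: "1 \<le> L" using ln_3_ge_1 by simp
    have aw: "w powr a0 / 2 \<le> a" unfolding a_def w_def a0_def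
      using uv3 assms by (intro area_lower_bound) auto
    have ap: "a > 0" using aw w3 by (smt (verit) divide_pos_pos powr_gt_zero)
    have e1: "(\<eta> * sqrt (a / L)) powr p = \<eta> powr p * (a powr (p/2) / L powr (p/2))"
    proof -
      have "sqrt (a / L) powr p = (a / L) powr (p/2)"
        using ap L by (simp add: powr_half_sqrt[symmetric] powr_powr)
      then show ?thesis using assms ap L by (simp add: powr_mult powr_divide)
    qed
    have "9 * a * (K / (\<eta> * sqrt (a / L)) powr p) = 9 * K / \<eta> powr p * L powr (p/2) * (a / a powr (p/2))"
      unfolding e1 using assms by simp
    also have "a / a powr (p/2) = a powr (- (p/2 - 1))"
    proof -
      have "a / a powr (p/2) = a powr 1 / a powr (p/2)" using ap by simp
      also have "\<dots> = a powr (1 - p/2)" by (rule powr_diff[symmetric])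
      finally show ?thesis by simp
    qed
    also have "9 * K / \<eta> powr p * L powr (p/2) * a powr (- (p/2 - 1))
      \<le> 9 * K / \<eta> powr p * L powr (p/2) * (w powr a0 / 2) powr (- (p/2 - 1))"
      using aw w3 assms by (intro mult_left_mono powr_mono2') auto
    also have "(w powr a0 / 2) powr (- (p/2 - 1)) = w powr - \<kappa> * w powr - \<kappa> * 2 powr (p/2 - 1)"
    proof -
      have "(w powr a0 / 2) powr (- (p/2 - 1)) = (w powr a0) powr (- (p/2 - 1)) / 2 powr (- (p/2 - 1))"
        by (rule powr_divide)
      also have "\<dots> = w powr (- \<kappa> + - \<kappa>) * 2 powr (p/2 - 1)"
        by (simp add: powr_powr \<kappa>_def powr_minus_divide algebra_simps powr_diff)
      finally show ?thesis by (simp only: powr_add)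
    qed
    also have "9 * K / \<eta> powr p * L powr (p/2) * (w powr - \<kappa> * w powr - \<kappa> * 2 powr (p/2 - 1))
       = (C * L powr (p/2) * w powr - \<kappa>) * w powr - \<kappa>"
      by (simp add: C_def)
    also have "\<dots> \<le> 1 * w powr - \<kappa>"
      using w0[OF ww] unfolding L_def by (intro mult_right_mono) auto
    finally show "9 * (row_length \<alpha> u * col_length v) *
      (K / (\<eta> * sqrt (row_length \<alpha> u * col_length v / ln (real u * real v))) powr p)
    \<le> (real u * real v) powr - \<kappa>"
      unfolding a_def L_def w_def by simp
  qed (auto simp: \<kappa> k_def)
qed

text \<open>
  The double array of the theorem.
\<close>

locale iid_array = iid_family M X "{1..} \<times> {1..}" Z
  for M :: "'a measure" and X :: "nat \<times> nat \<Rightarrow> 'a \<Rightarrow> real" and Z +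
  fixes \<alpha> :: real
  assumes \<alpha>: "0 < \<alpha>" "\<alpha> < 1"
begin

text \<open>
  The approximate number of summands of a window.
\<close>

definition area :: "nat \<Rightarrow> nat \<Rightarrow> real" where
  "area m n = row_length \<alpha> m * col_length n"

text \<open>
  The norming sequence, without the factor \<open>sqrt (2 * (1 - \<alpha>))\<close>.
\<close>

definition norming :: "nat \<Rightarrow> nat \<Rightarrow> real" where
  "norming m n = sqrt (area m n * ln (real m * real n))"

definition win :: "nat \<Rightarrow> nat \<Rightarrow> (nat \<times> nat) set" where
  "win m n = window (row_length \<alpha>) m \<times> window col_length n"

definition row_step :: "real \<Rightarrow> nat \<Rightarrow> nat" where "row_step \<delta> = step \<delta> (row_length \<alpha>)"
definition col_step :: "real \<Rightarrow> nat \<Rightarrow> nat" where "col_step \<delta> = step \<delta> col_length"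

text \<open>
  The common part of the windows that start in the cell of \<open>(u, v)\<close>.
\<close>

definition core :: "real \<Rightarrow> nat \<Rightarrow> nat \<Rightarrow> (nat \<times> nat) set" where
  "core \<delta> u v = window_core (row_length \<alpha>) u (u + row_step \<delta> u) \<times> window_core col_length v (v + col_step \<delta> v)"

text \<open>
  The truncation level, which depends on the cell only.
\<close>

definition level :: "real \<Rightarrow> nat \<Rightarrow> nat \<Rightarrow> real" where
  "level \<eta> u v = \<eta> * sqrt (area u v / ln (real u * real v))"

definition cut_event :: "real \<Rightarrow> real \<Rightarrow> nat \<Rightarrow> nat \<Rightarrow> (nat \<times> nat) set \<Rightarrow> 'a set" where
  "cut_event \<eta> x u v A = {\<omega>\<in>space M. x * norming u v \<le> (\<Sum>k\<in>A. cut_above (level \<eta> u v) (X k \<omega>))}"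

definition count_event :: "real \<Rightarrow> nat \<Rightarrow> nat \<Rightarrow> nat \<Rightarrow> (nat \<times> nat) set \<Rightarrow> 'a set" where
  "count_event \<eta> N u v A = {\<omega>\<in>space M. real N \<le> (\<Sum>k\<in>A. indicat_real {level \<eta> u v<..} (X k \<omega>))}"

text \<open>
  The exceptional event of a cell. Outside it, the truncated sum over the core is below \<open>x * norming u v\<close>, and for each window of the cell
  the truncated sum over the rest is below \<open>\<epsilon> * norming u v\<close> and fewer than \<open>N\<close> terms exceed the level.
\<close>

definition bad_cell :: "real \<Rightarrow> real \<Rightarrow> real \<Rightarrow> real \<Rightarrow> nat \<Rightarrow> nat \<Rightarrow> nat \<Rightarrow> 'a set" where
  "bad_cell x \<epsilon> \<delta> \<eta> N u v = cut_event \<eta> x u v (core \<delta> u v) \<union>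
    (\<Union>(m, n)\<in>{u..<u + row_step \<delta> u} \<times> {v..<v + col_step \<delta> v}.
       cut_event \<eta> \<epsilon> u v (win m n - core \<delta> u v) \<union> count_event \<eta> N u v (win m n))"

lemma area_pos: "1 \<le> m \<Longrightarrow> 3 \<le> n \<Longrightarrow> 0 < area m n"
  and ln_pos: "1 \<le> m \<Longrightarrow> 3 \<le> n \<Longrightarrow> 1 \<le> ln (real m * real n)"
proof -
  assume mn: "1 \<le> m" "3 \<le> n"
  have "ln 3 \<le> ln (real n)" using mn by (subst ln_le_cancel_iff) auto
  then have l: "1 \<le> ln (real n)" using ln_3_ge_1 by simp
  then show "0 < area m n" using mn by (simp add: area_def row_length_def col_length_def)
  have "0 \<le> ln (real m)" using mn by simp
  moreover have "ln (real m * real n) = ln (real m) + ln (real n)" using mn by (simp add: ln_mult)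
  ultimately show "1 \<le> ln (real m * real n)" using l by linarith
qed

lemma norming_pos: "1 \<le> m \<Longrightarrow> 3 \<le> n \<Longrightarrow> 0 < norming m n"
  unfolding norming_def
  by (intro real_sqrt_gt_zero mult_pos_pos area_pos less_le_trans[OF zero_less_one ln_pos])

lemma area_mono: "1 \<le> u \<Longrightarrow> u \<le> m \<Longrightarrow> 3 \<le> v \<Longrightarrow> v \<le> n \<Longrightarrow> area u v \<le> area m n"
  unfolding area_def using \<alpha> col_length_mono[of v n]
  by (intro mult_mono) (auto simp: row_length_def col_length_def intro!: powr_mono2)

lemma norming_mono: "1 \<le> u \<Longrightarrow> u \<le> m \<Longrightarrow> 3 \<le> v \<Longrightarrow> v \<le> n \<Longrightarrow> norming u v \<le> norming m n"
proof -
  assume uv: "1 \<le> u" "u \<le> m" "3 \<le> v" "v \<le> n"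
  have "ln (real u * real v) \<le> ln (real m * real n)"
    using uv by (subst ln_le_cancel_iff) (auto intro!: mult_mono)
  then show ?thesis unfolding norming_def
    using uv
    by (intro real_sqrt_le_mono mult_mono area_mono less_imp_le[OF area_pos]
      order_trans[OF zero_le_one ln_pos]) auto
qed

text \<open>
  The factor is not optimal; it is needed because a window that starts in a cell reaches up to four times the lower corner of the cell.
\<close>

lemma norming_dilate:
  assumes "1 \<le> u" "3 \<le> v"
  shows "norming (4 * u) (4 * v) \<le> 9 * norming u v"
proof -
  have "real (4 * u) powr \<alpha> \<le> 4 * real u powr \<alpha>"
  proof -
    have "4 powr \<alpha> \<le> (4::real) powr 1" using \<alpha> by (intro powr_mono) auto
    then show ?thesis by (simp add: powr_mult mult_right_mono)
  qed
  moreover have "col_length (4 * v) \<le> 4 * col_length v"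
  proof -
    have "ln 3 \<le> ln (real v)" using assms by (subst ln_le_cancel_iff) auto
    then have l: "1 \<le> ln (real v)" using ln_3_ge_1 by simp
    moreover have "ln (real v) \<le> ln (real (4 * v))" using assms by (subst ln_le_cancel_iff) auto
    ultimately have "real (4 * v) / ln (real (4 * v)) \<le> real (4 * v) / ln (real v)"
      by (intro divide_left_mono) auto
    then show ?thesis by (simp add: col_length_def)
  qed
  ultimately have "area (4 * u) (4 * v) \<le> (4 * row_length \<alpha> u) * (4 * col_length v)"
    unfolding area_def row_length_def using assms
    by (intro mult_mono) (auto simp: col_length_def)
  then have ar: "area (4 * u) (4 * v) \<le> 16 * area u v" by (simp add: area_def)
  have l1: "1 \<le> ln (real u * real v)" by (rule ln_pos[OF assms])
  have "real (4 * u) * real (4 * v) = 16 * (real u * real v)" by simp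
  then have "ln (real (4 * u) * real (4 * v)) = ln 16 + ln (real u * real v)"
    using assms by (simp only: ln_mult) (simp add: ln_mult)
  also have "ln (16::real) \<le> 4"
  proof -
    have "ln (16::real) = ln (2 ^ 4)" by simp
    also have "\<dots> = 4 * ln 2" by (subst ln_realpow) auto
    also have "\<dots> \<le> 4 * (2 - 1)" using ln_le_minus_one[of "2::real"] by (intro mult_left_mono) auto
    finally show ?thesis by simp
  qed
  finally have ln4: "ln (real (4 * u) * real (4 * v)) \<le> 5 * ln (real u * real v)" using l1 by simp
  have "area (4 * u) (4 * v) * ln (real (4 * u) * real (4 * v)) \<le> (16 * area u v) * (5 * ln (real u * real v))"
    using area_pos[OF assms] assms
    by (intro mult_mono ar ln4 order_trans[OF zero_le_one ln_pos]) auto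
  also have "\<dots> \<le> 81 * (area u v * ln (real u * real v))"
    using area_pos[OF assms] l1 by simp
  finally have "norming (4 * u) (4 * v) \<le> sqrt (9\<^sup>2 * (area u v * ln (real u * real v)))"
    unfolding norming_def by (intro real_sqrt_le_mono) simp
  then show ?thesis unfolding norming_def real_sqrt_mult[of "9\<^sup>2"] by simp
qed

lemma win_subset: "win m n \<subseteq> {1..} \<times> {1..}"
  by (auto simp: win_def window_def)

lemma sum_events:
  assumes "A \<subseteq> {1..} \<times> {1..}"
  shows "cut_event \<eta> x u v A \<in> events" "count_event \<eta> N u v A \<in> events"
proof -
  have [measurable]: "k \<in> A \<Longrightarrow> X k \<in> borel_measurable M" for k using assms X_measurable by auto
  have [measurable]: "(\<lambda>\<omega>. \<Sum>k\<in>A. cut_above (level \<eta> u v) (X k \<omega>)) \<in> borel_measurable M"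
    "(\<lambda>\<omega>. \<Sum>k\<in>A. indicat_real {level \<eta> u v<..} (X k \<omega>)) \<in> borel_measurable M"
    by (intro borel_measurable_sum; measurable)+
  show "cut_event \<eta> x u v A \<in> events" "count_event \<eta> N u v A \<in> events"
    unfolding cut_event_def count_event_def by measurable
qed

lemma cut_event_tail:
  assumes A: "finite A" "A \<subseteq> {1..} \<times> {1..}" "real (card A) \<le> c * area u v" and uv: "1 \<le> u" "3 \<le> v"
    and Z2: "integrable M (\<lambda>\<omega>. (Z \<omega>)\<^sup>2)" and Z0: "expectation Z = 0"
    and s: "expectation (\<lambda>\<omega>. (Z \<omega>)\<^sup>2) \<le> s\<^sup>2" and pos: "0 \<le> c" "0 \<le> \<theta>" "0 \<le> \<eta>"
    and exponent: "\<beta> \<le> \<theta> * x - c * \<theta>\<^sup>2 * s\<^sup>2 * exp (\<theta> * \<eta>) / 2"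
  shows "prob (cut_event \<eta> x u v A) \<le> (real u * real v) powr - \<beta>"
proof -
  have w: "0 < real u * real v" using uv by simp
  have l: "1 \<le> ln (real u * real v)" by (rule ln_pos[OF uv])
  have "prob (cut_event \<eta> x u v A) \<le> exp (- (ln (real u * real v) * (\<theta> * x - c * \<theta>\<^sup>2 * s\<^sup>2 * exp (\<theta> * \<eta>) / 2)))"
    unfolding cut_event_def norming_def level_def
    using l area_pos[OF uv] by (intro cut_sum_tail A Z2 Z0 s pos) auto
  also have "\<dots> \<le> exp (- (ln (real u * real v) * \<beta>))"
    using exponent l by (simp add: mult_left_mono)
  also have "\<dots> = (real u * real v) powr - \<beta>" using w uv by (simp add: powr_def mult.commute)
  finally show ?thesis .
qed

lemma psum_le_off_bad_cell:
  assumes \<omega>: "\<omega> \<in> space M" "\<omega> \<notin> bad_cell x \<epsilon> \<delta> \<eta> N u v"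
    and mn: "m \<in> {u..<u + row_step \<delta> u}" "n \<in> {v..<v + col_step \<delta> v}"
    and fin: "finite (win m n)" and core: "core \<delta> u v \<subseteq> win m n"
    and y: "0 \<le> y" "\<And>k. k \<in> win m n \<Longrightarrow> X k \<omega> \<le> y"
  shows "psum (win m n) \<omega> \<le> (x + \<epsilon>) * norming u v + real N * y"
proof -
  let ?b = "level \<eta> u v"
  let ?cut = "\<lambda>k. cut_above ?b (X k \<omega>)"
  let ?ind = "\<lambda>k. indicat_real {?b<..} (X k \<omega>)"
  have n1: "(\<Sum>k\<in>core \<delta> u v. ?cut k) < x * norming u v"
    and n2: "(\<Sum>k\<in>win m n - core \<delta> u v. ?cut k) < \<epsilon> * norming u v"
    and n3: "(\<Sum>k\<in>win m n. ?ind k) < real N"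
    using \<omega> mn by (auto simp: bad_cell_def cut_event_def count_event_def not_le)
  have "psum (win m n) \<omega> \<le> (\<Sum>k\<in>win m n. ?cut k + y * ?ind k)"
    unfolding psum_def using y by (intro sum_mono) (auto simp: cut_above_def indicator_def)
  also have "\<dots> = (\<Sum>k\<in>win m n. ?cut k) + y * (\<Sum>k\<in>win m n. ?ind k)"
    by (simp add: sum.distrib sum_distrib_left)
  also have "(\<Sum>k\<in>win m n. ?cut k) = (\<Sum>k\<in>core \<delta> u v. ?cut k) + (\<Sum>k\<in>win m n - core \<delta> u v. ?cut k)"
    using fin core by (simp add: sum.subset_diff)
  also have "y * (\<Sum>k\<in>win m n. ?ind k) \<le> y * real N" using n3 y by (intro mult_left_mono) auto
  finally show ?thesis using n1 n2 by (simp add: algebra_simps)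
qed

end

section \<open>The upper bound\<close>

lemma regular_cellD:
  assumes "regular_cell \<phi> \<delta> u"
  shows "1 \<le> step \<delta> \<phi> u" "step \<delta> \<phi> u \<le> u" "\<delta> * \<phi> u \<le> real (step \<delta> \<phi> u)" "1 \<le> \<phi> u"
    and "\<And>m. m \<in> {u..<u + step \<delta> \<phi> u} \<Longrightarrow> finite (window \<phi> m)"
    and "\<And>m. m \<in> {u..<u + step \<delta> \<phi> u} \<Longrightarrow> window_core \<phi> u (u + step \<delta> \<phi> u) \<subseteq> window \<phi> m"
    and "\<And>m. m \<in> {u..<u + step \<delta> \<phi> u} \<Longrightarrow>
      real (card (window \<phi> m - window_core \<phi> u (u + step \<delta> \<phi> u))) \<le> 4 * \<delta> * \<phi> u"
    and "real (card (window_core \<phi> u (u + step \<delta> \<phi> u))) \<le> (1 + \<delta>) * \<phi> u"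
    and "\<And>m. m \<in> {u..<u + step \<delta> \<phi> u} \<Longrightarrow> real (card (window \<phi> m)) \<le> 3 * \<phi> u"
    and "\<And>m. m \<in> {u..<u + step \<delta> \<phi> u} \<Longrightarrow> window \<phi> m \<subseteq> {u..4 * u}"
  using assms unfolding regular_cell_def by auto

context iid_array
begin

lemma cell_cards:
  assumes u: "regular_cell (row_length \<alpha>) \<delta> u" and v: "regular_cell col_length \<delta> v" and "0 < \<delta>"
    and mn: "m \<in> {u..<u + row_step \<delta> u}" "n \<in> {v..<v + col_step \<delta> v}"
  shows "finite (win m n)" "core \<delta> u v \<subseteq> win m n" "real (card (core \<delta> u v)) \<le> (1 + \<delta>)\<^sup>2 * area u v"
    "real (card (win m n - core \<delta> u v)) \<le> 24 * \<delta> * area u v" "real (card (win m n)) \<le> 9 * area u v"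
    "win m n \<subseteq> {u..4 * u} \<times> {v..4 * v}"
proof -
  note U = regular_cellD[OF u, folded row_step_def] and V = regular_cellD[OF v, folded col_step_def]
  let ?C1 = "window_core (row_length \<alpha>) u (u + row_step \<delta> u)" and ?W1 = "window (row_length \<alpha>) m"
  let ?C2 = "window_core col_length v (v + col_step \<delta> v)" and ?W2 = "window col_length n"
  have fin: "finite ?W1" "finite ?W2" "?C1 \<subseteq> ?W1" "?C2 \<subseteq> ?W2"
    using U(5,6) V(5,6) mn by auto
  show "finite (win m n)" using fin by (simp add: win_def)
  show "core \<delta> u v \<subseteq> win m n" using fin by (auto simp: win_def core_def)
  have "real (card (core \<delta> u v)) = real (card ?C1) * real (card ?C2)"
    by (simp add: core_def card_cartesian_product)
  also have "\<dots> \<le> ((1 + \<delta>) * row_length \<alpha> u) * ((1 + \<delta>) * col_length v)"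
    using U(4,8) V(4,8) \<open>0 < \<delta>\<close> by (intro mult_mono) auto
  finally show "real (card (core \<delta> u v)) \<le> (1 + \<delta>)\<^sup>2 * area u v"
    by (simp add: area_def power2_eq_square algebra_simps)
  have "real (card (win m n)) = real (card ?W1) * real (card ?W2)"
    by (simp add: win_def card_cartesian_product)
  also have "\<dots> \<le> (3 * row_length \<alpha> u) * (3 * col_length v)"
    using U(4,9) V(4,9) mn by (intro mult_mono) auto
  finally show "real (card (win m n)) \<le> 9 * area u v" by (simp add: area_def)
  have "card (win m n - core \<delta> u v) \<le> card ((?W1 - ?C1) \<times> ?W2 \<union> ?W1 \<times> (?W2 - ?C2))"
    using fin by (intro card_mono) (auto simp: win_def core_def)
  also have "\<dots> \<le> card ((?W1 - ?C1) \<times> ?W2) + card (?W1 \<times> (?W2 - ?C2))" by (rule card_Un_le)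
  also have "\<dots> = card (?W1 - ?C1) * card ?W2 + card ?W1 * card (?W2 - ?C2)"
    by (simp add: card_cartesian_product)
  finally have "real (card (win m n - core \<delta> u v)) \<le> real (card (?W1 - ?C1) * card ?W2 + card ?W1 * card (?W2 - ?C2))"
    by (simp only: of_nat_le_iff)
  also have "\<dots> = real (card (?W1 - ?C1)) * real (card ?W2) + real (card ?W1) * real (card (?W2 - ?C2))" by simp
  also have "\<dots> \<le> (4 * \<delta> * row_length \<alpha> u) * (3 * col_length v) + (3 * row_length \<alpha> u) * (4 * \<delta> * col_length v)"
    using U(4,7,9) V(4,7,9) mn \<open>0 < \<delta>\<close> by (intro add_mono mult_mono) auto
  finally show "real (card (win m n - core \<delta> u v)) \<le> 24 * \<delta> * area u v" by (simp add: area_def mult_ac)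
  show "win m n \<subseteq> {u..4 * u} \<times> {v..4 * v}"
    unfolding win_def using U(10) V(10) mn by (intro Sigma_mono) auto
qed

text \<open>
  Since \<open>\<beta> > 1 - \<alpha>\<close>, the bound is summable over the cells.
\<close>

lemma bad_cell_bound:
  assumes Z2: "integrable M (\<lambda>\<omega>. (Z \<omega>)\<^sup>2)" and Z0: "expectation Z = 0"
    and s: "expectation (\<lambda>\<omega>. (Z \<omega>)\<^sup>2) \<le> s\<^sup>2" "0 < s" "s < \<tau>" and \<epsilon>: "0 < \<epsilon>"
    and p: "2 < p" "integrable M (\<lambda>\<omega>. \<bar>Z \<omega>\<bar> powr p)"
  shows "\<exists>\<delta> \<eta> N \<beta> k. 0 < \<delta> \<and> 1 - \<alpha> < \<beta> \<and> 3 \<le> k \<and> (\<forall>u\<ge>k. regular_cell (row_length \<alpha>) \<delta> u \<and> regular_cell col_length \<delta> u) \<and>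
    (\<forall>u\<ge>k. \<forall>v\<ge>k. bad_cell (sqrt (2 * (1 - \<alpha>)) * \<tau>) (sqrt (2 * (1 - \<alpha>)) * \<epsilon>) \<delta> \<eta> N u v \<in> events \<and>
      prob (bad_cell (sqrt (2 * (1 - \<alpha>)) * \<tau>) (sqrt (2 * (1 - \<alpha>)) * \<epsilon>) \<delta> \<eta> N u v)
        \<le> 5 * (real u * real v) powr - \<beta>)"
proof -
  define r where "r = sqrt (2 * (1 - \<alpha>))"
  have r: "r > 0" "r\<^sup>2 = 2 * (1 - \<alpha>)" using \<alpha> by (auto simp: r_def)
  define \<rho> where "\<rho> = \<tau>\<^sup>2 / s\<^sup>2"
  have "s\<^sup>2 < \<tau>\<^sup>2" using s by (intro power_strict_mono) auto
  then have \<rho>: "\<rho> > 1" using s by (simp add: \<rho>_def)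
  define \<gamma> where "\<gamma> = min 1 ((\<rho> - 1) / 2)"
  have \<gamma>: "\<gamma> > 0" "\<gamma> \<le> 1" "1 + \<gamma> < \<rho>" using \<rho> by (auto simp: \<gamma>_def min_def field_simps)
  define \<beta> where "\<beta> = (1 - \<alpha>) * (1 + \<gamma>)"
  have "(1 - \<alpha>) * 1 < \<beta>" unfolding \<beta>_def using \<alpha> \<gamma> by (intro mult_strict_left_mono) auto
  then have \<beta>1: "1 - \<alpha> < \<beta>" by simp
  have \<beta>2: "\<beta> \<le> 2" unfolding \<beta>_def using \<alpha> \<gamma> mult_mono[of "1 - \<alpha>" 1 "1 + \<gamma>" 2] by simp
  \<comment> \<open>The Gaussian choice of the parameter for the core. The factors \<open>c1\<close> from the size of the core and \<open>exp (\<theta>1 * \<eta>)\<close> from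
    the truncation have product \<open>q\<close>, chosen such that the exponent comes out as \<open>\<beta>\<close>.\<close>
  define \<theta>1 where "\<theta>1 = r * \<tau> / s\<^sup>2"
  have \<theta>1: "\<theta>1 > 0" using r s by (simp add: \<theta>1_def)
  define q where "q = 2 - (1 + \<gamma>) / \<rho>"
  have q: "q > 1" using \<gamma> \<rho> by (simp add: q_def)
  define c1 where "c1 = sqrt q"
  have c1: "c1 > 1" "c1 * c1 = q" using q by (auto simp: c1_def)
  define \<eta> where "\<eta> = ln c1 / \<theta>1"
  have \<eta>: "\<eta> > 0" "exp (\<theta>1 * \<eta>) = c1" using c1 \<theta>1 by (auto simp: \<eta>_def)
  \<comment> \<open>For the rest of a window the parameter is large; the quadratic term of the exponent is at most \<open>2\<close> when \<open>\<delta> \<le> 1 / D\<close>.\<close>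
  define \<theta>2 where "\<theta>2 = 6 / (r * \<epsilon>)"
  have \<theta>2: "\<theta>2 > 0" using r \<epsilon> by (simp add: \<theta>2_def)
  define D where "D = 6 * \<theta>2\<^sup>2 * s\<^sup>2 * exp (\<theta>2 * \<eta>)"
  have D: "D > 0" using \<theta>2 s by (simp add: D_def)
  define \<delta> where "\<delta> = min (min 1 (sqrt c1 - 1)) (1 / D)"
  have sc: "sqrt c1 > 1" using c1 by simp
  have \<delta>: "0 < \<delta>" "\<delta> \<le> 1" "1 + \<delta> \<le> sqrt c1" "\<delta> \<le> 1 / D" using D sc by (auto simp: \<delta>_def)
  have "(1 + \<delta>)\<^sup>2 \<le> (sqrt c1)\<^sup>2" using \<delta> by (intro power_mono) auto
  then have \<delta>c: "(1 + \<delta>)\<^sup>2 \<le> c1" using c1 by simp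
  have \<delta>D: "\<delta> * D \<le> 1" using \<delta>(4) D by (simp add: field_simps)
  define K where "K = expectation (\<lambda>\<omega>. \<bar>Z \<omega>\<bar> powr p)"
  have K: "K \<ge> 0" unfolding K_def by (intro integral_nonneg_AE) auto
  obtain \<kappa> k1 where \<kappa>: "\<kappa> > 0" "k1 \<ge> 3" and small: "\<And>u v. k1 \<le> u \<Longrightarrow> k1 \<le> v \<Longrightarrow>
      9 * (row_length \<alpha> u * col_length v) *
      (K / (\<eta> * sqrt (row_length \<alpha> u * col_length v / ln (real u * real v))) powr p)
    \<le> (real u * real v) powr - \<kappa>"
    using exceedance_mean_small[OF \<alpha>(1) p(1) \<eta>(1) K] by blast
  define N where "N = nat \<lceil>4 / \<kappa>\<rceil>"
  have "4 / \<kappa> \<le> real N" unfolding N_def by (rule real_nat_ceiling_ge)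
  then have N: "4 \<le> \<kappa> * real N" using \<kappa> by (simp add: field_simps)
  have "\<forall>\<^sub>F u in sequentially. regular_cell (row_length \<alpha>) \<delta> u \<and> regular_cell col_length \<delta> u"
    by (intro eventually_conj window_cell window_length_row window_length_col \<alpha> \<delta>)
  then obtain k2 where k2: "\<And>u. k2 \<le> u \<Longrightarrow> regular_cell (row_length \<alpha>) \<delta> u \<and> regular_cell col_length \<delta> u"
    unfolding eventually_sequentially by blast
  define k where "k = max k1 k2"
  show ?thesis
    unfolding r_def[symmetric]
  proof (rule exI[of _ \<delta>], rule exI[of _ \<eta>], rule exI[of _ N], rule exI[of _ \<beta>], rule exI[of _ k],
      intro conjI allI impI)
    fix u v assume uv: "k \<le> u" "k \<le> v"
    then have uv3: "3 \<le> u" "3 \<le> v" "1 \<le> u" using \<kappa> by (auto simp: k_def)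
    have ru: "regular_cell (row_length \<alpha>) \<delta> u" and rv: "regular_cell col_length \<delta> v"
      using k2 uv by (auto simp: k_def)
    define w where "w = real u * real v"
    have w: "w \<ge> 1" using uv3 mult_mono[of 1 "real u" 1 "real v"] by (simp add: w_def)
    let ?cells = "{u..<u + row_step \<delta> u} \<times> {v..<v + col_step \<delta> v}"
    let ?C = "core \<delta> u v"
    note cc = cell_cards[OF ru rv \<delta>(1)]
    have inc: "u \<in> {u..<u + row_step \<delta> u}" "v \<in> {v..<v + col_step \<delta> v}"
      using regular_cellD(1)[OF ru] regular_cellD(1)[OF rv] by (auto simp: row_step_def col_step_def)
    have C: "finite ?C" "?C \<subseteq> {1..} \<times> {1..}" "real (card ?C) \<le> c1 * area u v"
    proof -
      show "finite ?C" using cc(1,2)[OF inc] finite_subset by blast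
      show "?C \<subseteq> {1..} \<times> {1..}" using cc(2)[OF inc] win_subset by blast
      show "real (card ?C) \<le> c1 * area u v"
        using cc(3)[OF inc] mult_right_mono[OF \<delta>c less_imp_le[OF area_pos[OF uv3(3,2)]]] by simp
    qed
    have p1: "prob (cut_event \<eta> (r * \<tau>) u v ?C) \<le> w powr - \<beta>"
      unfolding w_def
    proof (rule cut_event_tail[OF C uv3(3,2) Z2 Z0 s(1)])
      have "c1 * \<theta>1\<^sup>2 * s\<^sup>2 * exp (\<theta>1 * \<eta>) / 2 = (c1 * c1) * (r\<^sup>2 / 2) * \<rho>"
        unfolding \<eta>(2) using s by (simp add: \<theta>1_def \<rho>_def power2_eq_square field_simps)
      also have "\<dots> = q * (1 - \<alpha>) * \<rho>" unfolding c1(2) r(2) by simp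
      finally have e: "c1 * \<theta>1\<^sup>2 * s\<^sup>2 * exp (\<theta>1 * \<eta>) / 2 = q * (1 - \<alpha>) * \<rho>" .
      have "\<theta>1 * (r * \<tau>) = r\<^sup>2 * \<rho>" by (simp add: \<theta>1_def \<rho>_def power2_eq_square)
      then have "\<theta>1 * (r * \<tau>) - c1 * \<theta>1\<^sup>2 * s\<^sup>2 * exp (\<theta>1 * \<eta>) / 2 = (1 - \<alpha>) * (\<rho> * (2 - q))"
        unfolding e r(2) by (simp add: algebra_simps)
      also have "\<rho> * (2 - q) = 1 + \<gamma>" using \<rho> by (simp add: q_def)
      finally show "\<beta> \<le> \<theta>1 * (r * \<tau>) - c1 * \<theta>1\<^sup>2 * s\<^sup>2 * exp (\<theta>1 * \<eta>) / 2"
        by (simp add: \<beta>_def)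
    qed (use c1 \<theta>1 \<eta> in auto)
    have p2: "prob (cut_event \<eta> (r * \<epsilon>) u v (win m n - ?C)) \<le> w powr - 4"
      if mn: "m \<in> {u..<u + row_step \<delta> u}" "n \<in> {v..<v + col_step \<delta> v}" for m n
      unfolding w_def
    proof (rule cut_event_tail[where \<theta>=\<theta>2, OF _ _ cc(4)[OF mn] uv3(3,2) Z2 Z0 s(1)])
      have "24 * \<delta> * \<theta>2\<^sup>2 * s\<^sup>2 * exp (\<theta>2 * \<eta>) / 2 = 2 * (\<delta> * D)" by (simp add: D_def)
      then have "24 * \<delta> * \<theta>2\<^sup>2 * s\<^sup>2 * exp (\<theta>2 * \<eta>) / 2 \<le> 2" using \<delta>D by linarith
      moreover have "\<theta>2 * (r * \<epsilon>) = 6" using r \<epsilon> by (simp add: \<theta>2_def)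
      ultimately show "4 \<le> \<theta>2 * (r * \<epsilon>) - 24 * \<delta> * \<theta>2\<^sup>2 * s\<^sup>2 * exp (\<theta>2 * \<eta>) / 2" by linarith
    qed (use \<delta> \<theta>2 \<eta> cc(1)[OF mn] win_subset in auto)
    have p3: "prob (count_event \<eta> N u v (win m n)) \<le> 3 * w powr - 4"
      if mn: "m \<in> {u..<u + row_step \<delta> u}" "n \<in> {v..<v + col_step \<delta> v}" for m n
    proof -
      have lev: "level \<eta> u v > 0"
        unfolding level_def using \<eta> area_pos[OF uv3(3,2)] ln_pos[OF uv3(3,2)]
        by (intro mult_pos_pos real_sqrt_gt_zero divide_pos_pos) auto
      have "real (card (win m n)) * prob {\<omega>\<in>space M. level \<eta> u v < Z \<omega>}
        \<le> (9 * area u v) * (K / level \<eta> u v powr p)"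
        unfolding K_def using cc(5)[OF mn] area_pos[OF uv3(3,2)] p
        by (intro mult_mono moment_tail_bound Z_measurable lev) auto
      also have "\<dots> \<le> w powr - \<kappa>"
        using small[of u v] uv unfolding area_def level_def w_def by (simp add: k_def)
      finally have "prob (count_event \<eta> N u v (win m n)) \<le> 3 * w powr (- (\<kappa> * real N))"
        unfolding count_event_def using w \<kappa> cc(1)[OF mn] win_subset by (intro exceedance_count_tail) auto
      also have "\<dots> \<le> 3 * w powr - 4" using N w by (intro mult_left_mono powr_mono) auto
      finally show ?thesis .
    qed
    let ?E = "\<lambda>(m, n). cut_event \<eta> (r * \<epsilon>) u v (win m n - ?C) \<union> count_event \<eta> N u v (win m n)"
    have ev: "cut_event \<eta> (r * \<epsilon>) u v (win m n - ?C) \<in> events" "count_event \<eta> N u v (win m n) \<in> events" for m n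
      using win_subset[of m n] by (intro sum_events; blast)+
    have Em: "?E mn \<in> events" for mn
      using ev by (cases mn) auto
    have cutC: "cut_event \<eta> (r * \<tau>) u v ?C \<in> events" using C by (intro sum_events)
    show "bad_cell (r * \<tau>) (r * \<epsilon>) \<delta> \<eta> N u v \<in> events"
      unfolding bad_cell_def using Em cutC by (intro sets.Un sets.finite_UN) auto
    have p23: "prob (?E mn) \<le> 4 * w powr - 4" if "mn \<in> ?cells" for mn
    proof -
      obtain m n where mn: "mn = (m, n)" "m \<in> {u..<u + row_step \<delta> u}" "n \<in> {v..<v + col_step \<delta> v}"
        using \<open>mn \<in> ?cells\<close> by auto
      have "prob (?E mn) \<le> prob (cut_event \<eta> (r * \<epsilon>) u v (win m n - ?C)) + prob (count_event \<eta> N u v (win m n))"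
        unfolding mn(1) using ev by (auto intro!: measure_Un_le)
      then show ?thesis using p2[OF mn(2,3)] p3[OF mn(2,3)] by simp
    qed
    have "(\<Sum>mn\<in>?cells. prob (?E mn)) \<le> real (card ?cells) * (4 * w powr - 4)"
      by (rule sum_bounded_above) (rule p23)
    also have "\<dots> \<le> w * (4 * w powr - 4)"
    proof (intro mult_right_mono)
      have "card ?cells = row_step \<delta> u * col_step \<delta> v" by (simp add: card_cartesian_product)
      also have "\<dots> \<le> u * v"
        using regular_cellD(2)[OF ru] regular_cellD(2)[OF rv] by (simp add: row_step_def col_step_def mult_mono)
      finally show "real (card ?cells) \<le> w" unfolding w_def by (metis of_nat_le_iff of_nat_mult)
    qed simp
    also have "w * (4 * w powr - 4) = 4 * (w powr 1 * w powr - 4)" using w by simp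
    also have "\<dots> = 4 * w powr - 3" unfolding powr_add[symmetric] by simp
    also have "\<dots> \<le> 4 * w powr - \<beta>" using w \<beta>2 by (intro mult_left_mono powr_mono) auto
    finally have p4: "(\<Sum>mn\<in>?cells. prob (?E mn)) \<le> 4 * w powr - \<beta>" by simp
    have "prob (bad_cell (r * \<tau>) (r * \<epsilon>) \<delta> \<eta> N u v)
      \<le> prob (cut_event \<eta> (r * \<tau>) u v ?C) + prob (\<Union>mn\<in>?cells. ?E mn)"
      unfolding bad_cell_def using Em cutC by (intro measure_Un_le sets.finite_UN) auto
    also have "prob (\<Union>mn\<in>?cells. ?E mn) \<le> (\<Sum>mn\<in>?cells. prob (?E mn))"
      using Em by (intro measure_UNION_le) auto
    finally show "prob (bad_cell (r * \<tau>) (r * \<epsilon>) \<delta> \<eta> N u v) \<le> 5 * (real u * real v) powr - \<beta>"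
      using p1 p4 unfolding w_def by simp
  qed (use \<delta> \<beta>1 k2 \<kappa> in \<open>auto simp: k_def\<close>)
qed

text \<open>
  With \<open>f = jump_weight \<bar>Z\<bar> powr (1 / \<alpha>)\<close>, the event that \<open>X (i, j)\<close> is large is contained, in distribution, in \<open>f \<ge> c' * g j * i\<close>. Summation over \<open>i\<close>
  gives at most \<open>E f / (c' * g j)\<close>, and this is summable over \<open>j\<close> because \<open>g j = (j / ln j) powr (1 / \<alpha>)\<close> with \<open>1 / \<alpha> > 1\<close>.
\<close>

lemma large_terms_eventually_small:
  assumes int: "integrable M (\<lambda>\<omega>. jump_weight \<bar>Z \<omega>\<bar> powr (1 / \<alpha>))" and "0 < c"
  shows "AE \<omega> in M. \<exists>k. \<forall>i\<ge>k. \<forall>j\<ge>k. \<bar>X (i, j) \<omega>\<bar> \<le> c * norming i j"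
proof -
  let ?f = "\<lambda>\<omega>. jump_weight \<bar>Z \<omega>\<bar> powr (1 / \<alpha>)"
  define c' where "c' = (c\<^sup>2 / 2) powr (1 / \<alpha>)"
  have c': "c' > 0" using \<open>0 < c\<close> by (simp add: c'_def)
  define g where "g j = col_length j powr (1 / \<alpha>)" for j
  have "\<forall>\<^sub>F w::real in at_top. c\<^sup>2 * (w * ln w) \<le> w powr 4"
  proof -
    have "((\<lambda>w::real. c\<^sup>2 * (w * ln w) / w powr 4) \<longlongrightarrow> 0) at_top" by real_asymp
    then have "\<forall>\<^sub>F w::real in at_top. c\<^sup>2 * (w * ln w) / w powr 4 < 1" by (rule order_tendstoD) simp
    with eventually_gt_at_top[of 0] show ?thesis
      by eventually_elim (simp add: divide_less_eq)
  qed
  then obtain w0 where w0: "\<And>w. w \<ge> w0 \<Longrightarrow> c\<^sup>2 * (w * ln w) \<le> w powr 4"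
    unfolding eventually_at_top_linorder by auto
  define k where "k = max 3 (nat \<lceil>w0\<rceil>)"
  have key: "c' * g j * real i \<le> jump_weight y powr (1 / \<alpha>)"
    if ij: "k \<le> i" "k \<le> j" and y: "c * norming i j < y" for i j y
  proof -
    have ij3: "3 \<le> i" "3 \<le> j" "1 \<le> i" using ij by (auto simp: k_def)
    define w where "w = real i * real j"
    define L where "L = ln w"
    have L: "1 \<le> L" unfolding L_def w_def using ij3 by (intro ln_pos)
    have a: "0 < area i j" using ij3 by (intro area_pos)
    have "w0 \<le> real i" using ij by (auto simp: k_def)
    also have "real i * 1 \<le> w" unfolding w_def using ij3 by (intro mult_left_mono) auto
    finally have ww: "w0 \<le> w" by simp
    have wp: "w > 0" using ij3 by (simp add: w_def)
    have aw: "area i j \<le> w"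
    proof -
      have "real i powr \<alpha> \<le> real i powr 1" using ij3 \<alpha> by (intro powr_mono) auto
      moreover have "col_length j \<le> real j"
      proof -
        have "ln 3 \<le> ln (real j)" using ij3 by (subst ln_le_cancel_iff) auto
        then have "1 \<le> ln (real j)" using ln_3_ge_1 by simp
        then show ?thesis using ij3 by (simp add: col_length_def divide_le_eq mult_le_cancel_left1)
      qed
      ultimately show ?thesis unfolding area_def row_length_def w_def
        using ij3 by (intro mult_mono) (auto simp: col_length_def)
    qed
    let ?x = "c * norming i j"
    have xp: "0 < ?x" using norming_pos[OF ij3(3,2)] \<open>0 < c\<close> by simp
    have x2: "?x\<^sup>2 = c\<^sup>2 * (area i j * L)"
      unfolding power_mult_distrib norming_def L_def w_def using a ln_pos[OF ij3(3,2)] by simp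
    have "ln (?x\<^sup>2) \<le> ln (w powr 4)"
    proof (subst ln_le_cancel_iff)
      have "?x\<^sup>2 \<le> c\<^sup>2 * (w * L)" unfolding x2 using aw L by (intro mult_left_mono mult_right_mono) auto
      also have "\<dots> \<le> w powr 4" using w0[OF ww] by (simp add: L_def)
      finally show "?x\<^sup>2 \<le> w powr 4" .
    qed (use xp wp in auto)
    then have "2 * ln ?x \<le> 4 * L" using xp wp by (simp add: L_def ln_powr ln_realpow)
    then have lp: "log_plus ?x \<le> 2 * L" using L by (simp add: log_plus_def)
    have "c\<^sup>2 / 2 * area i j = ?x\<^sup>2 / (2 * L)" unfolding x2 using L by simp
    also have "\<dots> \<le> jump_weight ?x"
      unfolding jump_weight_def using lp log_plus_ge_1[of ?x] L by (intro divide_left_mono) auto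
    also have "\<dots> \<le> jump_weight y" using xp y by (intro jump_weight_mono) auto
    finally have "(c\<^sup>2 / 2 * area i j) powr (1 / \<alpha>) \<le> jump_weight y powr (1 / \<alpha>)"
      using \<alpha> a by (intro powr_mono2) auto
    also have "(c\<^sup>2 / 2 * area i j) powr (1 / \<alpha>) = c' * (real i * g j)"
      unfolding area_def row_length_def c'_def g_def powr_mult powr_powr using \<alpha> by simp
    finally show ?thesis by (simp add: mult_ac)
  qed
  define A where "A i j = {\<omega>\<in>space M. c * norming (k + i) (k + j) < \<bar>X (k + i, k + j) \<omega>\<bar>}" for i j
  have k1: "1 \<le> k" by (simp add: k_def)
  have gp: "0 < g (k + j)" for j
  proof -
    have "3 \<le> k + j" by (simp add: k_def)
    from area_pos[OF le_refl this] show ?thesis by (simp add: area_def row_length_def g_def)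
  qed
  let ?T = "\<lambda>j i. prob {\<omega>\<in>space M. (c' * g (k + j)) * real (Suc i) \<le> ?f \<omega>}"
  have fm[measurable]: "?f \<in> borel_measurable M" using int by auto
  have Ale: "prob (A i j) \<le> ?T j i" for i j
  proof -
    have "prob (A i j) = prob {\<omega>\<in>space M. Z \<omega> \<in> {x. c * norming (k + i) (k + j) < \<bar>x\<bar>}}"
      unfolding A_def using prob_X[of "(k + i, k + j)" "{x. c * norming (k + i) (k + j) < \<bar>x\<bar>}"] k1 by auto
    also have "\<dots> \<le> ?T j i"
    proof (intro finite_measure_mono subsetI)
      fix \<omega> assume w: "\<omega> \<in> {\<omega>\<in>space M. Z \<omega> \<in> {x. c * norming (k + i) (k + j) < \<bar>x\<bar>}}"
      have "c' * g (k + j) * real (Suc i) \<le> c' * g (k + j) * real (k + i)"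
        using c' gp k1 by (intro mult_left_mono) (auto simp: less_imp_le)
      also have "\<dots> \<le> ?f \<omega>" using w by (intro key) auto
      finally show "\<omega> \<in> {\<omega>\<in>space M. (c' * g (k + j)) * real (Suc i) \<le> ?f \<omega>}" using w by simp
    qed measurable
    finally show ?thesis .
  qed
  have T: "summable (?T j)" "(\<Sum>i. ?T j i) \<le> expectation ?f / (c' * g (k + j))" for j
    using sum_tails_le_expectation[OF int, of "c' * g (k + j)"] c' gp by auto
  have "AE \<omega> in M. \<exists>J. \<forall>j\<ge>J. \<forall>i. \<omega> \<notin> A i j"
  proof (rule borel_cantelli_rows)
    show Am: "A i j \<in> events" for i j
    proof -
      have [measurable]: "X (k + i, k + j) \<in> borel_measurable M" using k1 by (intro X_measurable) auto
      show ?thesis unfolding A_def by measurable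
    qed
    show sA: "summable (\<lambda>i. prob (A i j))" for j
      by (rule summable_comparison_test'[OF T(1)[of j], of 0]) (use Ale in auto)
    show "(\<Sum>i. prob (A i j)) \<le> expectation ?f / c' * inverse (g (k + j))" for j
    proof -
      have "(\<Sum>i. prob (A i j)) \<le> (\<Sum>i. ?T j i)" by (intro suminf_le Ale sA T(1))
      also have "\<dots> \<le> expectation ?f / (c' * g (k + j))" by (rule T(2))
      finally show ?thesis by (simp add: divide_inverse mult_ac)
    qed
    have "summable (\<lambda>j. inverse (g j))"
    proof (rule summable_comparison_test_ev)
      define e where "e = (1 / \<alpha> - 1) / 2"
      have e: "e > 0" using \<alpha> by (simp add: e_def field_simps)
      show "summable (\<lambda>j. real j powr - (1 + e))" using e by (simp add: summable_real_powr_iff)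
      have "((\<lambda>x::real. (ln x) powr (1 / \<alpha>) * x powr - e) \<longlongrightarrow> 0) at_top"
        using e \<alpha> by real_asymp
      then have "((\<lambda>j. (ln (real j)) powr (1 / \<alpha>) * real j powr - e) \<longlongrightarrow> 0) sequentially"
        by (rule filterlim_compose[OF _ filterlim_real_sequentially])
      then have "\<forall>\<^sub>F j in sequentially. (ln (real j)) powr (1 / \<alpha>) * real j powr - e < 1"
        by (rule order_tendstoD) simp
      with eventually_ge_at_top[of 3]
      show "\<forall>\<^sub>F j in sequentially. norm (inverse (g j)) \<le> real j powr - (1 + e)"
      proof eventually_elim
        case (elim j)
        have gj: "g j \<ge> 0" by (simp add: g_def)
        have l: "0 \<le> ln (real j)" using elim by simp
        have "inverse (g j) = ln (real j) powr (1 / \<alpha>) * real j powr - (1 / \<alpha>)"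
          unfolding g_def col_length_def using elim l by (simp add: powr_divide powr_minus field_simps)
        also have "- (1 / \<alpha>) = - e + - (1 + e)" by (simp add: e_def field_simps)
        also have "ln (real j) powr (1 / \<alpha>) * real j powr (- e + - (1 + e))
          = (ln (real j) powr (1 / \<alpha>) * real j powr - e) * real j powr - (1 + e)"
          unfolding powr_add by simp
        also have "\<dots> \<le> 1 * real j powr - (1 + e)" using elim by (intro mult_right_mono) auto
        finally show ?case using gj by simp
      qed
    qed
    then have "summable (\<lambda>j. inverse (g (j + k)))" by (rule summable_ignore_initial_segment)
    then show "summable (\<lambda>j. expectation ?f / c' * inverse (g (k + j)))"
      by (intro summable_mult) (simp add: add.commute)
  qed
  with AE_space show ?thesis
  proof eventually_elim
    case (elim \<omega>)
    from elim(2) obtain J where J: "\<And>j i. J \<le> j \<Longrightarrow> \<omega> \<notin> A i j" by blast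
    show ?case
    proof (intro exI[of _ "k + J"] allI impI)
      fix i j assume "k + J \<le> i" "k + J \<le> j"
      then have "J \<le> j - k" "k + (i - k) = i" "k + (j - k) = j" by auto
      then show "\<bar>X (i, j) \<omega>\<bar> \<le> c * norming i j"
        using J[of "j - k" "i - k"] elim(1) by (simp add: A_def not_less)
    qed
  qed
qed

lemma eventually_psum_le:
  assumes Z2: "integrable M (\<lambda>\<omega>. (Z \<omega>)\<^sup>2)" and Z0: "expectation Z = 0"
    and s: "expectation (\<lambda>\<omega>. (Z \<omega>)\<^sup>2) \<le> s\<^sup>2" "0 < s" "s < \<tau>"
    and p: "2 < p" "integrable M (\<lambda>\<omega>. \<bar>Z \<omega>\<bar> powr p)"
    and int: "integrable M (\<lambda>\<omega>. jump_weight \<bar>Z \<omega>\<bar> powr (1 / \<alpha>))"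
  shows "AE \<omega> in M. \<exists>k. \<forall>m\<ge>k. \<forall>n\<ge>k. psum (win m n) \<omega> \<le> sqrt (2 * (1 - \<alpha>)) * \<tau> * norming m n"
proof -
  define r where "r = sqrt (2 * (1 - \<alpha>))"
  have r: "r > 0" using \<alpha> by (simp add: r_def)
  define \<epsilon> where "\<epsilon> = (\<tau> - s) / 3"
  have \<epsilon>: "\<epsilon> > 0" "s < \<tau> - 2 * \<epsilon>" using s by (auto simp: \<epsilon>_def field_simps)
  define \<tau>' where "\<tau>' = \<tau> - 2 * \<epsilon>"
  obtain \<delta> \<eta> N \<beta> k where \<delta>: "0 < \<delta>" and \<beta>: "1 - \<alpha> < \<beta>" and k: "3 \<le> k"
    and reg: "\<And>u. k \<le> u \<Longrightarrow> regular_cell (row_length \<alpha>) \<delta> u \<and> regular_cell col_length \<delta> u"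
    and bad: "\<And>u v. k \<le> u \<Longrightarrow> k \<le> v \<Longrightarrow> bad_cell (r * \<tau>') (r * \<epsilon>) \<delta> \<eta> N u v \<in> events"
      "\<And>u v. k \<le> u \<Longrightarrow> k \<le> v \<Longrightarrow> prob (bad_cell (r * \<tau>') (r * \<epsilon>) \<delta> \<eta> N u v) \<le> 5 * (real u * real v) powr - \<beta>"
    using bad_cell_bound[OF Z2 Z0 s(1,2) \<epsilon>(2) \<epsilon>(1) p] unfolding r_def \<tau>'_def by blast
  define U where "U = grid (row_step \<delta>) k"
  define V where "V = grid (col_step \<delta>) k"
  have UV: "k \<le> U i" "k \<le> V i" for i unfolding U_def V_def by (rule grid_ge)+
  have rs: "1 \<le> row_step \<delta> u" "row_step \<delta> u \<le> u" "\<delta> * row_length \<alpha> u \<le> row_step \<delta> u" if "k \<le> u" for u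
    using regular_cellD(1-3)[of "row_length \<alpha>" \<delta> u] reg[OF that] by (auto simp: row_step_def)
  have cs: "1 \<le> col_step \<delta> u" "col_step \<delta> u \<le> u" "\<delta> * col_length u \<le> col_step \<delta> u" if "k \<le> u" for u
    using regular_cellD(1-3)[of col_length \<delta> u] reg[OF that] by (auto simp: col_step_def)
  have sU: "summable (\<lambda>i. real (U i) powr - \<beta>)"
    unfolding U_def
    by (rule summable_powr_grid[where \<kappa>="\<beta> - (1 - \<alpha>)" and c=1 and \<phi>="row_length \<alpha>", OF _ _ \<delta>])
       (use \<beta> k rs in \<open>auto simp: row_length_def\<close>)
  \<comment> \<open>The steps in the second coordinate are almost linear, and every positive exponent would do.\<close>
  have sV: "summable (\<lambda>i. real (V i) powr - \<beta>)"
    unfolding V_def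
  proof (rule summable_powr_grid[where \<kappa>="\<beta> / 2" and c="\<beta> / 2" and \<phi>=col_length, OF _ _ \<delta>])
    fix u assume u: "k \<le> u"
    have \<beta>0: "\<beta> > 0" using \<beta> \<alpha> by simp
    have u3: "3 \<le> u" using u k by simp
    have l: "0 < ln (real u)" using u3 by simp
    have "ln (real u) \<le> real u powr (\<beta> / 2) / (\<beta> / 2)"
      using u3 \<beta>0 by (intro ln_powr_bound) auto
    then have "real u / (real u powr (\<beta> / 2) / (\<beta> / 2)) \<le> col_length u"
      unfolding col_length_def using l u3 \<beta>0 by (intro divide_left_mono) auto
    also have "real u / (real u powr (\<beta> / 2) / (\<beta> / 2)) = \<beta> / 2 * real u powr (1 - \<beta> / 2)"
      using u3 by (simp add: powr_diff mult_ac)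
    finally show "\<beta> / 2 * real u powr (1 - \<beta> + \<beta> / 2) \<le> col_length u" by (simp add: field_simps)
  qed (use \<beta> \<alpha> k cs in auto)
  define A where "A i j = bad_cell (r * \<tau>') (r * \<epsilon>) \<delta> \<eta> N (U i) (V j)" for i j
  have Ale: "prob (A i j) \<le> 5 * real (V j) powr - \<beta> * real (U i) powr - \<beta>" for i j
    using bad(2)[OF UV(1)[of i] UV(2)[of j]] by (simp add: A_def powr_mult mult_ac)
  have ae1: "AE \<omega> in M. \<exists>J. \<forall>j\<ge>J. \<forall>i. \<omega> \<notin> A i j"
  proof (rule borel_cantelli_rows)
    show "A i j \<in> events" for i j unfolding A_def by (rule bad(1)[OF UV])
    have s1: "summable (\<lambda>i. 5 * real (V j) powr - \<beta> * real (U i) powr - \<beta>)" for j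
      by (intro summable_mult sU)
    show sA: "summable (\<lambda>i. prob (A i j))" for j
      by (rule summable_comparison_test'[OF s1[of j], of 0]) (use Ale in auto)
    show "(\<Sum>i. prob (A i j)) \<le> (5 * (\<Sum>i. real (U i) powr - \<beta>)) * real (V j) powr - \<beta>" for j
    proof -
      have "(\<Sum>i. prob (A i j)) \<le> (\<Sum>i. 5 * real (V j) powr - \<beta> * real (U i) powr - \<beta>)"
        by (intro suminf_le Ale sA s1)
      also have "\<dots> = 5 * real (V j) powr - \<beta> * (\<Sum>i. real (U i) powr - \<beta>)" by (rule suminf_mult[OF sU])
      finally show ?thesis by (simp add: mult_ac)
    qed
    show "summable (\<lambda>j. (5 * (\<Sum>i. real (U i) powr - \<beta>)) * real (V j) powr - \<beta>)"
      by (intro summable_mult sV)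
  qed
  define c where "c = r * \<epsilon> / (real N + 1) / 9"
  have c: "c > 0" using r \<epsilon> by (simp add: c_def)
  have ae2: "AE \<omega> in M. \<exists>k. \<forall>i\<ge>k. \<forall>j\<ge>k. \<bar>X (i, j) \<omega>\<bar> \<le> c * norming i j"
    by (rule large_terms_eventually_small[OF int c])
  show ?thesis
    unfolding r_def[symmetric] using ae1 ae2 AE_space
  proof eventually_elim
    case (elim \<omega>)
    then obtain J k' where J: "\<And>j i. J \<le> j \<Longrightarrow> \<omega> \<notin> A i j"
      and k': "\<And>i j. k' \<le> i \<Longrightarrow> k' \<le> j \<Longrightarrow> \<bar>X (i, j) \<omega>\<bar> \<le> c * norming i j" by blast
    define K where "K = max (2 * max k k') (V J)"
    show ?case
    proof (intro exI[of _ K] allI impI)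
      fix m n assume mn: "K \<le> m" "K \<le> n"
      then have mn': "k \<le> m" "k \<le> n" "2 * k' \<le> m" "2 * k' \<le> n" "V J \<le> n" by (auto simp: K_def)
      obtain i where i: "U i \<le> m" "m < U i + row_step \<delta> (U i)"
        unfolding U_def using grid_cell[of k "row_step \<delta>" m] rs(1) mn' by blast
      obtain j where j: "V j \<le> n" "n < V j + col_step \<delta> (V j)"
        unfolding V_def using grid_cell[of k "col_step \<delta>" n] cs(1) mn' by blast
      \<comment> \<open>The point lies in a late cell because it lies beyond the start of cell \<open>J\<close>.\<close>
      have "J \<le> j"
      proof (rule ccontr)
        assume "\<not> J \<le> j"
        then have "V (Suc j) \<le> V J" unfolding V_def by (intro grid_mono) auto
        then show False using mn' j by (simp add: V_def grid_Suc)
      qed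
      define u where "u = U i"
      define v where "v = V j"
      have uv: "k \<le> u" "k \<le> v" "1 \<le> u" "3 \<le> v" using UV[of i] UV[of j] k by (auto simp: u_def v_def)
      have uk': "k' \<le> u" "k' \<le> v"
        using i j mn' rs(2)[OF uv(1)] cs(2)[OF uv(2)] by (auto simp: u_def v_def)
      have cell: "m \<in> {u..<u + row_step \<delta> u}" "n \<in> {v..<v + col_step \<delta> v}"
        using i j by (auto simp: u_def v_def)
      note cc = cell_cards[OF conjunct1[OF reg[OF uv(1)]] conjunct2[OF reg[OF uv(2)]] \<delta> cell]
      have np: "0 < norming u v" by (rule norming_pos[OF uv(3,4)])
      let ?y = "c * (9 * norming u v)"
      have "psum (win m n) \<omega> \<le> (r * \<tau>' + r * \<epsilon>) * norming u v + real N * ?y"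
      proof (rule psum_le_off_bad_cell[OF _ _ cell cc(1,2)])
        show "\<omega> \<notin> bad_cell (r * \<tau>') (r * \<epsilon>) \<delta> \<eta> N u v"
          using J[OF \<open>J \<le> j\<close>, of i] by (simp add: A_def u_def v_def)
        show "0 \<le> ?y" using c np by simp
        fix x assume "x \<in> win m n"
        then obtain a b where ab: "x = (a, b)" "u \<le> a" "a \<le> 4 * u" "v \<le> b" "b \<le> 4 * v"
          using cc(6) by auto
        have "X x \<omega> \<le> \<bar>X (a, b) \<omega>\<bar>" using ab by simp
        also have "\<dots> \<le> c * norming a b" using ab uk' by (intro k') auto
        also have "\<dots> \<le> c * norming (4 * u) (4 * v)"
          using ab uv c by (intro mult_left_mono norming_mono) auto
        also have "\<dots> \<le> ?y" using uv c by (intro mult_left_mono norming_dilate) auto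
        finally show "X x \<omega> \<le> ?y" .
      qed (use elim in auto)
      also have "real N * ?y \<le> r * \<epsilon> * norming u v"
      proof -
        have "x / 9 * 9 = x" for x :: real by simp
        then have c9: "c * 9 = r * \<epsilon> / (real N + 1)" unfolding c_def by blast
        have "real N * ?y = real N * (c * 9) * norming u v" by simp
        also have "\<dots> = real N * (r * \<epsilon> / (real N + 1)) * norming u v" unfolding c9 ..
        also have "\<dots> = (real N / (real N + 1)) * (r * \<epsilon> * norming u v)" by simp
        also have "\<dots> \<le> 1 * (r * \<epsilon> * norming u v)" using r \<epsilon> np by (intro mult_right_mono) auto
        finally show ?thesis by simp
      qed
      also have "(r * \<tau>' + r * \<epsilon>) * norming u v + r * \<epsilon> * norming u v = r * \<tau> * norming u v"
        by (simp add: \<tau>'_def algebra_simps)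
      also have "\<dots> \<le> r * \<tau> * norming m n"
        using r s cell uv by (intro mult_left_mono norming_mono) auto
      finally show "psum (win m n) \<omega> \<le> r * \<tau> * norming m n" by simp
    qed
  qed
qed

end

section \<open>Tails and moments\<close>

lemma (in prob_space) integrable_of_summable_tails:
  fixes f :: "'a \<Rightarrow> real"
  assumes [measurable]: "f \<in> borel_measurable M" and nn: "\<And>\<omega>. 0 \<le> f \<omega>" and "0 < D"
    and s: "summable (\<lambda>m. prob {\<omega>\<in>space M. D * real m < f \<omega>})"
  shows "integrable M f"
proof -
  let ?A = "\<lambda>m. {\<omega>\<in>space M. D * real m < f \<omega>}"
  have "(\<integral>\<^sup>+\<omega>. ennreal (f \<omega> / D) \<partial>M) \<le> (\<integral>\<^sup>+\<omega>. (\<Sum>m. indicator (?A m) \<omega>) \<partial>M)"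
  proof (rule nn_integral_mono)
    fix \<omega> assume w: "\<omega> \<in> space M"
    define g where "g = f \<omega> / D"
    have "ennreal g \<le> ennreal (real (nat \<lceil>g\<rceil>))" by (intro ennreal_leI real_nat_ceiling_ge)
    also have "\<dots> = (\<Sum>m<nat \<lceil>g\<rceil>. 1)" by (simp add: ennreal_of_nat_eq_real_of_nat)
    also have "\<dots> = (\<Sum>m<nat \<lceil>g\<rceil>. indicator (?A m) \<omega>)"
    proof (intro sum.cong refl)
      fix m assume "m \<in> {..<nat \<lceil>g\<rceil>}"
      then have "real m < g" by (simp add: zless_nat_eq_int_zless less_ceiling_iff)
      then show "1 = indicator (?A m) \<omega>" using w \<open>0 < D\<close> by (simp add: g_def field_simps)
    qed
    also have "\<dots> \<le> (\<Sum>m. indicator (?A m) \<omega>)" by (intro sum_le_suminf) auto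
    finally show "ennreal (f \<omega> / D) \<le> (\<Sum>m. indicator (?A m) \<omega>)" by (simp add: g_def)
  qed
  also have "\<dots> = (\<Sum>m. emeasure M (?A m))"
    by (subst nn_integral_suminf) auto
  also have "\<dots> = ennreal (\<Sum>m. prob (?A m))"
    unfolding emeasure_eq_measure using s by (intro suminf_ennreal_eq summable_sums) auto
  also have "\<dots> < \<infinity>" by simp
  finally have "integrable M (\<lambda>\<omega>. f \<omega> / D)"
    using nn \<open>0 < D\<close> by (intro integrableI_nonneg) auto
  then have "integrable M (\<lambda>\<omega>. D * (f \<omega> / D))" by (intro integrable_mult_right)
  then show ?thesis using \<open>0 < D\<close> by simp
qed

lemma (in prob_space) exists_small_tail:
  fixes Z :: "'a \<Rightarrow> real"
  assumes [measurable]: "Z \<in> borel_measurable M" and "0 < e"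
  shows "\<exists>x0. \<forall>x\<ge>x0. prob {\<omega>\<in>space M. x < \<bar>Z \<omega>\<bar>} < e"
proof -
  let ?A = "\<lambda>k::nat. {\<omega>\<in>space M. real k < \<bar>Z \<omega>\<bar>}"
  have "(\<lambda>k. prob (?A k)) \<longlonglongrightarrow> prob (\<Inter>k. ?A k)"
    by (intro finite_Lim_measure_decseq) (auto simp: decseq_def)
  also have "(\<Inter>k. ?A k) = {}"
  proof -
    have "\<omega> \<notin> (\<Inter>k. ?A k)" for \<omega>
    proof -
      obtain k where "\<bar>Z \<omega>\<bar> \<le> real k" using real_arch_simple by blast
      then have "\<omega> \<notin> ?A k" by simp
      then show ?thesis by blast
    qed
    then show ?thesis by blast
  qed
  finally have "(\<lambda>k. prob (?A k)) \<longlonglongrightarrow> 0" by simp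
  then have "\<forall>\<^sub>F k in sequentially. prob (?A k) < e" using \<open>0 < e\<close> by (rule order_tendstoD)
  then obtain k where k: "prob (?A k) < e" by (auto simp: eventually_sequentially)
  show ?thesis
  proof (intro exI[of _ "real k"] allI impI)
    fix x assume "real k \<le> x"
    then have "prob {\<omega>\<in>space M. x < \<bar>Z \<omega>\<bar>} \<le> prob (?A k)" by (intro finite_measure_mono) auto
    then show "prob {\<omega>\<in>space M. x < \<bar>Z \<omega>\<bar>} < e" using k by simp
  qed
qed

lemma powr_le_jump_weight:
  assumes "0 < \<alpha>" "\<alpha> < 1"
  shows "\<exists>C. \<forall>x\<ge>0. x powr (1 + 1 / \<alpha>) \<le> C + jump_weight x powr (1 / \<alpha>)"
proof -
  define e where "e = 1 / \<alpha> - 1"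
  have e: "e > 0" using assms by (simp add: e_def field_simps)
  have "((\<lambda>x::real. ln x powr (1 / \<alpha>) * x powr - e) \<longlongrightarrow> 0) at_top"
    using e assms by real_asymp
  then have "\<forall>\<^sub>F x::real in at_top. ln x powr (1 / \<alpha>) * x powr - e < 1"
    by (rule order_tendstoD) simp
  then obtain x0 where x0: "\<And>x::real. x \<ge> x0 \<Longrightarrow> ln x powr (1 / \<alpha>) * x powr - e < 1"
    unfolding eventually_at_top_linorder by auto
  define x1 where "x1 = max x0 3"
  have "x powr (1 + 1 / \<alpha>) \<le> x1 powr (1 + 1 / \<alpha>) + jump_weight x powr (1 / \<alpha>)" if "x \<ge> 0" for x
  proof (cases "x \<le> x1")
    case True
    have "x powr (1 + 1 / \<alpha>) \<le> x1 powr (1 + 1 / \<alpha>)"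
      using True that assms by (intro powr_mono2) auto
    then show ?thesis by (simp add: add_increasing2)
  next
    case False
    then have x: "x \<ge> x0" "x \<ge> 3" by (auto simp: x1_def)
    have "ln 3 \<le> ln x" using x by (subst ln_le_cancel_iff) auto
    then have l: "1 \<le> ln x" using ln_3_ge_1 by simp
    then have lp: "log_plus x = ln x" by (simp add: log_plus_def)
    have "ln x powr (1 / \<alpha>) * x powr - e < 1" by (rule x0[OF x(1)])
    then have "ln x powr (1 / \<alpha>) \<le> x powr e" using x by (simp add: powr_minus field_simps)
    then have "x powr (1 + 1 / \<alpha>) * ln x powr (1 / \<alpha>) \<le> x powr (1 + 1 / \<alpha>) * x powr e"
      by (intro mult_left_mono) auto
    also have "\<dots> = x powr (2 / \<alpha>)" unfolding powr_add[symmetric] by (simp add: e_def)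
    also have "\<dots> = (x powr 2) powr (1 / \<alpha>)" unfolding powr_powr by simp
    also have "\<dots> = (x\<^sup>2) powr (1 / \<alpha>)" using x by simp
    finally have "x powr (1 + 1 / \<alpha>) \<le> (x\<^sup>2) powr (1 / \<alpha>) / ln x powr (1 / \<alpha>)"
      using l by (simp add: field_simps)
    also have "\<dots> = jump_weight x powr (1 / \<alpha>)"
      unfolding jump_weight_def lp using l by (simp add: powr_divide)
    finally show ?thesis by (simp add: add_increasing)
  qed
  then show ?thesis by blast
qed

lemma (in prob_space) moments_of_jump_weight:
  fixes Z :: "'a \<Rightarrow> real"
  assumes [measurable]: "Z \<in> borel_measurable M" and \<alpha>: "0 < \<alpha>" "\<alpha> < 1"
    and int: "integrable M (\<lambda>\<omega>. jump_weight \<bar>Z \<omega>\<bar> powr (1 / \<alpha>))"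
  shows "integrable M (\<lambda>\<omega>. \<bar>Z \<omega>\<bar> powr (1 + 1 / \<alpha>))" "integrable M (\<lambda>\<omega>. (Z \<omega>)\<^sup>2)"
proof -
  obtain C where C: "\<And>x. 0 \<le> x \<Longrightarrow> x powr (1 + 1 / \<alpha>) \<le> C + jump_weight x powr (1 / \<alpha>)"
    using powr_le_jump_weight[OF \<alpha>] by blast
  show p: "integrable M (\<lambda>\<omega>. \<bar>Z \<omega>\<bar> powr (1 + 1 / \<alpha>))"
  proof (rule Bochner_Integration.integrable_bound)
    show "integrable M (\<lambda>\<omega>. C + jump_weight \<bar>Z \<omega>\<bar> powr (1 / \<alpha>))" using int by auto
    show "AE \<omega> in M. norm (\<bar>Z \<omega>\<bar> powr (1 + 1 / \<alpha>)) \<le> norm (C + jump_weight \<bar>Z \<omega>\<bar> powr (1 / \<alpha>))"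
    proof (intro AE_I2)
      fix \<omega>
      show "norm (\<bar>Z \<omega>\<bar> powr (1 + 1 / \<alpha>)) \<le> norm (C + jump_weight \<bar>Z \<omega>\<bar> powr (1 / \<alpha>))"
        using C[of "\<bar>Z \<omega>\<bar>"] by simp
    qed
  qed measurable
  show "integrable M (\<lambda>\<omega>. (Z \<omega>)\<^sup>2)"
  proof (rule Bochner_Integration.integrable_bound)
    show "integrable M (\<lambda>\<omega>. 1 + \<bar>Z \<omega>\<bar> powr (1 + 1 / \<alpha>))" using p by auto
    show "AE \<omega> in M. norm ((Z \<omega>)\<^sup>2) \<le> norm (1 + \<bar>Z \<omega>\<bar> powr (1 + 1 / \<alpha>))"
    proof (intro AE_I2)
      fix \<omega>
      have "\<bar>Z \<omega>\<bar>\<^sup>2 \<le> 1 + \<bar>Z \<omega>\<bar> powr (1 + 1 / \<alpha>)"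
      proof (cases "\<bar>Z \<omega>\<bar> \<le> 1")
        case True
        then have "\<bar>Z \<omega>\<bar>\<^sup>2 \<le> 1" by (intro power_le_one) auto
        then show ?thesis by (simp add: add_increasing2)
      next
        case False
        have "2 \<le> 1 + 1 / \<alpha>" using \<alpha> by (simp add: field_simps)
        then have "\<bar>Z \<omega>\<bar> powr 2 \<le> \<bar>Z \<omega>\<bar> powr (1 + 1 / \<alpha>)" using False by (intro powr_mono) auto
        moreover have "\<bar>Z \<omega>\<bar> powr 2 = \<bar>Z \<omega>\<bar>\<^sup>2" using False by (subst powr_numeral) auto
        ultimately show ?thesis by simp
      qed
      then show "norm ((Z \<omega>)\<^sup>2) \<le> norm (1 + \<bar>Z \<omega>\<bar> powr (1 + 1 / \<alpha>))" by simp
    qed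
  qed measurable
qed

section \<open>Strips of fixed height: the lower bound and the converse\<close>

context iid_array
begin

text \<open>
  The exact number of rows of a window. The grid with these steps has consecutive disjoint windows.
\<close>

definition row_block :: "nat \<Rightarrow> nat" where
  "row_block u = Suc (nat \<lfloor>row_length \<alpha> u\<rfloor>)"

lemma row_length_ge_1: "1 \<le> u \<Longrightarrow> 1 \<le> row_length \<alpha> u"
  unfolding row_length_def using \<alpha> by (intro ge_one_powr_ge_zero) auto

lemma window_row_block: "1 \<le> u \<Longrightarrow> window (row_length \<alpha>) u = {u..<u + row_block u}"
  by (subst window_eq) (auto simp: row_block_def row_length_def)

lemma card_win_bounds:
  assumes "1 \<le> m" "3 \<le> n"
  shows "finite (win m n)" "area m n \<le> real (card (win m n))" "real (row_block m) \<le> real (card (win m n))"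
proof -
  have "0 < area 1 n" using assms by (intro area_pos) auto
  then have c: "0 < col_length n" by (simp add: area_def row_length_def)
  note R = card_window[of m "row_length \<alpha>"] and C = card_window[of n col_length]
  have r: "0 \<le> row_length \<alpha> m" by (simp add: row_length_def)
  have n1: "1 \<le> n" using assms by simp
  show "finite (win m n)" unfolding win_def using R(1) C(1) assms r c by auto
  have cw: "card (win m n) = card (window (row_length \<alpha>) m) * card (window col_length n)"
    by (simp add: win_def card_cartesian_product)
  show "area m n \<le> real (card (win m n))"
    unfolding cw area_def of_nat_mult using R(2) C(2) assms r c by (intro mult_mono) auto
  have "0 < real (card (window col_length n))" using C(2)[OF n1] c by linarith
  then have "1 \<le> card (window col_length n)" by simp
  then have "row_block m * 1 \<le> card (win m n)"
    unfolding cw window_row_block[OF assms(1)] by (intro mult_mono) auto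
  then show "real (row_block m) \<le> real (card (win m n))" by simp
qed

text \<open>
  Windows that start in the points of this grid do not overlap.
\<close>

lemma indep_strip:
  assumes "1 \<le> u0"
  shows "indep_vars (\<lambda>_. borel) (\<lambda>l. psum (win (grid row_block u0 l) n)) UNIV"
proof (rule indep_block_sums)
  let ?U = "grid row_block u0"
  have U1: "1 \<le> ?U l" for l using grid_ge[of u0 row_block l] assms by simp
  have lt: "win (?U l) n \<inter> win (?U l') n = {}" if "l < l'" for l l'
  proof -
    have "?U (Suc l) \<le> ?U l'" using that by (intro grid_mono) auto
    then have "?U l + row_block (?U l) \<le> ?U l'" by (simp add: grid_Suc)
    then show ?thesis unfolding win_def window_row_block[OF U1] by auto
  qed
  show "disjoint_family_on (\<lambda>l. win (?U l) n) UNIV"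
    unfolding disjoint_family_on_def using lt by (metis Int_commute linorder_neqE_nat)
qed (rule win_subset)

lemma row_block_ge_1: "1 \<le> row_block u" by (simp add: row_block_def)

text \<open>
  The lower bound is already attained for each fixed \<open>n\<close>, as \<open>m\<close> tends to infinity.
\<close>

lemma frequently_psum_ge:
  assumes Z2: "integrable M (\<lambda>\<omega>. (Z \<omega>)\<^sup>2)" and Z0: "expectation Z = 0"
    and var: "expectation (\<lambda>\<omega>. (Z \<omega>)\<^sup>2) = \<sigma>\<^sup>2" and \<tau>: "0 < \<tau>" "\<tau> < \<sigma>" and n: "3 \<le> n"
  shows "AE \<omega> in M. \<forall>k. \<exists>m\<ge>k. sqrt (2 * (1 - \<alpha>)) * \<tau> * norming m n \<le> psum (win m n) \<omega>"
proof -
  define g where "g = col_length n"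
  have "0 < area 1 n" using n by (intro area_pos) auto
  then have g: "g > 0" by (simp add: area_def row_length_def g_def)
  have np: "real n > 0" using n by simp
  have inf: "infinite ({1..} \<times> {1..} :: (nat \<times> nat) set)"
    by (simp add: finite_cartesian_product_iff infinite_Ici)
  obtain h0 \<kappa> where hk: "h0 > 0" "\<kappa> > 0" and mod0: "\<forall>h\<ge>h0. \<forall>A. A \<subseteq> {1..} \<times> {1..} \<longrightarrow> finite A \<longrightarrow>
      \<kappa> * h \<le> real (card A) \<longrightarrow>
      exp (- h) / 2 \<le> prob {\<omega>\<in>space M. \<tau> * sqrt (2 * h * card A) \<le> psum A \<omega>}"
    using psum_moderate_deviation_lower[OF inf Z2 Z0 var \<tau>] by (elim exE conjE) (rule that)
  note mod = mod0[rule_format]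
  let ?h = "\<lambda>x::real. (1 - \<alpha>) * ln (x * real n)"
  have "\<forall>\<^sub>F x in at_top. h0 \<le> ?h x"
  proof -
    have "filterlim ?h at_top at_top" using np \<alpha> by real_asymp
    then show ?thesis by (simp add: filterlim_at_top)
  qed
  moreover have "\<forall>\<^sub>F x in at_top. \<kappa> * ?h x \<le> x powr \<alpha> * g"
  proof -
    have "((\<lambda>x::real. \<kappa> * ?h x / (x powr \<alpha> * g)) \<longlongrightarrow> 0) at_top" using np g \<alpha> hk by real_asymp
    then have "\<forall>\<^sub>F x in at_top. \<kappa> * ?h x / (x powr \<alpha> * g) < 1" by (rule order_tendstoD) simp
    with eventually_gt_at_top[of 0] show ?thesis
      by eventually_elim (use g in \<open>simp add: divide_less_eq\<close>)
  qed
  ultimately obtain x0 where x0: "\<And>x. x \<ge> x0 \<Longrightarrow> h0 \<le> ?h x \<and> \<kappa> * ?h x \<le> x powr \<alpha> * g"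
    unfolding eventually_conj_iff[symmetric] eventually_at_top_linorder
    by (metis (mono_tags, lifting) eventually_at_top_linorder eventually_conj)
  define u0 where "u0 = max 1 (nat \<lceil>x0\<rceil>)"
  have u0: "1 \<le> u0" by (simp add: u0_def)
  define U where "U = grid row_block u0"
  have Ug: "u0 \<le> U l" "l \<le> U l" for l
    unfolding U_def using grid_ge grid_ge_index[of u0 row_block] row_block_ge_1 by auto
  define r where "r = sqrt (2 * (1 - \<alpha>))"
  define B where "B l = {r * \<tau> * norming (U l) n ..}" for l
  \<comment> \<open>This is \<open>exp (- h) / 2\<close> for \<open>h = (1 - \<alpha>) * ln (u * n)\<close>.\<close>
  define G where "G u = (real u * real n) powr - (1 - \<alpha>) / 2" for u :: nat
  have pl: "G (U l) \<le> prob {\<omega>\<in>space M. psum (win (U l) n) \<omega> \<in> B l}" for l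
  proof -
    define u where "u = U l"
    have u: "1 \<le> u" "x0 \<le> real u" using Ug[of l] u0 by (auto simp: u_def u0_def)
    let ?A = "win u n"
    define h where "h = ?h (real u)"
    have h: "h0 \<le> h" "\<kappa> * h \<le> area u n"
      using x0[OF u(2)] unfolding h_def area_def row_length_def g_def by auto
    note cb = card_win_bounds[OF u(1) n]
    have "G u = exp (- h) / 2"
    proof -
      have "(real u * real n) powr - (1 - \<alpha>) = exp (- (1 - \<alpha>) * ln (real u * real n))"
        using u np by (simp add: powr_def)
      also have "- (1 - \<alpha>) * ln (real u * real n) = - h" unfolding h_def by (simp only: mult_minus_left)
      finally show ?thesis by (simp add: G_def)
    qed
    also have "\<dots> \<le> prob {\<omega>\<in>space M. \<tau> * sqrt (2 * h * card ?A) \<le> psum ?A \<omega>}"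
      using h cb by (intro mod win_subset) auto
    also have "\<dots> \<le> prob {\<omega>\<in>space M. psum ?A \<omega> \<in> B l}"
    proof (intro finite_measure_mono)
      have "r * \<tau> * norming u n = \<tau> * sqrt (2 * h * area u n)"
        unfolding r_def norming_def h_def by (simp add: real_sqrt_mult[symmetric] mult_ac)
      also have "\<dots> \<le> \<tau> * sqrt (2 * h * card ?A)"
        using cb(2) h hk \<tau> by (intro mult_left_mono real_sqrt_le_mono) auto
      finally show "{\<omega>\<in>space M. \<tau> * sqrt (2 * h * card ?A) \<le> psum ?A \<omega>} \<subseteq> {\<omega>\<in>space M. psum ?A \<omega> \<in> B l}"
        by (auto simp: B_def u_def)
      have [measurable]: "psum ?A \<in> borel_measurable M" using win_subset by (rule psum_measurable)
      show "{\<omega>\<in>space M. psum ?A \<omega> \<in> B l} \<in> events" unfolding B_def by measurable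
    qed
    finally show ?thesis by (simp add: u_def)
  qed
  have nsum: "\<not> summable (\<lambda>l. prob {\<omega>\<in>space M. psum (win (U l) n) \<omega> \<in> B l})"
  proof
    assume "summable (\<lambda>l. prob {\<omega>\<in>space M. psum (win (U l) n) \<omega> \<in> B l})"
    then have "summable (\<lambda>l. G (U l))"
      by (rule summable_comparison_test'[where N=0]) (use pl in \<open>auto simp: G_def\<close>)
    \<comment> \<open>A cell has about \<open>u powr \<alpha>\<close> points, so that \<open>G u\<close> dominates the harmonic sum over the cell.\<close>
    then have "summable (\<lambda>m. (real n powr - (1 - \<alpha>) / 4) * inverse (real m))"
      unfolding U_def
    proof (rule summable_of_grid[OF row_block_ge_1])
      fix u assume "u0 \<le> u"
      then have u: "1 \<le> u" using u0 by simp
      let ?c = "real n powr - (1 - \<alpha>) / 4"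
      have "(\<Sum>m\<in>{u..<u + row_block u}. ?c * inverse (real m)) \<le> (\<Sum>m\<in>{u..<u + row_block u}. ?c * inverse (real u))"
        using u by (intro sum_mono mult_left_mono le_imp_inverse_le) auto
      also have "\<dots> = real (row_block u) * (?c * inverse (real u))" by simp
      also have "\<dots> \<le> (2 * row_length \<alpha> u) * (?c * inverse (real u))"
      proof (intro mult_right_mono)
        have "real (row_block u) \<le> row_length \<alpha> u + 1"
          unfolding row_block_def using row_length_ge_1[OF u] by simp
        then show "real (row_block u) \<le> 2 * row_length \<alpha> u" using row_length_ge_1[OF u] by simp
      qed (use u in auto)
      also have "\<dots> = G u"
      proof -
        have "row_length \<alpha> u * inverse (real u) = real u powr - (1 - \<alpha>)"
          using u by (simp add: row_length_def powr_diff divide_inverse)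
        then have "2 * (real n powr - (1 - \<alpha>) / 4) * (row_length \<alpha> u * inverse (real u))
            = 2 * (real n powr - (1 - \<alpha>) / 4) * real u powr - (1 - \<alpha>)" by (rule arg_cong)
        then show ?thesis by (simp add: G_def powr_mult mult_ac)
      qed
      finally show "(\<Sum>m\<in>{u..<u + row_block u}. ?c * inverse (real m)) \<le> G u" .
    qed (auto simp: G_def)
    then have "summable (\<lambda>m. inverse (real m))" using np by simp
    then show False using not_summable_harmonic[where 'a=real] by (simp add: inverse_eq_divide)
  qed
  have z: "prob {\<omega>\<in>space M. \<forall>l\<ge>k. psum (win (U l) n) \<omega> \<notin> B l} = 0" for k
    using prob_avoid_indep_sequence[OF indep_strip[OF u0], of B n k] nsum
    unfolding U_def[symmetric] B_def by auto
  have "AE \<omega> in M. \<not> (\<forall>l\<ge>k. psum (win (U l) n) \<omega> \<notin> B l)" for k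
  proof (rule AE_I')
    have [measurable]: "psum (win (U l) n) \<in> borel_measurable M" for l by (rule psum_measurable[OF win_subset])
    have "{\<omega>\<in>space M. \<forall>l\<ge>k. psum (win (U l) n) \<omega> \<notin> B l} \<in> events" unfolding B_def by measurable
    then show "{\<omega>\<in>space M. \<forall>l\<ge>k. psum (win (U l) n) \<omega> \<notin> B l} \<in> null_sets M"
      by (intro null_setsI) (simp only: emeasure_eq_measure z ennreal_0)
    show "{\<omega>\<in>space M. \<not> \<not> (\<forall>l\<ge>k. psum (win (U l) n) \<omega> \<notin> B l)} \<subseteq> {\<omega>\<in>space M. \<forall>l\<ge>k. psum (win (U l) n) \<omega> \<notin> B l}"
      by (simp only: not_not order_refl)
  qed
  then have "AE \<omega> in M. \<forall>k. \<not> (\<forall>l\<ge>k. psum (win (U l) n) \<omega> \<notin> B l)" by (simp add: AE_all_countable)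
  then show ?thesis
  proof eventually_elim
    case (elim \<omega>)
    show ?case
    proof
      fix k
      obtain l where "l \<ge> k" "psum (win (U l) n) \<omega> \<in> B l" using elim by blast
      then show "\<exists>m\<ge>k. sqrt (2 * (1 - \<alpha>)) * \<tau> * norming m n \<le> psum (win m n) \<omega>"
        using Ug(2)[of l] by (intro exI[of _ "U l"]) (auto simp: B_def r_def)
    qed
  qed
qed

text \<open>
  The converse of the estimate used for the upper bound, for fixed \<open>n\<close>: values up to the norming have a weight of order at most \<open>m\<close>.
\<close>

lemma jump_weight_le_linear:
  assumes n: "3 \<le> n" and C: "0 < C"
  shows "\<exists>D>0. \<exists>m0. \<forall>m\<ge>m0. \<forall>x. 0 \<le> x \<longrightarrow> x \<le> C * norming m n \<longrightarrow> jump_weight x powr (1 / \<alpha>) \<le> D * real m"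
proof -
  define g where "g = col_length n"
  have "0 < area 1 n" using n by (intro area_pos) auto
  then have g: "g > 0" by (simp add: area_def row_length_def g_def)
  have np: "real n > 0" using n by simp
  define E where "E = 8 * C\<^sup>2 * g / \<alpha>"
  have E: "E > 0" using C g \<alpha> by (simp add: E_def)
  have "\<forall>\<^sub>F x::real in at_top. \<alpha> / 8 * ln (x * real n) \<le> ln (C * sqrt (x powr \<alpha> * g * ln (x * real n)))"
    using np g C \<alpha> by real_asymp
  then obtain x0 where x0: "\<And>x::real. x \<ge> x0 \<Longrightarrow> \<alpha> / 8 * ln (x * real n) \<le> ln (C * sqrt (x powr \<alpha> * g * ln (x * real n)))"
    unfolding eventually_at_top_linorder by auto
  define m0 where "m0 = max 1 (nat \<lceil>x0\<rceil>)"
  show ?thesis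
  proof (intro exI[of _ "E powr (1 / \<alpha>)"] conjI exI[of _ m0] allI impI)
    fix m and x :: real assume m: "m0 \<le> m" and x: "0 \<le> x" "x \<le> C * norming m n"
    have m1: "1 \<le> m" "x0 \<le> real m" using m by (auto simp: m0_def)
    let ?y = "C * norming m n"
    define L where "L = ln (real m * real n)"
    have L: "1 \<le> L" unfolding L_def by (rule ln_pos[OF m1(1) n])
    have "\<alpha> / 8 * L \<le> ln ?y"
      using x0[OF m1(2)] unfolding L_def norming_def area_def row_length_def g_def .
    then have lp: "\<alpha> / 8 * L \<le> log_plus ?y" by (simp add: log_plus_def)
    have y2: "?y\<^sup>2 = C\<^sup>2 * (area m n * L)"
      unfolding power_mult_distrib norming_def L_def
      using area_pos[OF m1(1) n] ln_pos[OF m1(1) n] by simp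
    have "jump_weight x \<le> jump_weight ?y" using x by (intro jump_weight_mono)
    also have "\<dots> \<le> ?y\<^sup>2 / (\<alpha> / 8 * L)"
      unfolding jump_weight_def using lp L \<alpha> log_plus_ge_1[of ?y] by (intro divide_left_mono mult_pos_pos) auto
    also have "\<dots> = E * row_length \<alpha> m"
      unfolding y2 area_def g_def[symmetric] E_def using L \<alpha> by (simp add: field_simps)
    finally have "jump_weight x powr (1 / \<alpha>) \<le> (E * row_length \<alpha> m) powr (1 / \<alpha>)"
      using \<alpha> jump_weight_nonneg by (intro powr_mono2) auto
    also have "\<dots> = E powr (1 / \<alpha>) * real m"
      unfolding powr_mult row_length_def powr_powr using \<alpha> by simp
    finally show "jump_weight x powr (1 / \<alpha>) \<le> E powr (1 / \<alpha>) * real m" .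
  qed (use E in auto)
qed

text \<open>
  One value of \<open>n\<close> suffices for the converse.
\<close>

lemma moment_condition_of_strip_bounded:
  assumes n: "3 \<le> n" and C: "0 \<le> C"
    and pos: "0 < prob {\<omega>\<in>space M. \<forall>m\<ge>k. \<bar>psum (win m n) \<omega>\<bar> \<le> C * norming m n}"
  shows "integrable M (\<lambda>\<omega>. jump_weight \<bar>Z \<omega>\<bar> powr (1 / \<alpha>))" "integrable M Z" "expectation Z = 0"
proof -
  define g where "g = col_length n"
  have "0 < area 1 n" using n by (intro area_pos) auto
  then have g: "g > 0" by (simp add: area_def row_length_def g_def)
  have np: "real n > 0" using n by simp
  have inf: "filterlim (\<lambda>m. norming m n) at_top sequentially"
  proof -
    have "filterlim (\<lambda>x::real. sqrt (x powr \<alpha> * g * ln (x * real n))) at_top at_top"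
      using np g \<alpha> by real_asymp
    then have "filterlim (\<lambda>m. sqrt (real m powr \<alpha> * g * ln (real m * real n))) at_top sequentially"
      by (rule filterlim_compose[OF _ filterlim_real_sequentially])
    then show ?thesis by (simp add: norming_def area_def row_length_def g_def)
  qed
  define U where "U = grid row_block 1"
  have U1: "1 \<le> U l" "l \<le> U l" for l
    unfolding U_def using grid_ge grid_ge_index[of 1 row_block] row_block_ge_1 by auto
  have Uinf: "filterlim U at_top sequentially"
    unfolding filterlim_at_top
  proof
    fix Q show "\<forall>\<^sub>F l in sequentially. Q \<le> U l"
      using eventually_ge_at_top[of Q] by eventually_elim (use U1(2) order_trans in blast)
  qed
  have [measurable]: "psum (win m n) \<in> borel_measurable M" for m by (rule psum_measurable[OF win_subset])
  define p where "p l = prob {\<omega>\<in>space M. C * norming (U l) n < \<bar>psum (win (U l) n) \<omega>\<bar>}" for l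
  \<comment> \<open>Otherwise infinitely many of the independent window sums would be large almost surely.\<close>
  have sp: "summable p"
  proof (rule ccontr)
    assume "\<not> summable p"
    then have "\<not> summable (\<lambda>l. prob {\<omega>\<in>space M. psum (win (U l) n) \<omega> \<in> {x. C * norming (U l) n < \<bar>x\<bar>}})"
      by (simp add: p_def[abs_def])
    then have "prob {\<omega>\<in>space M. \<forall>l\<ge>k. psum (win (U l) n) \<omega> \<notin> {x. C * norming (U l) n < \<bar>x\<bar>}} = 0"
      unfolding U_def by (intro prob_avoid_indep_sequence indep_strip) auto
    moreover have "prob {\<omega>\<in>space M. \<forall>m\<ge>k. \<bar>psum (win m n) \<omega>\<bar> \<le> C * norming m n}
        \<le> prob {\<omega>\<in>space M. \<forall>l\<ge>k. psum (win (U l) n) \<omega> \<notin> {x. C * norming (U l) n < \<bar>x\<bar>}}"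
    proof (intro finite_measure_mono subsetI)
      fix \<omega> assume w: "\<omega> \<in> {\<omega>\<in>space M. \<forall>m\<ge>k. \<bar>psum (win m n) \<omega>\<bar> \<le> C * norming m n}"
      have "\<bar>psum (win (U l) n) \<omega>\<bar> \<le> C * norming (U l) n" if "k \<le> l" for l
        using w order_trans[OF that U1(2)[of l]] by blast
      then show "\<omega> \<in> {\<omega>\<in>space M. \<forall>l\<ge>k. psum (win (U l) n) \<omega> \<notin> {x. C * norming (U l) n < \<bar>x\<bar>}}"
        using w by (simp add: not_less)
    qed measurable
    ultimately show False using pos by simp
  qed
  have p0: "p \<longlonglongrightarrow> 0" using sp by (rule summable_LIMSEQ_zero)
  define C' where "C' = 3 * (C + 1)"
  have C': "C' > 0" using C by (simp add: C'_def)
  define H where "H m = prob {\<omega>\<in>space M. C' * norming m n < \<bar>Z \<omega>\<bar>}" for m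
  obtain y0 where y0: "\<And>x. x \<ge> y0 \<Longrightarrow> prob {\<omega>\<in>space M. x < \<bar>Z \<omega>\<bar>} < 1/16"
    using exists_small_tail[OF Z_measurable, of "1/16"] by auto
  have "\<forall>\<^sub>F l in sequentially. y0 \<le> norming (U l) n"
    using filterlim_compose[OF inf Uinf] by (simp add: filterlim_at_top)
  moreover have "\<forall>\<^sub>F l in sequentially. p l < 1/16" using p0 by (rule order_tendstoD) simp
  ultimately have ev: "\<forall>\<^sub>F l in sequentially. real (row_block (U l)) * H (U l) \<le> 2 * p l"
  proof eventually_elim
    case (elim l)
    let ?A = "win (U l) n"
    have nn: "0 \<le> norming (U l) n" using norming_pos[OF U1(1) n] by (simp add: less_imp_le)
    note cb = card_win_bounds[OF U1(1) n]
    have "real (card ?A) * prob {\<omega>\<in>space M. 3 * (C * norming (U l) n + norming (U l) n) < \<bar>Z \<omega>\<bar>}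
       \<le> 2 * prob {\<omega>\<in>space M. C * norming (U l) n < \<bar>psum ?A \<omega>\<bar>}"
      using elim y0[of "norming (U l) n"] nn C cb(1) win_subset
      by (intro single_jump_bound) (auto simp: p_def less_imp_le)
    also have "3 * (C * norming (U l) n + norming (U l) n) = C' * norming (U l) n"
      by (simp add: C'_def algebra_simps)
    finally have "real (card ?A) * H (U l) \<le> 2 * p l" by (simp add: H_def p_def)
    moreover have "real (row_block (U l)) * H (U l) \<le> real (card ?A) * H (U l)"
      using cb(3) by (intro mult_right_mono) (auto simp: H_def)
    ultimately show ?case by simp
  qed
  have "summable (\<lambda>l. real (row_block (U l)) * H (U l))"
  proof (rule summable_comparison_test_ev[OF _ summable_mult[OF sp, of 2]])
    show "\<forall>\<^sub>F l in sequentially. norm (real (row_block (U l)) * H (U l)) \<le> 2 * p l"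
      using ev by eventually_elim (simp add: H_def)
  qed
  then have sH: "summable H"
    unfolding U_def
  proof (rule summable_of_grid[OF row_block_ge_1])
    fix u :: nat assume u: "1 \<le> u"
    have "(\<Sum>m\<in>{u..<u + row_block u}. H m) \<le> (\<Sum>m\<in>{u..<u + row_block u}. H u)"
    proof (rule sum_mono)
      fix m assume "m \<in> {u..<u + row_block u}"
      then have "C' * norming u n \<le> C' * norming m n" using u n C' by (intro mult_left_mono norming_mono) auto
      then show "H m \<le> H u" unfolding H_def by (intro finite_measure_mono) auto
    qed
    then show "(\<Sum>m\<in>{u..<u + row_block u}. H m) \<le> real (row_block u) * H u" by simp
  qed (auto simp: H_def)
  let ?f = "\<lambda>\<omega>. jump_weight \<bar>Z \<omega>\<bar> powr (1 / \<alpha>)"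
  have [measurable]: "jump_weight \<in> borel_measurable borel"
    unfolding jump_weight_def[abs_def] log_plus_def[abs_def] by measurable
  obtain D m0 where D: "D > 0" and m0: "\<And>m x. m0 \<le> m \<Longrightarrow> 0 \<le> x \<Longrightarrow> x \<le> C' * norming m n \<Longrightarrow> jump_weight x powr (1 / \<alpha>) \<le> D * real m"
    using jump_weight_le_linear[OF n C'] by blast
  show int: "integrable M ?f"
  proof (rule integrable_of_summable_tails[OF _ _ D])
    show "summable (\<lambda>m. prob {\<omega>\<in>space M. D * real m < ?f \<omega>})"
    proof (rule summable_comparison_test_ev[OF _ sH])
      show "\<forall>\<^sub>F m in sequentially. norm (prob {\<omega>\<in>space M. D * real m < ?f \<omega>}) \<le> H m"
        using eventually_ge_at_top[of m0]
      proof eventually_elim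
        case (elim m)
        have "prob {\<omega>\<in>space M. D * real m < ?f \<omega>} \<le> H m"
          unfolding H_def
        proof (intro finite_measure_mono subsetI)
          fix \<omega> assume "\<omega> \<in> {\<omega>\<in>space M. D * real m < ?f \<omega>}"
          then show "\<omega> \<in> {\<omega>\<in>space M. C' * norming m n < \<bar>Z \<omega>\<bar>}"
            using m0[OF elim, of "\<bar>Z \<omega>\<bar>"] by fastforce
        qed measurable
        then show ?case by simp
      qed
    qed
  qed auto
  have Z2: "integrable M (\<lambda>\<omega>. (Z \<omega>)\<^sup>2)" by (rule moments_of_jump_weight(2)[OF Z_measurable \<alpha> int])
  show iZ: "integrable M Z" using Z2 by (rule square_integrable_imp_integrable[rotated]) auto
  show "expectation Z = 0"
  proof (rule ccontr)
    define \<mu> where "\<mu> = expectation Z"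
    assume "expectation Z \<noteq> 0"
    then have \<mu>: "\<mu> \<noteq> 0" by (simp add: \<mu>_def)
    \<comment> \<open>The centred array is again an i.i.d. family; the Chebyshev inequality for it plays the role of the law of large numbers.\<close>
    have cI: "iid_family M (\<lambda>i \<omega>. X i \<omega> - \<mu>) ({1..} \<times> {1..}) (\<lambda>\<omega>. Z \<omega> - \<mu>)"
    proof (unfold_locales)
      show "indep_vars (\<lambda>_. borel) (\<lambda>i \<omega>. X i \<omega> - \<mu>) ({1..} \<times> {1..})"
        by (rule indep_vars_compose2[OF indep, where Y="\<lambda>_ x. x - \<mu>"]) auto
      fix i :: "nat \<times> nat" assume i: "i \<in> {1..} \<times> {1..}"
      have [measurable]: "X i \<in> borel_measurable M" using i by (rule X_measurable)
      have "distr M borel (\<lambda>\<omega>. X i \<omega> - \<mu>) = distr (distr M borel (X i)) borel (\<lambda>x. x - \<mu>)"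
        by (subst distr_distr) (auto simp: comp_def)
      also have "\<dots> = distr M borel (\<lambda>\<omega>. Z \<omega> - \<mu>)"
        unfolding ident[OF i] by (subst distr_distr) (auto simp: comp_def)
      finally show "distr M borel (\<lambda>\<omega>. X i \<omega> - \<mu>) = distr M borel (\<lambda>\<omega>. Z \<omega> - \<mu>)" .
    qed auto
    interpret c: iid_family M "\<lambda>i \<omega>. X i \<omega> - \<mu>" "{1..} \<times> {1..}" "\<lambda>\<omega>. Z \<omega> - \<mu>" by (rule cI)
    have cps: "c.psum A \<omega> = psum A \<omega> - real (card A) * \<mu>" for A \<omega>
      by (simp add: c.psum_def psum_def sum_subtractf)
    have cZ2: "integrable M (\<lambda>\<omega>. (Z \<omega> - \<mu>)\<^sup>2)" using iZ Z2 by (simp add: power2_diff)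
    have cZ0: "expectation (\<lambda>\<omega>. Z \<omega> - \<mu>) = 0" using iZ by (simp add: \<mu>_def prob_space)
    define v where "v = expectation (\<lambda>\<omega>. (Z \<omega> - \<mu>)\<^sup>2)"
    have v: "v \<ge> 0" unfolding v_def by (intro integral_nonneg_AE) auto
    have "((\<lambda>x::real. C * sqrt (x powr \<alpha> * g * ln (x * real n)) / (x powr \<alpha> * g)) \<longlongrightarrow> 0) at_top"
      "((\<lambda>x::real. (4 * v / \<mu>\<^sup>2) / (x powr \<alpha> * g)) \<longlongrightarrow> 0) at_top"
      using np g \<alpha> by real_asymp+
    then have lim: "((\<lambda>m. C * norming m n / area m n) \<longlonglongrightarrow> 0)" "((\<lambda>m. (4 * v / \<mu>\<^sup>2) / area m n) \<longlonglongrightarrow> 0)"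
      unfolding norming_def area_def row_length_def g_def[symmetric]
      by (auto dest: filterlim_compose[OF _ filterlim_real_sequentially])
    have "\<forall>\<^sub>F l in sequentially. C * norming (U l) n / area (U l) n < \<bar>\<mu>\<bar> / 2"
      using filterlim_compose[OF lim(1) Uinf] \<mu> by (intro order_tendstoD) auto
    moreover have "\<forall>\<^sub>F l in sequentially. (4 * v / \<mu>\<^sup>2) / area (U l) n < 1/2"
      using filterlim_compose[OF lim(2) Uinf] by (intro order_tendstoD) auto
    moreover have "\<forall>\<^sub>F l in sequentially. p l < 1/2" using p0 by (rule order_tendstoD) simp
    ultimately have "\<forall>\<^sub>F l in sequentially. False"
    proof eventually_elim
      case (elim l)
      let ?A = "win (U l) n"
      note cb = card_win_bounds[OF U1(1) n]
      have ap: "0 < area (U l) n" by (rule area_pos[OF U1(1) n])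
      define K where "K = real (card ?A)"
      have K: "area (U l) n \<le> K" "0 < K" using cb(2)[of l] ap by (auto simp: K_def)
      let ?y = "K * \<bar>\<mu>\<bar> / 2"
      have y: "?y > 0" using K \<mu> by simp
      have [measurable]: "c.psum ?A \<in> borel_measurable M" by (rule c.psum_measurable[OF win_subset])
      have "prob {\<omega>\<in>space M. ?y \<le> \<bar>c.psum ?A \<omega>\<bar>} \<le> K * v / ?y\<^sup>2"
        unfolding K_def v_def using y cb(1) by (intro c.psum_tail_Chebyshev win_subset cZ2 cZ0) (auto simp: K_def)
      also have "\<dots> = (4 * v / \<mu>\<^sup>2) / K" using K \<mu> by (simp add: power2_eq_square field_simps)
      also have "\<dots> \<le> (4 * v / \<mu>\<^sup>2) / area (U l) n" using K ap v by (intro divide_left_mono) auto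
      finally have q: "prob {\<omega>\<in>space M. ?y \<le> \<bar>c.psum ?A \<omega>\<bar>} < 1/2" using elim by simp
      have "prob (space M) \<le> prob ({\<omega>\<in>space M. ?y \<le> \<bar>c.psum ?A \<omega>\<bar>} \<union> {\<omega>\<in>space M. C * norming (U l) n < \<bar>psum ?A \<omega>\<bar>})"
      proof (intro finite_measure_mono subsetI)
        fix \<omega> assume w: "\<omega> \<in> space M"
        have "C * norming (U l) n < ?y"
        proof -
          have "C * norming (U l) n < \<bar>\<mu>\<bar> / 2 * area (U l) n" using elim(1) ap by (simp add: divide_less_eq)
          also have "\<dots> \<le> \<bar>\<mu>\<bar> / 2 * K" using K by (intro mult_left_mono) auto
          finally show ?thesis by (simp add: mult.commute)
        qed
        moreover have "K * \<bar>\<mu>\<bar> \<le> \<bar>c.psum ?A \<omega>\<bar> + \<bar>psum ?A \<omega>\<bar>"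
        proof -
          have "K * \<bar>\<mu>\<bar> = \<bar>K * \<mu>\<bar>" using K by (simp add: abs_mult)
          also have "K * \<mu> = psum ?A \<omega> - c.psum ?A \<omega>" by (simp add: cps K_def)
          finally show ?thesis by simp
        qed
        ultimately show "\<omega> \<in> {\<omega>\<in>space M. ?y \<le> \<bar>c.psum ?A \<omega>\<bar>} \<union> {\<omega>\<in>space M. C * norming (U l) n < \<bar>psum ?A \<omega>\<bar>}"
          using w by auto
      qed measurable
      also have "\<dots> \<le> prob {\<omega>\<in>space M. ?y \<le> \<bar>c.psum ?A \<omega>\<bar>} + p l"
        unfolding p_def by (intro measure_Un_le) measurable
      finally show False using q elim(3) by (simp add: prob_space)
    qed
    then show False by simp
  qed
qed

end

section \<open>Double upper limits and both parts of the theorem\<close>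

lemma limsup2_le:
  assumes "\<And>m n. k \<le> m \<Longrightarrow> k \<le> n \<Longrightarrow> f m n \<le> c"
  shows "limsup2 f \<le> c"
  unfolding limsup2_eq_INF using assms by (intro INF_lower2[of k] SUP_least) auto

lemma limsup2_ge:
  assumes "\<And>k. \<exists>m\<ge>k. \<exists>n\<ge>k. c \<le> f m n"
  shows "c \<le> limsup2 f"
  unfolding limsup2_eq_INF
proof (rule INF_greatest)
  fix k :: nat
  obtain m n where "k \<le> m" "k \<le> n" "c \<le> f m n" using assms by blast
  then show "c \<le> (SUP (m, n)\<in>{k..} \<times> {k..}. f m n)" by (intro SUP_upper2[of "(m, n)"]) auto
qed

lemma limsup2_finite_bound:
  assumes "limsup2 f < \<infinity>"
  obtains k C :: nat where "\<And>m n. k \<le> m \<Longrightarrow> k \<le> n \<Longrightarrow> f m n \<le> ereal (real C)"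
proof -
  obtain k where k: "(SUP (m, n)\<in>{k..} \<times> {k..}. f m n) < \<infinity>"
    using assms unfolding limsup2_eq_INF INF_less_iff by blast
  then obtain C :: nat where C: "(SUP (m, n)\<in>{k..} \<times> {k..}. f m n) < ereal (real C)"
    using less_PInf_Ex_of_nat by auto
  show thesis
  proof
    fix m n assume mn: "k \<le> m" "k \<le> n"
    have "f m n \<le> (SUP (m, n)\<in>{k..} \<times> {k..}. f m n)"
      using mn by (intro SUP_upper2[of "(m, n)"]) auto
    then show "f m n \<le> ereal (real C)" using C by simp
  qed
qed

context iid_array
begin

text \<open>
  The identities for the sum and for the two denominators hold for all \<open>m\<close> and \<open>n\<close>, including those with \<open>ln n = 0\<close>, where both sides
  of the latter are \<open>0\<close>.
\<close>

lemma delayed_sum_eq_psum: "delayed_sum \<alpha> X m n \<omega> = psum (win m n) \<omega>"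
  unfolding delayed_sum_def psum_def win_def window_def row_length_def col_length_def
  by (simp add: sum.cartesian_product)

lemma direct_denominator:
  "sqrt (2 * real m powr \<alpha> * real n * ((1 - \<alpha>) * ln (real m * real n) / ln (real n)))
    = sqrt (2 * (1 - \<alpha>)) * norming m n"
  unfolding norming_def area_def row_length_def col_length_def real_sqrt_mult[symmetric]
  by (rule arg_cong[where f=sqrt]) (simp add: mult_ac)

lemma converse_denominator:
  "sqrt (real m powr \<alpha> * real n * (ln (real m * real n) / ln (real n))) = norming m n"
  unfolding norming_def area_def row_length_def col_length_def
  by (rule arg_cong[where f=sqrt]) (simp add: mult_ac)

lemma all_terms_zero:
  assumes Z2: "integrable M (\<lambda>\<omega>. (Z \<omega>)\<^sup>2)" and var: "expectation (\<lambda>\<omega>. (Z \<omega>)\<^sup>2) = 0"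
  shows "AE \<omega> in M. \<forall>m n. psum (win m n) \<omega> = 0"
proof -
  have "AE \<omega> in M. X k \<omega> = 0" if k: "k \<in> {1..} \<times> {1..}" for k
  proof -
    have i: "integrable M (\<lambda>\<omega>. (X k \<omega>)\<^sup>2)" "expectation (\<lambda>\<omega>. (X k \<omega>)\<^sup>2) = 0"
      using integrable_X[OF k, of "\<lambda>x. x\<^sup>2"] expectation_X[OF k, of "\<lambda>x. x\<^sup>2"] Z2 var by auto
    have "AE \<omega> in M. (X k \<omega>)\<^sup>2 = 0"
      using integral_nonneg_eq_0_iff_AE[OF i(1)] i(2) by simp
    then show ?thesis by simp
  qed
  then have "AE \<omega> in M. \<forall>k\<in>{1..} \<times> {1..}. X k \<omega> = 0"
    by (intro AE_ball_countable[THEN iffD2]) auto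
  then show ?thesis
  proof eventually_elim
    case (elim \<omega>)
    show ?case
      unfolding psum_def using elim win_subset by (intro allI sum.neutral) blast
  qed
qed

lemma limsup2_window_sums:
  assumes int: "integrable M (\<lambda>\<omega>. jump_weight \<bar>Z \<omega>\<bar> powr (1 / \<alpha>))" and Z0: "expectation Z = 0"
    and var: "expectation (\<lambda>\<omega>. (Z \<omega>)\<^sup>2) = \<sigma>\<^sup>2" and \<sigma>: "0 \<le> \<sigma>"
  shows "AE \<omega> in M. limsup2 (\<lambda>m n. ereal (psum (win m n) \<omega> / (sqrt (2 * (1 - \<alpha>)) * norming m n))) = ereal \<sigma>"
proof -
  define r where "r = sqrt (2 * (1 - \<alpha>))"
  have r: "r > 0" using \<alpha> by (simp add: r_def)
  note mom = moments_of_jump_weight[OF Z_measurable \<alpha> int]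
  let ?q = "\<lambda>\<omega> m n. psum (win m n) \<omega> / (r * norming m n)"
  have p: "2 < 1 + 1 / \<alpha>" using \<alpha> by (simp add: field_simps)
  have "AE \<omega> in M. \<forall>i::nat. \<exists>k. \<forall>m\<ge>k. \<forall>n\<ge>k. psum (win m n) \<omega> \<le> r * (\<sigma> + 1 / real (Suc i)) * norming m n"
    unfolding AE_all_countable r_def
  proof
    fix i :: nat
    let ?s = "\<sigma> + 1 / (2 * real (Suc i))"
    show "AE \<omega> in M. \<exists>k. \<forall>m\<ge>k. \<forall>n\<ge>k. psum (win m n) \<omega> \<le> sqrt (2 * (1 - \<alpha>)) * (\<sigma> + 1 / real (Suc i)) * norming m n"
    proof (rule eventually_psum_le[OF mom(2) Z0 _ _ _ p mom(1) int])
      show "expectation (\<lambda>\<omega>. (Z \<omega>)\<^sup>2) \<le> ?s\<^sup>2" unfolding var using \<sigma> by (intro power_mono) auto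
      show "0 < ?s" using \<sigma> by (intro add_nonneg_pos) auto
      show "?s < \<sigma> + 1 / real (Suc i)" by (simp add: field_simps)
    qed
  qed
  then have upper: "AE \<omega> in M. limsup2 (\<lambda>m n. ereal (?q \<omega> m n)) \<le> ereal \<sigma>"
  proof eventually_elim
    case (elim \<omega>)
    show ?case
    proof (rule ereal_le_epsilon2)
      fix e :: real assume "0 < e"
      then obtain i where i: "inverse (real (Suc i)) < e" using reals_Archimedean by blast
      obtain k where k: "\<And>m n. k \<le> m \<Longrightarrow> k \<le> n \<Longrightarrow> psum (win m n) \<omega> \<le> r * (\<sigma> + 1 / real (Suc i)) * norming m n"
        using elim by blast
      have "limsup2 (\<lambda>m n. ereal (?q \<omega> m n)) \<le> ereal (\<sigma> + 1 / real (Suc i))"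
      proof (rule limsup2_le[of "max k 3"])
        fix m n assume "max k 3 \<le> m" "max k 3 \<le> n"
        then have mn: "k \<le> m" "k \<le> n" "1 \<le> m" "3 \<le> n" by auto
        have "0 < r * norming m n" using r norming_pos[OF mn(3,4)] by simp
        then show "ereal (?q \<omega> m n) \<le> ereal (\<sigma> + 1 / real (Suc i))"
          using k[OF mn(1,2)] by (simp add: divide_le_eq mult_ac del: of_nat_Suc)
      qed
      also have "\<dots> \<le> ereal (\<sigma> + e)" using i by (simp add: inverse_eq_divide)
      finally show "limsup2 (\<lambda>m n. ereal (?q \<omega> m n)) \<le> ereal \<sigma> + ereal e" by simp
    qed
  qed
  \<comment> \<open>For \<open>\<sigma> = 0\<close> all summands vanish almost surely; this case is not covered by the central limit theorem.\<close>
  have lower: "AE \<omega> in M. ereal \<sigma> \<le> limsup2 (\<lambda>m n. ereal (?q \<omega> m n))"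
  proof (cases "\<sigma> = 0")
    case True
    then have "AE \<omega> in M. \<forall>m n. psum (win m n) \<omega> = 0"
      using all_terms_zero[OF mom(2)] var by simp
    then show ?thesis
      by eventually_elim (use True in \<open>auto intro!: limsup2_ge\<close>)
  next
    case False
    then have \<sigma>0: "\<sigma> > 0" using \<sigma> by simp
    let ?t = "\<lambda>i::nat. \<sigma> - \<sigma> / real (i + 2)"
    have t: "0 < ?t i" "?t i < \<sigma>" for i using \<sigma>0 by (auto simp: field_simps intro!: add_pos_nonneg)
    have "AE \<omega> in M. \<forall>k. \<exists>m\<ge>k. r * ?t i * norming m (n + 3) \<le> psum (win m (n + 3)) \<omega>" for i n
      unfolding r_def by (rule frequently_psum_ge[OF mom(2) Z0 var t]) simp
    then have "AE \<omega> in M. \<forall>n. \<forall>k. \<exists>m\<ge>k. r * ?t i * norming m (n + 3) \<le> psum (win m (n + 3)) \<omega>" for i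
      by (rule AE_all_countable[THEN iffD2, OF allI])
    then have "AE \<omega> in M. \<forall>i. \<forall>n. \<forall>k. \<exists>m\<ge>k. r * ?t i * norming m (n + 3) \<le> psum (win m (n + 3)) \<omega>"
      by (rule AE_all_countable[THEN iffD2, OF allI])
    then show ?thesis
    proof eventually_elim
      case (elim \<omega>)
      show ?case
      proof (rule ereal_le_epsilon2)
        fix e :: real assume e: "0 < e"
        then obtain i where "inverse (real (Suc i)) < e / \<sigma>" using reals_Archimedean[of "e / \<sigma>"] \<sigma>0 by auto
        then have "\<sigma> / real (Suc i) < e" using \<sigma>0 by (simp add: field_simps)
        moreover have "\<sigma> / real (i + 2) \<le> \<sigma> / real (Suc i)" using \<sigma>0 by (intro divide_left_mono) auto
        ultimately have i: "\<sigma> \<le> ?t i + e" by simp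
        have "ereal (?t i) \<le> limsup2 (\<lambda>m n. ereal (?q \<omega> m n))"
        proof (rule limsup2_ge)
          fix k
          obtain m where m: "m \<ge> max k 1" "r * ?t i * norming m (k + 3) \<le> psum (win m (k + 3)) \<omega>"
            using elim by blast
          have "0 < r * norming m (k + 3)" using r norming_pos[of m "k + 3"] m by simp
          then have "?t i \<le> ?q \<omega> m (k + 3)"
            using m(2) by (simp add: le_divide_eq mult_ac)
          then show "\<exists>m\<ge>k. \<exists>n\<ge>k. ereal (?t i) \<le> ereal (?q \<omega> m n)"
            using m(1) by (intro exI[of _ m] conjI exI[of _ "k + 3"]) auto
        qed
        then have le: "ereal (?t i) + ereal e \<le> limsup2 (\<lambda>m n. ereal (?q \<omega> m n)) + ereal e"
          by (rule add_right_mono)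
        have "ereal \<sigma> \<le> ereal (?t i + e)" using i by (simp only: ereal_less_eq)
        also have "\<dots> = ereal (?t i) + ereal e" by (rule plus_ereal.simps(1)[symmetric])
        also note le
        finally show "ereal \<sigma> \<le> limsup2 (\<lambda>m n. ereal (?q \<omega> m n)) + ereal e" .
      qed
    qed
  qed
  show ?thesis
    unfolding r_def[symmetric] using upper lower by eventually_elim (rule antisym)
qed

lemma moment_condition_of_limsup2_finite:
  assumes pos: "0 < prob {\<omega>\<in>space M. limsup2 (\<lambda>m n. ereal (\<bar>psum (win m n) \<omega>\<bar> / norming m n)) < \<infinity>}"
  shows "integrable M (\<lambda>\<omega>. jump_weight \<bar>Z \<omega>\<bar> powr (1 / \<alpha>)) \<and> integrable M Z \<and> expectation Z = 0"
proof -
  define E where "E k C = {\<omega>\<in>space M. \<forall>m\<ge>k + 3. \<bar>psum (win m (k + 3)) \<omega>\<bar> \<le> real C * norming m (k + 3)}" for k C :: nat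
  have E: "E k C \<in> events" for k C
  proof -
    have [measurable]: "psum (win m n) \<in> borel_measurable M" for m n by (rule psum_measurable[OF win_subset])
    show ?thesis unfolding E_def by measurable
  qed
  have sub: "{\<omega>\<in>space M. limsup2 (\<lambda>m n. ereal (\<bar>psum (win m n) \<omega>\<bar> / norming m n)) < \<infinity>} \<subseteq> (\<Union>k. \<Union>C. E k C)"
  proof
    fix \<omega> assume "\<omega> \<in> {\<omega>\<in>space M. limsup2 (\<lambda>m n. ereal (\<bar>psum (win m n) \<omega>\<bar> / norming m n)) < \<infinity>}"
    then have w: "\<omega> \<in> space M" "limsup2 (\<lambda>m n. ereal (\<bar>psum (win m n) \<omega>\<bar> / norming m n)) < \<infinity>" by auto
    obtain k C :: nat where kC: "\<And>m n. k \<le> m \<Longrightarrow> k \<le> n \<Longrightarrow> ereal (\<bar>psum (win m n) \<omega>\<bar> / norming m n) \<le> ereal (real C)"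
      using limsup2_finite_bound[OF w(2)] by blast
    have "\<bar>psum (win m (k + 3)) \<omega>\<bar> \<le> real C * norming m (k + 3)" if "k + 3 \<le> m" for m
    proof -
      have "0 < norming m (k + 3)" using that by (intro norming_pos) auto
      then show ?thesis using kC[of m "k + 3"] that by (simp add: divide_le_eq)
    qed
    then have "\<omega> \<in> E k C" using w by (simp add: E_def)
    then show "\<omega> \<in> (\<Union>k. \<Union>C. E k C)" by blast
  qed
  have "\<exists>k C. 0 < prob (E k C)"
  proof (rule ccontr)
    assume "\<not> ?thesis"
    then have "E k C \<in> null_sets M" for k C
      using E[of k C] by (auto simp: null_sets_def emeasure_eq_measure not_less measure_le_0_iff)
    then have "(\<Union>k. \<Union>C. E k C) \<in> null_sets M" by (intro null_sets_UN) auto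
    then have "prob (\<Union>k. \<Union>C. E k C) = 0" by (auto simp: measure_def)
    moreover have "prob {\<omega>\<in>space M. limsup2 (\<lambda>m n. ereal (\<bar>psum (win m n) \<omega>\<bar> / norming m n)) < \<infinity>} \<le> prob (\<Union>k. \<Union>C. E k C)"
      using E by (intro finite_measure_mono[OF sub]) auto
    ultimately show False using pos by simp
  qed
  then obtain k C where "0 < prob (E k C)" by blast
  then show ?thesis using moment_condition_of_strip_bounded[of "k + 3" "real C" "k + 3"] unfolding E_def by auto
qed

end

theorem theorem5p1:
  fixes M :: "'a measure"
    and X0 :: "'a \<Rightarrow> real"
    and X :: "nat \<times> nat \<Rightarrow> 'a \<Rightarrow> real"
    and \<alpha> \<sigma> :: real
  assumes "prob_space M"
    and "0 < \<alpha>" and "\<alpha> < 1"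
    and "X0 \<in> borel_measurable M"
    and "prob_space.indep_vars M (\<lambda>_. borel) X ({1..} \<times> {1..})"
    and "\<And>i j. 1 \<le> i \<Longrightarrow> 1 \<le> j \<Longrightarrow> distr M borel (X (i, j)) = distr M borel X0"
  shows "(integrable M (\<lambda>\<omega>. \<bar>X0 \<omega>\<bar> powr (2 / \<alpha>) * log_plus \<bar>X0 \<omega>\<bar> powr (- (1 / \<alpha>))) \<and>
          integrable M X0 \<and> integral\<^sup>L M X0 = 0 \<and>
          integrable M (\<lambda>\<omega>. (X0 \<omega>)\<^sup>2) \<and> integral\<^sup>L M (\<lambda>\<omega>. (X0 \<omega>)\<^sup>2) = \<sigma>\<^sup>2 \<and> 0 \<le> \<sigma>
         \<longrightarrow> (AE \<omega> in M.
               limsup2 (\<lambda>m n. ereal (delayed_sum \<alpha> X m n \<omega> /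
                 sqrt (2 * real m powr \<alpha> * real n *
                   ((1 - \<alpha>) * ln (real m * real n) / ln (real n))))) = ereal \<sigma>)) \<and>
         (measure M {\<omega> \<in> space M.
            limsup2 (\<lambda>m n. ereal (\<bar>delayed_sum \<alpha> X m n \<omega>\<bar> /
              sqrt (real m powr \<alpha> * real n * (ln (real m * real n) / ln (real n))))) < \<infinity>} > 0
         \<longrightarrow> integrable M (\<lambda>\<omega>. \<bar>X0 \<omega>\<bar> powr (2 / \<alpha>) * log_plus \<bar>X0 \<omega>\<bar> powr (- (1 / \<alpha>))) \<and>
             integrable M X0 \<and> integral\<^sup>L M X0 = 0)"
proof -
  interpret iid_array M X X0 \<alpha>
  proof (intro iid_array.intro iid_family.intro iid_array_axioms.intro iid_family_axioms.intro)
    fix i :: "nat \<times> nat" assume "i \<in> {1..} \<times> {1..}"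
    then show "distr M borel (X i) = distr M borel X0" using assms(6) by (cases i) auto
  qed (use assms in auto)
  have *: "(\<lambda>\<omega>. \<bar>X0 \<omega>\<bar> powr (2 / \<alpha>) * log_plus \<bar>X0 \<omega>\<bar> powr (- (1 / \<alpha>))) =
      (\<lambda>\<omega>. jump_weight \<bar>X0 \<omega>\<bar> powr (1 / \<alpha>))"
    unfolding moment_weight_eq ..
  show ?thesis
    unfolding * delayed_sum_eq_psum direct_denominator converse_denominator
    using limsup2_window_sums[of \<sigma>] moment_condition_of_limsup2_finite by blast
qed

end
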